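(* The progressive waves in $\mathcal{E}$ with a finite number of zeros of the system $$i\partial_t u=\Pi(|v|^2u),\qquad i\partial_t v=-\Pi(|u|^2v)\qquad(\ast)$$ are given by the following initial conditions. Precisely, let $U,V\in\mathcal{E}$ each have finitely many zeros in $\mathbb{C}$, let $(\lambda,\mu)\in\mathbb{R}^2$ and $\alpha\in\mathbb{C}$. Then $(U,V)$ is the initial condition of a progressive wave of $(\ast)$ with parameters $(\lambda,\mu,\alpha)$ if and only if one of the following holds: (i) (case $\alpha=0$) $$U=Ae^{i\theta_1}\varphi_{n_1}^{\gamma},\qquad V=Be^{i\theta_2}\varphi_{n_2}^{\gamma}$$ for some $A,B>0$, $n_1,n_2\in\mathbb{N}=\{0,1,2,\dots\}$, $\theta_1,\theta_2\in\mathbb{R}$, $\gamma\in\mathbb{C}$, with $$\alpha=0,\qquad\lambda=\frac{(n_1+n_2)!}{2^{n_1+n_2+1}\pi\,n_1!\,n_2!}B^2,\qquad\mu=-\frac{(n_1+n_2)!}{2^{n_1+n_2+1}\pi\,n_1!\,n_2!}A^2;$$ (ii) (case $\alpha\neq0$) $$U=Ke^{i\theta_1}\Big(\frac12\varphi_0^\gamma+\frac{\sqrt3}{2}ie^{i\theta}\varphi_1^\gamma\Big),\qquad V=Ke^{i\theta_2}\Big(\frac12\varphi_0^\gamma-\frac{\sqrt3}{2}ie^{i\theta}\varphi_1^\gamma\Big)$$ for some $K>0$, $\theta,\theta_1,\theta_2\in\mathbb{R}$, $\gamma\in\mathbb{C}$, with $$\lambda=\frac{K^2}{32\pi}\big(7+2\sqrt3\,\mathrm{Im}(\gamma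 e^{-i\theta})\big),\qquad\mu=\frac{K^2}{32\pi}\big(-7+2\sqrt3\,\mathrm{Im}(\gamma e^{-i\theta})\big),\qquad\alpha=\frac{\sqrt3}{32\pi}K^2e^{-i\theta}.$$
   Context: $L$ is Lebesgue measure on $\mathbb{C}$. The Bargmann-Fock space is $\mathcal{E}=\{u(z)=e^{-|z|^2/2}f(z):\ f \text{ entire holomorphic}\}\cap L^2(\mathbb{C})$. $\Pi$ is the orthogonal projection onto $\mathcal{E}$, given by $[\Pi u](z)=\frac1\pi e^{-|z|^2/2}\int_{\mathbb{C}}e^{\overline{w}z-|w|^2/2}u(w)\,dL(w)$. For $n\in\mathbb{N}$ and $\gamma\in\mathbb{C}$, $$\varphi_n^\gamma(z)=\frac{1}{\sqrt{\pi n!}}(z-\overline{\gamma})^ne^{-\frac{|z|^2}{2}-\frac{|\gamma|^2}{2}+\gamma z}.$$ $(U,V)$ is the initial condition of a progressive wave of $(\ast)$ with parameters $(\lambda,\mu,\alpha)\in\mathbb{R}^2\times\mathbb{C}$ if $$\big(u(t,z),v(t,z)\big)=\Big(e^{-i\lambda t}U(z+\alpha t)e^{\frac12(\overline{z}\alpha-z\overline{\alpha})t},\ e^{-i\mu t}V(z+\alpha t)e^{\frac12(\overline{z}\alpha-z\overline{\alpha})t}\Big)$$ is a solution of $(\ast)$. Equivalently, with $\alpha=\alpha_1+i\alpha_2$, $\alpha\cdot\Gamma=\alpha_1\Gamma_1+\alpha_2\Gamma_2$, $\Gamma_1=i(-z+\partial_z+\frac{\overline z}{2})$, $\Gamma_2=-(z+\partial_z+\frac{\overline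 z}{2})$, one has $\lambda U+(\alpha\cdot\Gamma)U=\Pi(|V|^2U)$ and $\mu V+(\alpha\cdot\Gamma)V=-\Pi(|U|^2V)$. *)

theory Defs
  imports "HOL-Complex_Analysis.Complex_Analysis"
begin

text \<open>
  Elements are genuine functions (the continuous representatives), so their zeros and point
  values are meaningful; measurability is automatic, which makes integrability of
  \<open>|u|\<^sup>2\<close> the same as membership in \<open>L\<^sup>2\<close>.
\<close>
definition bargmann_fock :: "(complex \<Rightarrow> complex) set" where
  "bargmann_fock =
     {u. (\<exists>f. f holomorphic_on UNIV \<and> (\<forall>z. u z = exp (- complex_of_real ((cmod z)\<^sup>2 / 2)) * f z))
         \<and> integrable lborel (\<lambda>z. (cmod (u z))\<^sup>2)}"

text \<open>
  The orthogonal projection of \<open>L\<^sup>2\<close> onto \<^const>\<open>bargmann_fock\<close>, through its integral kernel.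
\<close>
definition fock_proj :: "(complex \<Rightarrow> complex) \<Rightarrow> complex \<Rightarrow> complex" where
  "fock_proj u z =
     complex_of_real (1 / pi) * exp (- complex_of_real ((cmod z)\<^sup>2 / 2)) *
     (LINT w|lborel. exp (cnj w * z - complex_of_real ((cmod w)\<^sup>2 / 2)) * u w)"

definition phi :: "nat \<Rightarrow> complex \<Rightarrow> complex \<Rightarrow> complex" where
  "phi n \<gamma> z =
     complex_of_real (1 / sqrt (pi * fact n)) * (z - cnj \<gamma>) ^ n *
     exp (- complex_of_real ((cmod z)\<^sup>2 / 2) - complex_of_real ((cmod \<gamma>)\<^sup>2 / 2) + \<gamma> * z)"

text \<open>
  Solutions, global in time and with values in \<^const>\<open>bargmann_fock\<close>, of
  \<open>i \<partial>\<^sub>t u = \<Pi>(|v|\<^sup>2 u)\<close>, \<open>i \<partial>\<^sub>t v = - \<Pi>(|u|\<^sup>2 v)\<close>; the time derivative is taken at each fixed \<open>z\<close>.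
\<close>
definition is_solution ::
  "(real \<Rightarrow> complex \<Rightarrow> complex) \<Rightarrow> (real \<Rightarrow> complex \<Rightarrow> complex) \<Rightarrow> bool" where
  "is_solution u v \<longleftrightarrow>
     (\<forall>t. u t \<in> bargmann_fock \<and> v t \<in> bargmann_fock) \<and>
     (\<forall>t z. \<exists>du dv.
        ((\<lambda>s. u s z) has_vector_derivative du) (at t) \<and>
        ((\<lambda>s. v s z) has_vector_derivative dv) (at t) \<and>
        \<i> * du = fock_proj (\<lambda>w. complex_of_real ((cmod (v t w))\<^sup>2) * u t w) z \<and>
        \<i> * dv = - fock_proj (\<lambda>w. complex_of_real ((cmod (u t w))\<^sup>2) * v t w) z)"

definition travelling ::
  "(complex \<Rightarrow> complex) \<Rightarrow> real \<Rightarrow> complex \<Rightarrow> real \<Rightarrow> complex \<Rightarrow> complex" where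
  "travelling U lam \<alpha> t z =
     exp (- \<i> * complex_of_real (lam * t)) * U (z + \<alpha> * complex_of_real t) *
     exp ((1 / 2) * (cnj z * \<alpha> - z * cnj \<alpha>) * complex_of_real t)"

definition progressive_wave_initial ::
  "(complex \<Rightarrow> complex) \<Rightarrow> (complex \<Rightarrow> complex) \<Rightarrow> real \<Rightarrow> real \<Rightarrow> complex \<Rightarrow> bool" where
  "progressive_wave_initial U V lam mu \<alpha> \<longleftrightarrow>
     is_solution (travelling U lam \<alpha>) (travelling V mu \<alpha>)"

end

theory Submission
  imports Defs "HOL-Probability.Distributions" "HOL-Computational_Algebra.Fundamental_Theorem_Algebra"
begin

text \<open>
  Write \<open>U = exp (- |z|\<^sup>2 / 2) * f\<close> and \<open>V = exp (- |z|\<^sup>2 / 2) * g\<close> with \<open>f\<close>, \<open>g\<close> entire.  At each time the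
  evolution equation is a stationary equation for the entire factors (\<open>progressive_wave_iff\<close>),
  \<open>\<lambda> f + \<i> \<alpha> f' - \<i> cnj \<alpha> z f = (1/\<pi>) \<integral> exp (cnj w z - 2 |w|\<^sup>2) |g|\<^sup>2 f dw\<close>,
  and the same with \<open>f\<close> and \<open>g\<close> exchanged and the opposite sign.

  A square integrable Fock function with finitely many zeros has an entire factor \<open>P exp (a z\<^sup>2 + b z)\<close> with
  \<open>P\<close> a polynomial and \<open>|a| < 1/2\<close> (\<open>fock_finite_zeros\<close>): a local mean value bound limits its growth, so that
  the logarithm of the zero-free part is a polynomial of degree at most two, and it forces decay at
  infinity, which excludes \<open>|a| \<ge> 1/2\<close>.

  For such \<open>f\<close> and \<open>g = R exp (c z\<^sup>2 + d z)\<close> the cubic term is a Gaussian integral with polynomial factors, hence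
  again a polynomial times the exponential of a quadratic polynomial whose coefficients are explicit
  (\<open>cubic_form\<close>).  Comparing exponents in the two equations gives \<open>a = c = 0\<close> and \<open>b = d\<close>, because any other
  solution would need \<open>Re (a cnj c) = 1/4\<close> (\<open>exponents_trivial\<close>).  So both factors are polynomials in
  \<open>x = z - cnj \<gamma>\<close> times \<open>exp (\<gamma> z)\<close>, with a common \<open>\<gamma>\<close>.

  On the polynomials \<open>p\<close>, \<open>r\<close> the cubic term is, up to a constant, \<open>r\<close> with conjugated coefficients applied as a
  differential operator to \<open>(p r)(x / 2)\<close>.  Magnetic translation moves \<open>\<gamma>\<close> but keeps \<open>p\<close>, \<open>r\<close> and the
  constants, so the equations for all times reduce to a single algebraic system
  (\<open>progressive_wave_polynomials_iff\<close>).  For \<open>\<alpha> = 0\<close> the left side does not raise the degree, which forces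
  monomials.  For \<open>\<alpha> \<noteq> 0\<close> it raises it by exactly one, which forces \<open>p\<close> and \<open>r\<close> to be powers of \<open>x\<close> times linear
  factors; comparing the highest with the lowest coefficient removes the powers, and the remaining six equations
  in the four coefficients are solved by hand (\<open>polynomial_system_iff\<close>).
\<close>

section \<open>Gaussian integrals with polynomial factors\<close>

lemma integrable_gaussian_complex:
  fixes d :: real assumes "d > 0"
  shows "integrable lborel (\<lambda>w::complex. exp (- d * (cmod w)\<^sup>2))"
    and "(LINT w|lborel. exp (- d * (cmod w)\<^sup>2)) = pi / d"
proof -
  have 1: "has_bochner_integral lborel (\<lambda>x::real. exp (- x\<^sup>2)) (sqrt pi)"
    using has_bochner_integral_even_function[OF gaussian_moment_0] by simp
  have 2: "has_bochner_integral lborel (\<lambda>x::real. exp (- d * x\<^sup>2)) (sqrt pi / sqrt d)"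
    using lborel_has_bochner_integral_real_affine_iff[of "sqrt d" "\<lambda>x::real. exp (- x\<^sup>2)" "sqrt pi" 0] 1 assms
    by (simp add: power_mult_distrib field_simps)
  have 3: "(\<integral>\<^sup>+x. ennreal (exp (- d * x\<^sup>2)) \<partial>lborel) = ennreal (sqrt pi / sqrt d)"
    using 2 by (subst nn_integral_eq_integral) (auto simp: has_bochner_integral_iff)
  have "(\<integral>\<^sup>+w. (\<Prod>b\<in>Basis. ennreal (exp (- d * (w \<bullet> b)\<^sup>2))) \<partial>(lborel :: complex measure)) = (\<Prod>b\<in>(Basis::complex set). (\<integral>\<^sup>+x. ennreal (exp (- d * x\<^sup>2)) \<partial>lborel))"
    by (rule nn_integral_lborel_prod) auto
  also have "\<dots> = ennreal (sqrt pi / sqrt d) * ennreal (sqrt pi / sqrt d)"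
    unfolding 3 by (simp add: Basis_complex_def)
  also have "\<dots> = ennreal (pi / d)" using assms by (simp add: ennreal_mult[symmetric])
  also have "(\<lambda>w::complex. (\<Prod>b\<in>Basis. ennreal (exp (- d * (w \<bullet> b)\<^sup>2)))) = (\<lambda>w. ennreal (exp (- d * (cmod w)\<^sup>2)))"
    by (auto simp: Basis_complex_def ennreal_mult[symmetric] exp_add[symmetric] cmod_power2 algebra_simps)
  finally have 4: "(\<integral>\<^sup>+w. ennreal (exp (- d * (cmod w)\<^sup>2)) \<partial>lborel) = ennreal (pi / d)" .
  show "integrable lborel (\<lambda>w::complex. exp (- d * (cmod w)\<^sup>2))"
    by (rule integrableI_nonneg) (use 4 in auto)
  show "(LINT w|lborel. exp (- d * (cmod w)\<^sup>2)) = pi / d"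
    by (subst integral_eq_nn_integral) (use 4 assms in auto)
qed

text \<open>
  The integrands below are Gaussians times polynomials times exponentials of linear forms.  Demanding
  integrability against \<open>exp (c * |w|)\<close> for every \<open>c\<close> gives a class that is stable under both kinds of
  factors, so that parameters \<open>s\<close> in \<open>exp (s * w)\<close> can be differentiated any number of times.
\<close>

definition rapid :: "(complex \<Rightarrow> complex) \<Rightarrow> bool" where
  "rapid k \<longleftrightarrow> k \<in> borel_measurable borel \<and> (\<forall>c. integrable lborel (\<lambda>w. exp (c * cmod w) * cmod (k w)))"

lemma rapidI:
  assumes [measurable]: "k \<in> borel_measurable borel" and "d > 0" "\<And>w. cmod (k w) \<le> exp (- d * (cmod w)\<^sup>2)"
  shows "rapid k"
  unfolding rapid_def
proof (intro conjI allI)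
  fix c :: real
  show "integrable lborel (\<lambda>w. exp (c * cmod w) * cmod (k w))"
  proof (rule Bochner_Integration.integrable_bound)
    show "integrable lborel (\<lambda>w. exp (c\<^sup>2 / (2 * d)) * exp (- (d / 2) * (cmod w)\<^sup>2))"
      using integrable_gaussian_complex[of "d/2"] assms(2) by (intro integrable_mult_right) auto
    have "exp (c * r) * x \<le> exp (c\<^sup>2 / (2 * d)) * exp (- (d / 2) * r\<^sup>2)" if "x \<le> exp (- d * r\<^sup>2)" for r x :: real
    proof -
      have "0 \<le> (c - d * r)\<^sup>2 / (2 * d)" using assms(2) by simp
      also have "\<dots> = c\<^sup>2 / (2 * d) + (- (d / 2) * r\<^sup>2) - (c * r + - d * r\<^sup>2)"
        using assms(2) by (simp add: field_simps power2_eq_square)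
      finally have "c * r + - d * r\<^sup>2 \<le> c\<^sup>2 / (2 * d) + (- (d / 2) * r\<^sup>2)" by simp
      then have "exp (c * r) * exp (- d * r\<^sup>2) \<le> exp (c\<^sup>2 / (2 * d)) * exp (- (d / 2) * r\<^sup>2)"
        unfolding exp_add[symmetric] by simp
      with that show ?thesis by (smt (verit) exp_gt_zero mult_left_mono)
    qed
    then show "AE w in lborel. norm (exp (c * cmod w) * cmod (k w)) \<le> norm (exp (c\<^sup>2 / (2 * d)) * exp (- (d / 2) * (cmod w)\<^sup>2))"
      using assms(3) by (auto intro!: AE_I2 simp: abs_mult)
  qed auto
qed auto

lemma rapid_mult:
  assumes "rapid k" and [measurable]: "h \<in> borel_measurable borel" and h: "\<And>w. cmod (h w) \<le> C * exp (c * cmod w)"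
  shows "rapid (\<lambda>w. h w * k w)"
  unfolding rapid_def
proof (intro conjI allI)
  have [measurable]: "k \<in> borel_measurable borel" using assms(1) by (simp add: rapid_def)
  show "(\<lambda>w. h w * k w) \<in> borel_measurable borel" by measurable
  fix d :: real
  show "integrable lborel (\<lambda>w. exp (d * cmod w) * cmod (h w * k w))"
  proof (rule Bochner_Integration.integrable_bound)
    show "integrable lborel (\<lambda>w. C * (exp ((c + d) * cmod w) * cmod (k w)))"
      using assms(1) by (intro integrable_mult_right) (auto simp: rapid_def)
    have "exp (d * cmod w) * cmod (h w * k w) \<le> C * (exp ((c + d) * cmod w) * cmod (k w))" for w
    proof -
      have "exp (d * cmod w) * (cmod (h w) * cmod (k w)) \<le> exp (d * cmod w) * ((C * exp (c * cmod w)) * cmod (k w))"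
        by (intro mult_left_mono mult_right_mono h) auto
      also have "\<dots> = C * (exp ((c + d) * cmod w) * cmod (k w))" by (simp add: exp_add algebra_simps)
      finally show ?thesis by (simp add: norm_mult)
    qed
    then show "AE w in lborel. norm (exp (d * cmod w) * cmod (h w * k w)) \<le> norm (C * (exp ((c + d) * cmod w) * cmod (k w)))"
      by (intro AE_I2) (smt (verit, best) exp_gt_zero mult_nonneg_nonneg norm_ge_zero real_norm_def)
  qed auto
qed

lemma rapid_integrable: "rapid k \<Longrightarrow> integrable lborel k"
  unfolding rapid_def by (rule conjE, assumption, drule spec[of _ 0]) (simp add: integrable_norm_iff)

lemma rapid_mult_exp:
  assumes "rapid k" and [measurable]: "L \<in> borel_measurable borel" and "\<And>w. cmod (L w) \<le> c * cmod w"
  shows "rapid (\<lambda>w. exp (L w) * k w)"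
proof (rule rapid_mult[OF assms(1)])
  fix w
  have "cmod (exp (L w)) \<le> exp (cmod (L w))" by (rule norm_exp)
  also have "\<dots> \<le> 1 * exp (c * cmod w)" using assms(3) by simp
  finally show "cmod (exp (L w)) \<le> 1 * exp (c * cmod w)" .
qed auto

lemma rapid_mult_lin:
  assumes "rapid k" and [measurable]: "L \<in> borel_measurable borel" and "\<And>w. cmod (L w) \<le> c * cmod w"
  shows "rapid (\<lambda>w. L w * k w)"
proof (rule rapid_mult[OF assms(1)])
  fix w
  have "c * cmod w \<le> exp (c * cmod w)" by (smt (verit) exp_ge_add_one_self)
  then show "cmod (L w) \<le> 1 * exp (c * cmod w)" using assms(3)[of w] by linarith
qed auto

lemma rapid_mult_power:
  assumes "rapid k" shows "rapid (\<lambda>w. w ^ j * k w)" "rapid (\<lambda>w. cnj w ^ j * k w)"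
proof -
  show "rapid (\<lambda>w. w ^ j * k w)"
  proof (induction j)
    case (Suc j)
    show ?case using rapid_mult_lin[OF Suc, of "\<lambda>w. w" 1] by (simp add: mult.assoc)
  qed (simp add: assms)
  show "rapid (\<lambda>w. cnj w ^ j * k w)"
  proof (induction j)
    case (Suc j)
    show ?case using rapid_mult_lin[OF Suc, of "\<lambda>w. cnj w" 1] by (simp add: mult.assoc borel_measurable_continuous_onI)
  qed (simp add: assms)
qed

lemma rapid_add:
  assumes "rapid k" "rapid l" shows "rapid (\<lambda>w. k w + l w)"
  unfolding rapid_def
proof (intro conjI allI)
  have [measurable]: "k \<in> borel_measurable borel" "l \<in> borel_measurable borel" using assms by (simp_all add: rapid_def)
  show "(\<lambda>w. k w + l w) \<in> borel_measurable borel" by measurable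
  fix c :: real
  show "integrable lborel (\<lambda>w. exp (c * cmod w) * cmod (k w + l w))"
  proof (rule Bochner_Integration.integrable_bound)
    show "integrable lborel (\<lambda>w. exp (c * cmod w) * cmod (k w) + exp (c * cmod w) * cmod (l w))"
      using assms by (intro Bochner_Integration.integrable_add) (auto simp: rapid_def)
    have "exp (c * cmod w) * cmod (k w + l w) \<le> exp (c * cmod w) * cmod (k w) + exp (c * cmod w) * cmod (l w)" for w
      unfolding distrib_left[symmetric] by (intro mult_left_mono norm_triangle_ineq) auto
    then show "AE w in lborel. norm (exp (c * cmod w) * cmod (k w + l w)) \<le> norm (exp (c * cmod w) * cmod (k w) + exp (c * cmod w) * cmod (l w))"
      by (intro AE_I2) simp
  qed auto
qed

lemma rapid_cmult: "rapid k \<Longrightarrow> rapid (\<lambda>w. c * k w)"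
  by (rule rapid_mult[of _ "\<lambda>_. c" "cmod c" 0]) auto

lemma rapid_sum:
  assumes "finite I" "\<And>i. i \<in> I \<Longrightarrow> rapid (k i)" shows "rapid (\<lambda>w. \<Sum>i\<in>I. k i w)"
  using assms
proof (induction I rule: finite_induct)
  case empty
  show ?case by (simp add: rapid_def)
next
  case (insert i I)
  then show ?case by (simp add: rapid_add)
qed

lemma rapid_poly:
  assumes "rapid k" shows "rapid (\<lambda>w. poly P w * k w)" "rapid (\<lambda>w. cnj (poly P w) * k w)"
proof -
  show "rapid (\<lambda>w. poly P w * k w)"
    unfolding poly_altdef sum_distrib_right mult.assoc
    by (intro rapid_sum rapid_cmult rapid_mult_power assms finite_atMost)
  show "rapid (\<lambda>w. cnj (poly P w) * k w)"
    unfolding poly_altdef cnj_sum complex_cnj_mult complex_cnj_power sum_distrib_right mult.assoc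
    by (intro rapid_sum rapid_cmult rapid_mult_power assms finite_atMost)
qed

text \<open>
  The Taylor remainder \<open>exp (h * L) - 1 - h * L\<close> is at most \<open>|h|\<^sup>2 * |L|\<^sup>2 * exp |L|\<close> for \<open>|h| \<le> 1\<close>, and
  \<open>L\<^sup>2 * exp |L|\<close> times the integrand is still integrable.  The error of the difference quotient is
  therefore \<open>O(|h|)\<close>.
\<close>

lemma moment_deriv:
  assumes k: "rapid k" and [measurable]: "L \<in> borel_measurable borel" and L: "\<And>w. cmod (L w) \<le> c * cmod w"
  shows "((\<lambda>s. LINT w|lborel. exp (s * L w) * k w) has_field_derivative (LINT w|lborel. L w * (exp (s * L w) * k w))) (at s)"
proof -
  define F where "F = (\<lambda>s. LINT w|lborel. exp (s * L w) * k w)"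
  define D where "D = (LINT w|lborel. L w * (exp (s * L w) * k w))"
  have [measurable]: "k \<in> borel_measurable borel" using k by (simp add: rapid_def)
  have r: "rapid (\<lambda>w. exp (s * L w) * k w)" for s
  proof (rule rapid_mult_exp[OF k])
    fix w
    have "cmod s * cmod (L w) \<le> cmod s * (c * cmod w)" by (intro mult_left_mono L) auto
    then show "cmod (s * L w) \<le> (cmod s * c) * cmod w" by (simp add: norm_mult)
  qed auto
  have r1: "rapid (\<lambda>w. L w * (exp (s * L w) * k w))" for s
    by (rule rapid_mult_lin[OF r, of _ c]) (auto simp: L)
  have r2: "rapid (\<lambda>w. L w * (L w * (exp (s * L w) * k w)))" for s
    by (rule rapid_mult_lin[OF r1, of _ c]) (auto simp: L)
  define g where "g = (\<lambda>w. exp (c * cmod w) * cmod (L w * (L w * (exp (s * L w) * k w))))"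
  define M where "M = integral\<^sup>L lborel g"
  have Mint: "integrable lborel g"
    using r2 by (auto simp: rapid_def g_def)
  have bd: "norm (F (s + h) - F s - h * D) \<le> (cmod h)\<^sup>2 * M" if "cmod h \<le> 1" for h
  proof -
    have "F (s + h) - F s - h * D = (LINT w|lborel. exp ((s + h) * L w) * k w - exp (s * L w) * k w - h * (L w * (exp (s * L w) * k w)))"
      unfolding F_def D_def
      by (simp add: rapid_integrable[OF r] rapid_integrable[OF r1])
    also have "\<dots> = (LINT w|lborel. (exp (h * L w) - 1 - h * L w) * (exp (s * L w) * k w))"
      by (rule Bochner_Integration.integral_cong) (auto simp: exp_add algebra_simps)
    also have "norm \<dots> \<le> (LINT w|lborel. (cmod h)\<^sup>2 * g w)"
    proof (rule Bochner_Integration.integral_norm_bound_integral)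
      have eq: "(\<lambda>w. (exp (h * L w) - 1 - h * L w) * (exp (s * L w) * k w)) = (\<lambda>w. exp ((s + h) * L w) * k w - exp (s * L w) * k w - h * (L w * (exp (s * L w) * k w)))"
        by (auto simp: exp_add algebra_simps)
      show "integrable lborel (\<lambda>w. (exp (h * L w) - 1 - h * L w) * (exp (s * L w) * k w))"
        unfolding eq by (intro Bochner_Integration.integrable_diff rapid_integrable[OF r] integrable_mult_right rapid_integrable[OF r1])
      show "integrable lborel (\<lambda>w. (cmod h)\<^sup>2 * g w)"
        by (intro integrable_mult_right Mint)
      fix w
      have "cmod (exp (h * L w) - (\<Sum>i\<le>1. (h * L w) ^ i / fact i)) \<le> exp \<bar>Re (h * L w)\<bar> * cmod (h * L w) ^ Suc 1 / fact 1"
        by (rule Taylor_exp)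
      then have "cmod (exp (h * L w) - 1 - h * L w) \<le> exp \<bar>Re (h * L w)\<bar> * (cmod h * cmod (L w))\<^sup>2"
        by (simp add: norm_mult power2_eq_square algebra_simps)
      also have "\<dots> \<le> exp (c * cmod w) * (cmod h * cmod (L w))\<^sup>2"
      proof -
        have "\<bar>Re (h * L w)\<bar> \<le> cmod (h * L w)" by (rule abs_Re_le_cmod)
        also have "\<dots> \<le> 1 * cmod (L w)" unfolding norm_mult using that by (intro mult_right_mono) auto
        also have "\<dots> \<le> c * cmod w" using L by simp
        finally show ?thesis by (intro mult_right_mono) auto
      qed
      finally have 1: "cmod (exp (h * L w) - 1 - h * L w) \<le> exp (c * cmod w) * (cmod h * cmod (L w))\<^sup>2" .
      have "cmod ((exp (h * L w) - 1 - h * L w) * (exp (s * L w) * k w)) \<le> exp (c * cmod w) * (cmod h * cmod (L w))\<^sup>2 * cmod (exp (s * L w) * k w)"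
        unfolding norm_mult[of "exp (h * L w) - 1 - h * L w"] by (intro mult_right_mono 1) auto
      then show "cmod ((exp (h * L w) - 1 - h * L w) * (exp (s * L w) * k w)) \<le> (cmod h)\<^sup>2 * g w"
        unfolding g_def by (simp only: norm_mult power2_eq_square mult_ac)
    qed
    also have "\<dots> = (cmod h)\<^sup>2 * M" by (simp add: M_def)
    finally show ?thesis .
  qed
  have "((\<lambda>h. (F (s + h) - F s) / h - D) \<longlongrightarrow> 0) (at 0)"
  proof (rule Lim_null_comparison)
    show "\<forall>\<^sub>F h in at 0. norm ((F (s + h) - F s) / h - D) \<le> cmod h * M"
      unfolding eventually_at
    proof (intro exI[of _ 1] conjI ballI impI)
      fix h :: complex assume h: "h \<noteq> 0 \<and> dist h 0 < 1"
      have "norm ((F (s + h) - F s) / h - D) = norm (F (s + h) - F s - h * D) / cmod h"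
        using h by (simp add: norm_divide[symmetric] diff_divide_distrib)
      also have "\<dots> \<le> (cmod h)\<^sup>2 * M / cmod h" using h by (intro divide_right_mono bd) auto
      also have "\<dots> = cmod h * M" using h by (simp add: power2_eq_square)
      finally show "norm ((F (s + h) - F s) / h - D) \<le> cmod h * M" .
    qed simp
    show "((\<lambda>h. cmod h * M) \<longlongrightarrow> 0) (at 0)"
      by (auto intro!: tendsto_eq_intros)
  qed
  then have "((\<lambda>h. (F (s + h) - F s) / h) \<longlongrightarrow> D) (at 0)" by (simp add: LIM_zero_iff)
  then show ?thesis unfolding DERIV_def F_def D_def .
qed

lemma lborel_integral_translate:
  fixes f :: "complex \<Rightarrow> complex"
  assumes [measurable]: "f \<in> borel_measurable borel"
  shows "(LINT w|lborel. f (h + w)) = (LINT w|lborel. f w)"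
proof -
  have "(LINT w|lborel. f w) = (LINT w|distr lborel borel ((+) h). f w)" by (simp add: lborel_distr_plus)
  also have "\<dots> = (LINT w|lborel. f (h + w))" by (rule integral_distr) auto
  finally show ?thesis ..
qed

lemma cnj_measurable [measurable]: "cnj \<in> borel_measurable borel"
  by (intro borel_measurable_continuous_onI continuous_intros)

lemma lin_bound: "cmod (a * w + b * cnj w) \<le> (cmod a + cmod b) * cmod w"
  by (rule order_trans[OF norm_triangle_ineq]) (simp add: norm_mult algebra_simps)

text \<open>
  Under this smallness the real part of the exponent of \<open>wt\<close> below is negative definite.
\<close>

locale gaussian_weight =
  fixes A C :: complex
  assumes small: "cmod A + cmod C < 2"
begin

definition wt :: "complex \<Rightarrow> complex" where
  "wt w = exp (A * w\<^sup>2 + C * (cnj w)\<^sup>2 - 2 * of_real ((cmod w)\<^sup>2))"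

definition G :: "nat \<Rightarrow> nat \<Rightarrow> complex \<Rightarrow> complex \<Rightarrow> complex" where
  "G j k s t = (LINT w|lborel. w ^ j * (cnj w ^ k * (exp (s * w + t * cnj w) * wt w)))"

lemma wt_measurable [measurable]: "wt \<in> borel_measurable borel"
  unfolding wt_def by measurable

lemma rapid_wt: "rapid wt"
proof (rule rapidI)
  show "0 < 2 - (cmod A + cmod C)" using small by simp
  fix w
  have "Re (A * w\<^sup>2) \<le> cmod A * (cmod w)\<^sup>2" "Re (C * (cnj w)\<^sup>2) \<le> cmod C * (cmod w)\<^sup>2"
    using complex_Re_le_cmod[of "A * w\<^sup>2"] complex_Re_le_cmod[of "C * (cnj w)\<^sup>2"]
    by (simp_all add: norm_mult norm_power)
  then show "cmod (wt w) \<le> exp (- (2 - (cmod A + cmod C)) * (cmod w)\<^sup>2)"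
    unfolding wt_def norm_exp_eq_Re by (simp add: algebra_simps Re_power2 del: of_real_power)
qed auto

lemma rapid_wt_exp: "rapid (\<lambda>w. exp (s * w + t * cnj w) * wt w)"
  by (rule rapid_mult_exp[OF rapid_wt _ lin_bound]) measurable

lemma rapid_integrand: "rapid (\<lambda>w. w ^ j * (cnj w ^ k * (exp (s * w + t * cnj w) * wt w)))"
  by (intro rapid_mult_power rapid_wt_exp)

lemma deriv_line:
  "((\<lambda>e. G 0 0 (s + e * m) (t + e * n)) has_field_derivative
      m * G 1 0 (s + e * m) (t + e * n) + n * G 0 1 (s + e * m) (t + e * n)) (at e)"
proof -
  have eq: "exp (e * (m * w + n * cnj w)) * (exp (s * w + t * cnj w) * wt w) = exp ((s + e * m) * w + (t + e * n) * cnj w) * wt w" for e w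
    by (simp add: exp_add[symmetric] algebra_simps)
  have "((\<lambda>e. LINT w|lborel. exp (e * (m * w + n * cnj w)) * (exp (s * w + t * cnj w) * wt w)) has_field_derivative
     (LINT w|lborel. (m * w + n * cnj w) * (exp (e * (m * w + n * cnj w)) * (exp (s * w + t * cnj w) * wt w)))) (at e)"
    by (rule moment_deriv[OF rapid_wt_exp _ lin_bound]) auto
  moreover have "(LINT w|lborel. (m * w + n * cnj w) * (exp (e * (m * w + n * cnj w)) * (exp (s * w + t * cnj w) * wt w)))
     = m * G 1 0 (s + e * m) (t + e * n) + n * G 0 1 (s + e * m) (t + e * n)"
    using rapid_integrable[OF rapid_integrand[of 1 0 "s + e * m" "t + e * n"]] rapid_integrable[OF rapid_integrand[of 0 1 "s + e * m" "t + e * n"]]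
    unfolding eq G_def by (simp add: ring_distribs mult.assoc)
  ultimately show ?thesis unfolding eq by (simp add: G_def)
qed

lemma deriv_s: "((\<lambda>s. G j k s t) has_field_derivative G (Suc j) k s t) (at s)"
proof -
  have eq: "exp (s * w) * (w ^ j * (cnj w ^ k * (exp (0 * w + t * cnj w) * wt w))) = w ^ j * (cnj w ^ k * (exp (s * w + t * cnj w) * wt w))" for s w
    by (simp add: exp_add)
  have "((\<lambda>s. LINT w|lborel. exp (s * w) * (w ^ j * (cnj w ^ k * (exp (0 * w + t * cnj w) * wt w)))) has_field_derivative
    (LINT w|lborel. w * (exp (s * w) * (w ^ j * (cnj w ^ k * (exp (0 * w + t * cnj w) * wt w)))))) (at s)"
    by (rule moment_deriv[OF rapid_integrand, of _ 1]) auto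
  then show ?thesis unfolding eq by (simp add: G_def mult.assoc)
qed

lemma deriv_t: "((\<lambda>t. G j k s t) has_field_derivative G j (Suc k) s t) (at t)"
proof -
  have eq: "exp (t * cnj w) * (w ^ j * (cnj w ^ k * (exp (s * w + 0 * cnj w) * wt w))) = w ^ j * (cnj w ^ k * (exp (s * w + t * cnj w) * wt w))" for t w
    by (simp add: exp_add)
  have eq2: "cnj w * (w ^ j * (cnj w ^ k * (exp (s * w + t * cnj w) * wt w))) = w ^ j * (cnj w ^ Suc k * (exp (s * w + t * cnj w) * wt w))" for t w
    by simp
  have "((\<lambda>t. LINT w|lborel. exp (t * cnj w) * (w ^ j * (cnj w ^ k * (exp (s * w + 0 * cnj w) * wt w)))) has_field_derivative
    (LINT w|lborel. cnj w * (exp (t * cnj w) * (w ^ j * (cnj w ^ k * (exp (s * w + 0 * cnj w) * wt w)))))) (at t)"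
    by (rule moment_deriv[OF rapid_integrand, of _ 1]) auto
  then show ?thesis unfolding eq eq2 by (simp add: G_def)
qed

text \<open>
  Shifting the integration variable by \<open>h\<close> only changes the linear part of the exponent and a constant
  factor.  This exact functional equation replaces integration by parts in the plane: its derivative
  at \<open>h = 0\<close> gives the two differential equations that determine \<open>G 0 0\<close>.
\<close>

lemma translate:
  "G 0 0 s t = exp (A * h\<^sup>2 + C * (cnj h)\<^sup>2 - 2 * h * cnj h + s * h + t * cnj h)
      * G 0 0 (s + (2 * A * h - 2 * cnj h)) (t + (2 * C * cnj h - 2 * h))"
proof -
  have "G 0 0 s t = (LINT w|lborel. exp (s * w + t * cnj w) * wt w)" by (simp add: G_def)
  also have "\<dots> = (LINT w|lborel. exp (s * (h + w) + t * cnj (h + w)) * wt (h + w))"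
    by (rule lborel_integral_translate[symmetric]) measurable
  also have "\<dots> = (LINT w|lborel. exp (A * h\<^sup>2 + C * (cnj h)\<^sup>2 - 2 * h * cnj h + s * h + t * cnj h) *
      (exp ((s + (2 * A * h - 2 * cnj h)) * w + (t + (2 * C * cnj h - 2 * h)) * cnj w) * wt w))"
    unfolding wt_def exp_add[symmetric] complex_norm_square of_real_power[symmetric]
    by (intro Bochner_Integration.integral_cong refl arg_cong[where f = exp]) (simp add: algebra_simps power2_eq_square)
  also have "\<dots> = exp (A * h\<^sup>2 + C * (cnj h)\<^sup>2 - 2 * h * cnj h + s * h + t * cnj h)
      * G 0 0 (s + (2 * A * h - 2 * cnj h)) (t + (2 * C * cnj h - 2 * h))"
    by (simp add: G_def)
  finally show ?thesis .
qed

text \<open>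
  The equation is real linear in \<open>h\<close>; comparing \<open>h = 1\<close> with \<open>h = \<i>\<close> separates the coefficients of
  \<open>h\<close> and of \<open>cnj h\<close>.
\<close>

lemma pde_dir:
  "(s * h + t * cnj h) * G 0 0 s t + (2 * A * h - 2 * cnj h) * G 1 0 s t + (2 * C * cnj h - 2 * h) * G 0 1 s t = 0"
proof -
  define Q where "Q = A * h\<^sup>2 + C * (cnj h)\<^sup>2 - 2 * h * cnj h"
  define m where "m = 2 * A * h - 2 * cnj h"
  define n where "n = 2 * C * cnj h - 2 * h"
  define \<psi> where "\<psi> = (\<lambda>e. exp (Q * e\<^sup>2 + (s * h + t * cnj h) * e) * G 0 0 (s + e * m) (t + e * n))"
  have d: "(\<psi> has_field_derivative (s * h + t * cnj h) * G 0 0 s t + m * G 1 0 s t + n * G 0 1 s t) (at 0)"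
    unfolding \<psi>_def by (rule derivative_eq_intros deriv_line refl | simp)+
  have c: "\<psi> (of_real r) = G 0 0 s t" for r
  proof -
    have e1: "A * (of_real r * h)\<^sup>2 + C * (cnj (of_real r * h))\<^sup>2 - 2 * (of_real r * h) * cnj (of_real r * h) + s * (of_real r * h) + t * cnj (of_real r * h) = Q * (of_real r)\<^sup>2 + (s * h + t * cnj h) * of_real r"
      by (simp add: Q_def algebra_simps power2_eq_square)
    have e2: "s + (2 * A * (of_real r * h) - 2 * cnj (of_real r * h)) = s + of_real r * m"
      by (simp add: m_def algebra_simps)
    have e3: "t + (2 * C * cnj (of_real r * h) - 2 * (of_real r * h)) = t + of_real r * n"
      by (simp add: n_def algebra_simps)
    show ?thesis using translate[of s t "of_real r * h"] unfolding e1 e2 e3 \<psi>_def by simp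
  qed
  have "((\<lambda>r. \<psi> (of_real r)) has_vector_derivative (s * h + t * cnj h) * G 0 0 s t + m * G 1 0 s t + n * G 0 1 s t) (at 0)"
    using has_vector_derivative_real_field[of \<psi> _ 0 UNIV] d by simp
  then have "((\<lambda>r::real. G 0 0 s t) has_vector_derivative (s * h + t * cnj h) * G 0 0 s t + m * G 1 0 s t + n * G 0 1 s t) (at 0)"
    unfolding c .
  from vector_derivative_unique_at[OF this has_vector_derivative_const]
  show ?thesis unfolding m_def n_def .
qed

lemma pde1: "s * G 0 0 s t + 2 * A * G 1 0 s t = 2 * G 0 1 s t"
  and pde2: "t * G 0 0 s t + 2 * C * G 0 1 s t = 2 * G 1 0 s t"
proof -
  define X where "X = s * G 0 0 s t + 2 * A * G 1 0 s t - 2 * G 0 1 s t"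
  define Y where "Y = t * G 0 0 s t + 2 * C * G 0 1 s t - 2 * G 1 0 s t"
  have "X * h + Y * cnj h = 0" for h
    using pde_dir[of s h t] by (simp add: X_def Y_def algebra_simps)
  from this[of 1] this[of \<i>] have "X + Y = 0" "X - Y = 0" by (simp_all add: algebra_simps)
  then have "X = 0" "Y = 0" by (auto simp: add_eq_0_iff)
  then show "s * G 0 0 s t + 2 * A * G 1 0 s t = 2 * G 0 1 s t" "t * G 0 0 s t + 2 * C * G 0 1 s t = 2 * G 1 0 s t"
    by (simp_all add: X_def Y_def)
qed

text \<open>
  Differentiating the second equation \<open>j\<close> times in \<open>s\<close>.  It trades a factor \<open>w\<close> for multiplication by
  \<open>t\<close> and one \<open>t\<close>-derivative, so that all moments are computed with \<open>s\<close> kept fixed.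
\<close>

lemma raise_j: "t * G j 0 s t + 2 * C * G j 1 s t = 2 * G (Suc j) 0 s t"
proof (induction j arbitrary: s)
  case 0 then show ?case using pde2 by simp
next
  case (Suc j)
  have 1: "((\<lambda>s. t * G j 0 s t + 2 * C * G j 1 s t) has_field_derivative t * G (Suc j) 0 s t + 2 * C * G (Suc j) 1 s t) (at s)"
    by (intro derivative_intros DERIV_cmult deriv_s)
  have 2: "((\<lambda>s. 2 * G (Suc j) 0 s t) has_field_derivative 2 * G (Suc (Suc j)) 0 s t) (at s)"
    by (intro DERIV_cmult deriv_s)
  show ?case using DERIV_unique[OF 1] 2 unfolding Suc by blast
qed

lemma AC_ne: "1 - A * C \<noteq> 0"
proof
  assume "1 - A * C = 0"
  then have "cmod A * cmod C = 1" by (metis norm_mult norm_one right_minus_eq)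
  moreover have "4 * (cmod A * cmod C) = (cmod A + cmod C)\<^sup>2 - (cmod A - cmod C)\<^sup>2" by (simp add: power2_eq_square algebra_simps)
  moreover have "(cmod A + cmod C)\<^sup>2 < 2\<^sup>2" by (rule power_strict_mono) (use small in auto)
  moreover have "(cmod A - cmod C)\<^sup>2 \<ge> 0" by simp
  ultimately show False by simp
qed

lemma G_t_eq: "G 0 1 s t = (s + A * t) / (2 * (1 - A * C)) * G 0 0 s t"
proof -
  have "2 * (1 - A * C) * G 0 1 s t = (s + A * t) * G 0 0 s t"
    using pde1[of s t] pde2[of t s] by algebra
  then show ?thesis using AC_ne by (simp add: field_simps)
qed

text \<open>
  The solution of the linear equation \<open>G_t_eq\<close> in \<open>t\<close>, normalised at \<open>t = 0\<close>.
\<close>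

definition E :: "complex \<Rightarrow> complex \<Rightarrow> complex" where
  "E s t = exp ((2 * s * t + A * t\<^sup>2) / (4 * (1 - A * C)))"

lemma deriv_E: "((\<lambda>t. E s t) has_field_derivative (s + A * t) / (2 * (1 - A * C)) * E s t) (at t)"
proof -
  have D: "((\<lambda>t. exp ((2 * s * t + A * t\<^sup>2) / c)) has_field_derivative
     exp ((2 * s * t + A * t\<^sup>2) / c) * ((2 * s + A * (2 * t)) / c)) (at t)" for c
  proof -
    have "((\<lambda>t. 2 * s * t + A * t\<^sup>2) has_field_derivative 2 * s + A * (2 * t)) (at t)"
      by (auto intro!: derivative_eq_intros)
    from DERIV_fun_exp[OF DERIV_cdivide[OF this]] show ?thesis .
  qed
  have e: "(2 * s + A * (2 * t)) / (4 * (1 - A * C)) = (s + A * t) / (2 * (1 - A * C))"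
    using mult_divide_mult_cancel_left[of 2 "s + A * t" "2 * (1 - A * C)"] by (simp add: algebra_simps)
  from D[of "4 * (1 - A * C)"] show ?thesis unfolding E_def e by (rule DERIV_cong) (rule mult.commute)
qed

lemma G_00: "G 0 0 s t = G 0 0 s 0 * E s t"
proof -
  have "\<exists>c. \<forall>t\<in>UNIV. G 0 0 s t / E s t = c"
  proof (rule has_field_derivative_zero_constant)
    fix t
    have "((\<lambda>t. G 0 0 s t / E s t) has_field_derivative
      (G 0 (Suc 0) s t * E s t - G 0 0 s t * ((s + A * t) / (2 * (1 - A * C)) * E s t)) / (E s t * E s t)) (at t)"
      by (intro DERIV_divide deriv_t deriv_E) (simp add: E_def)
    then show "((\<lambda>t. G 0 0 s t / E s t) has_field_derivative 0) (at t within UNIV)"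
      using G_t_eq[of s t] by simp
  qed auto
  then obtain c where c: "\<And>t. G 0 0 s t / E s t = c" by auto
  have "E s 0 = 1" by (simp add: E_def)
  then have "G 0 0 s t / E s t = G 0 0 s 0" using c[of t] c[of 0] by simp
  moreover have "E s t \<noteq> 0" by (simp add: E_def)
  ultimately show ?thesis by (metis nonzero_divide_eq_eq)
qed

lemma deriv_poly_E:
  "((\<lambda>t. poly S t * E s t) has_field_derivative
     poly (pderiv S + [:s / (2 * (1 - A * C)), A / (2 * (1 - A * C)):] * S) t * E s t) (at t)"
proof (rule DERIV_cong[OF DERIV_mult[OF poly_DERIV deriv_E]])
  have *: "(s + A * t) / D = s / D + t * (A / D)" for D by (simp add: add_divide_distrib mult.commute)
  have alg: "p' * e + (u + t * v) * e * p = (p' + (u + t * (v + t * 0)) * p) * e" for p' e u v p :: complex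
    by (simp add: algebra_simps)
  show "poly (pderiv S) t * E s t + (s + A * t) / (2 * (1 - A * C)) * E s t * poly S t =
    poly (pderiv S + [:s / (2 * (1 - A * C)), A / (2 * (1 - A * C)):] * S) t * E s t"
    unfolding * poly_add poly_mult poly_pCons poly_0 by (rule alg)
qed

lemma G_poly: "\<exists>S. \<forall>t. G j k s t = poly S t * E s t"
proof -
  have step: "\<exists>S'. \<forall>t. G j (Suc k) s t = poly S' t * E s t" if S: "\<forall>t. G j k s t = poly S t * E s t" for j k S
  proof -
    have eq: "(\<lambda>t. G j k s t) = (\<lambda>t. poly S t * E s t)" using S by auto
    have "G j (Suc k) s t = poly (pderiv S + [:s / (2 * (1 - A * C)), A / (2 * (1 - A * C)):] * S) t * E s t" for t
      by (rule DERIV_unique[OF deriv_t[of j k s t, unfolded eq] deriv_poly_E])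
    then show ?thesis by blast
  qed
  have "\<exists>S. \<forall>t. G j 0 s t = poly S t * E s t"
  proof (induction j)
    case 0
    have "G 0 0 s t = poly [:G 0 0 s 0:] t * E s t" for t
      by (subst G_00) simp
    then show ?case by blast
  next
    case (Suc j)
    then obtain S where S: "\<forall>t. G j 0 s t = poly S t * E s t" by blast
    with step[OF S] obtain S' where S': "\<forall>t. G j 1 s t = poly S' t * E s t" by auto
    have "G (Suc j) 0 s t = poly ([:0, 1/2:] * S + smult C S') t * E s t" for t
    proof -
      have "t * (poly S t * E s t) + 2 * C * (poly S' t * E s t) = 2 * G (Suc j) 0 s t"
        using raise_j[of t j s] unfolding S[rule_format] S'[rule_format] .
      then have "G (Suc j) 0 s t = (t * (poly S t * E s t) + 2 * C * (poly S' t * E s t)) / 2" by simp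
      then show ?thesis by (subst \<open>G (Suc j) 0 s t = _\<close>) (simp add: algebra_simps add_divide_distrib)
    qed
    then show ?case by blast
  qed
  then show ?thesis by (induction k) (use step in blast)+
qed

lemma poly_integral:
  "(LINT w|lborel. poly H w * cnj (poly R w) * (exp (s * w + t * cnj w) * wt w))
     = (\<Sum>j\<le>degree H. \<Sum>k\<le>degree R. coeff H j * cnj (coeff R k) * G j k s t)"
  "rapid (\<lambda>w. poly H w * cnj (poly R w) * (exp (s * w + t * cnj w) * wt w))"
proof -
  define X where "X = (\<lambda>j k w. w ^ j * (cnj w ^ k * (exp (s * w + t * cnj w) * wt w)))"
  have eq: "poly H w * cnj (poly R w) * (exp (s * w + t * cnj w) * wt w) = (\<Sum>j\<le>degree H. \<Sum>k\<le>degree R. coeff H j * cnj (coeff R k) * X j k w)" for w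
    unfolding poly_altdef cnj_sum sum_product sum_distrib_right X_def by (intro sum.cong refl) (simp add: sum_distrib_left mult_ac)
  have r: "rapid (X j k)" for j k unfolding X_def by (rule rapid_integrand)
  have "(LINT w|lborel. (\<Sum>j\<le>degree H. \<Sum>k\<le>degree R. coeff H j * cnj (coeff R k) * X j k w)) = (\<Sum>j\<le>degree H. \<Sum>k\<le>degree R. coeff H j * cnj (coeff R k) * G j k s t)"
    using rapid_integrable[OF r] by (simp add: G_def X_def)
  then show "(LINT w|lborel. poly H w * cnj (poly R w) * (exp (s * w + t * cnj w) * wt w))
     = (\<Sum>j\<le>degree H. \<Sum>k\<le>degree R. coeff H j * cnj (coeff R k) * G j k s t)" unfolding eq .
  show "rapid (\<lambda>w. poly H w * cnj (poly R w) * (exp (s * w + t * cnj w) * wt w))"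
    unfolding mult.assoc by (intro rapid_poly rapid_wt_exp)
qed

lemma poly_integral_form:
  "\<exists>S. \<forall>t. (LINT w|lborel. poly H w * cnj (poly R w) * (exp (s * w + t * cnj w) * wt w)) = poly S t * E s t"
proof -
  obtain S where S: "\<And>j k t. G j k s t = poly (S j k) t * E s t" using G_poly[of _ _ s] by metis
  show ?thesis unfolding poly_integral
    by (intro exI[of _ "\<Sum>j\<le>degree H. \<Sum>k\<le>degree R. smult (coeff H j * cnj (coeff R k)) (S j k)"])
       (simp add: S poly_sum sum_distrib_right mult.assoc)
qed

end

interpretation iso: gaussian_weight 0 0 by unfold_locales simp

text \<open>
  In the isotropic case the recursion has no derivative term, and the moments reduce to derivatives of
  the monomial \<open>(t / 2) ^ j\<close>.
\<close>

lemma iso_G: "iso.G j k 0 t = of_real (pi / 2) * poly ((pderiv ^^ k) (monom (1 / 2 ^ j) j)) t"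
proof (induction k arbitrary: t)
  case 0
  have "iso.G j 0 0 t = of_real (pi / 2) * (t / 2) ^ j"
  proof (induction j)
    case 0
    have "iso.G 0 0 0 t = iso.G 0 0 0 0" by (subst iso.G_00) (simp add: iso.E_def)
    also have "\<dots> = (LINT w|lborel. of_real (exp (- 2 * (cmod w)\<^sup>2)))"
      unfolding iso.G_def iso.wt_def by (intro Bochner_Integration.integral_cong) (auto simp: exp_of_real[symmetric])
    also have "\<dots> = of_real (pi / 2)" unfolding integral_complex_of_real integrable_gaussian_complex(2)[OF zero_less_numeral] ..
    finally show ?case by simp
  next
    case (Suc j)
    have "iso.G (Suc j) 0 0 t = t * iso.G j 0 0 t / 2" using iso.raise_j[of t j 0] by simp
    then show ?case unfolding Suc by (simp add: algebra_simps)
  qed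
  then show ?case by (simp add: poly_monom power_divide)
next
  case (Suc k)
  have "(iso.G j k 0 has_field_derivative of_real (pi / 2) * poly (pderiv ((pderiv ^^ k) (monom (1 / 2 ^ j) j))) t) (at t)"
    unfolding Suc[abs_def] by (intro DERIV_cmult poly_DERIV)
  with iso.deriv_t[of j k 0 t] show ?case by (metis DERIV_unique comp_apply funpow.simps(2))
qed

section \<open>The stationary equation for the entire factors\<close>

definition fock :: "(complex \<Rightarrow> complex) \<Rightarrow> complex \<Rightarrow> complex" where
  "fock f z = exp (- complex_of_real ((cmod z)\<^sup>2 / 2)) * f z"

definition cubic :: "(complex \<Rightarrow> complex) \<Rightarrow> (complex \<Rightarrow> complex) \<Rightarrow> complex \<Rightarrow> complex" where
  "cubic g f z = of_real (1 / pi) *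
     (LINT w|lborel. exp (cnj w * z - 2 * of_real ((cmod w)\<^sup>2)) * of_real ((cmod (g w))\<^sup>2) * f w)"

text \<open>
  The stationary operator \<open>\<lambda> + \<alpha> \<cdot> \<Gamma>\<close> conjugated by the Gaussian: it acts on the entire factor \<open>f\<close> of
  \<open>fock f\<close>.
\<close>

definition advect :: "real \<Rightarrow> complex \<Rightarrow> (complex \<Rightarrow> complex) \<Rightarrow> complex \<Rightarrow> complex" where
  "advect lam \<alpha> f z = of_real lam * f z + \<i> * \<alpha> * deriv f z - \<i> * cnj \<alpha> * z * f z"

text \<open>
  The entire factor of the travelling profile at time \<open>t\<close>; the phase of the magnetic translation and
  the Gaussian of the shifted variable combine into one holomorphic exponential.
\<close>

definition shifted :: "real \<Rightarrow> complex \<Rightarrow> real \<Rightarrow> (complex \<Rightarrow> complex) \<Rightarrow> complex \<Rightarrow> complex" where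
  "shifted lam \<alpha> t f z =
     exp (- \<i> * of_real (lam * t) - of_real ((cmod \<alpha>)\<^sup>2 * t\<^sup>2 / 2) - cnj \<alpha> * of_real t * z) * f (z + \<alpha> * of_real t)"

lemma fock_proj_cubic:
  "fock_proj (\<lambda>w. of_real ((cmod (fock g w))\<^sup>2) * fock f w) z = exp (- of_real ((cmod z)\<^sup>2 / 2)) * cubic g f z"
proof -
  have "exp (cnj w * z - of_real ((cmod w)\<^sup>2 / 2)) * (of_real ((cmod (fock g w))\<^sup>2) * fock f w)
    = exp (cnj w * z - 2 * of_real ((cmod w)\<^sup>2)) * of_real ((cmod (g w))\<^sup>2) * f w" for w
  proof -
    define x where "x = (cmod w)\<^sup>2"
    have 1: "(cmod (fock g w))\<^sup>2 = exp (- x) * (cmod (g w))\<^sup>2"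
      unfolding fock_def norm_mult norm_exp_eq_Re power_mult_distrib exp_double[symmetric] x_def by simp
    have 2: "exp (cnj w * z - of_real (x / 2)) * (of_real (exp (- x)) * exp (- of_real (x / 2))) = exp (cnj w * z - 2 * of_real x)"
      unfolding exp_of_real[symmetric] exp_add[symmetric] by (rule arg_cong[where f = exp]) simp
    show ?thesis unfolding 1 unfolding fock_def x_def[symmetric] 2[symmetric] by (simp only: of_real_mult mult_ac)
  qed
  then show ?thesis unfolding fock_proj_def cubic_def by (simp only: mult_ac)
qed

lemma travelling_fock: "travelling (fock f) lam \<alpha> t = fock (shifted lam \<alpha> t f)"
proof
  fix z
  have "of_real ((cmod (z + \<alpha> * of_real t))\<^sup>2) = of_real ((cmod z)\<^sup>2) + (z * cnj \<alpha> + cnj z * \<alpha>) * of_real t + of_real ((cmod \<alpha>)\<^sup>2 * t\<^sup>2)"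
    unfolding of_real_mult[of "(cmod \<alpha>)\<^sup>2"] of_real_power[of t] complex_norm_square by (simp add: algebra_simps power2_eq_square)
  then have "- \<i> * of_real (lam * t) + (- (of_real ((cmod (z + \<alpha> * of_real t))\<^sup>2) / 2) + (1 / 2) * (cnj z * \<alpha> - z * cnj \<alpha>) * of_real t)
    = - (of_real ((cmod z)\<^sup>2) / 2) + (- \<i> * of_real (lam * t) - of_real ((cmod \<alpha>)\<^sup>2 * t\<^sup>2) / 2 - cnj \<alpha> * of_real t * z)"
    by (simp add: field_simps)
  then have "exp (- \<i> * of_real (lam * t)) * (exp (- (of_real ((cmod (z + \<alpha> * of_real t))\<^sup>2) / 2)) * exp ((1 / 2) * (cnj z * \<alpha> - z * cnj \<alpha>) * of_real t))
    = exp (- (of_real ((cmod z)\<^sup>2) / 2)) * exp (- \<i> * of_real (lam * t) - of_real ((cmod \<alpha>)\<^sup>2 * t\<^sup>2) / 2 - cnj \<alpha> * of_real t * z)"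
    unfolding exp_add[symmetric] by (rule arg_cong)
  moreover have "e1 * (e2 * F) * e3 = e4 * (e5 * F)" if "e1 * (e2 * e3) = e4 * e5" for e1 e2 e3 e4 e5 F :: complex
    using that by algebra
  ultimately show "travelling (fock f) lam \<alpha> t z = fock (shifted lam \<alpha> t f) z"
    unfolding travelling_def fock_def shifted_def of_real_divide of_real_numeral by blast
qed

lemma entire_deriv:
  assumes "f holomorphic_on UNIV" shows "(f has_field_derivative deriv f z) (at z)"
  using assms holomorphic_derivI open_UNIV by blast

lemma shifted_deriv_z:
  assumes f: "f holomorphic_on UNIV"
  shows "(shifted lam \<alpha> t f has_field_derivative
    exp (- \<i> * of_real (lam * t) - of_real ((cmod \<alpha>)\<^sup>2 * t\<^sup>2 / 2) - cnj \<alpha> * of_real t * z) *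
      (deriv f (z + \<alpha> * of_real t) - cnj \<alpha> * of_real t * f (z + \<alpha> * of_real t))) (at z)"
proof -
  have d1: "((\<lambda>z. f (z + \<alpha> * of_real t)) has_field_derivative deriv f (z + \<alpha> * of_real t)) (at z)"
    using DERIV_shift[of f "deriv f (z + \<alpha> * of_real t)" z "\<alpha> * of_real t"] entire_deriv[OF f] by simp
  have d2: "((\<lambda>z. - \<i> * of_real (lam * t) - of_real ((cmod \<alpha>)\<^sup>2 * t\<^sup>2 / 2) - cnj \<alpha> * of_real t * z) has_field_derivative - (cnj \<alpha> * of_real t)) (at z)"
    by (auto intro!: derivative_eq_intros)
  show ?thesis
    unfolding shifted_def by (rule DERIV_cong[OF DERIV_mult[OF DERIV_fun_exp[OF d2] d1]]) (simp add: algebra_simps)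
qed

lemma shifted_deriv_t:
  assumes f: "f holomorphic_on UNIV"
  shows "((\<lambda>s. shifted lam \<alpha> s f z) has_vector_derivative
     - \<i> * advect lam \<alpha> (shifted lam \<alpha> t f) z) (at t)"
proof -
  define e where "e = (\<lambda>s. exp (- \<i> * of_real lam * s - of_real ((cmod \<alpha>)\<^sup>2) * s\<^sup>2 / 2 - cnj \<alpha> * s * z))"
  define F where "F = (\<lambda>s. e s * f (z + \<alpha> * s))"
  define T where "T = complex_of_real t"
  have Fs: "shifted lam \<alpha> s f z = F (of_real s)" for s
    by (simp add: F_def e_def shifted_def mult.assoc)
  have d1: "((\<lambda>s. f (z + \<alpha> * s)) has_field_derivative deriv f (z + \<alpha> * T) * \<alpha>) (at T)"
    by (rule DERIV_chain2[OF entire_deriv[OF f]]) (auto intro!: derivative_eq_intros)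
  have "((\<lambda>s. - \<i> * of_real lam * s - of_real ((cmod \<alpha>)\<^sup>2) * s\<^sup>2 / 2 - cnj \<alpha> * s * z) has_field_derivative
      - \<i> * of_real lam - of_real ((cmod \<alpha>)\<^sup>2) * T - cnj \<alpha> * z) (at T)"
    by (auto intro!: derivative_eq_intros)
  then have d2: "(e has_field_derivative e T * (- \<i> * of_real lam - of_real ((cmod \<alpha>)\<^sup>2) * T - cnj \<alpha> * z)) (at T)"
    unfolding e_def by (rule DERIV_fun_exp)
  have d3: "(F has_field_derivative e T * (- \<i> * of_real lam - of_real ((cmod \<alpha>)\<^sup>2) * T - cnj \<alpha> * z) * f (z + \<alpha> * T)
      + deriv f (z + \<alpha> * T) * \<alpha> * e T) (at T)"
    unfolding F_def by (rule DERIV_mult[OF d2 d1])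
  have eT: "e T = exp (- \<i> * of_real (lam * t) - of_real ((cmod \<alpha>)\<^sup>2 * t\<^sup>2 / 2) - cnj \<alpha> * of_real t * z)"
    by (simp add: e_def T_def mult.assoc)
  have dz: "deriv (shifted lam \<alpha> t f) z = e T * (deriv f (z + \<alpha> * T) - cnj \<alpha> * T * f (z + \<alpha> * T))"
    using DERIV_imp_deriv[OF shifted_deriv_z[OF f, of lam \<alpha> t z]] unfolding eT[symmetric] unfolding T_def .
  have a2: "of_real ((cmod \<alpha>)\<^sup>2) = \<alpha> * cnj \<alpha>" by (rule complex_norm_square)
  have "e T * (- \<i> * of_real lam - of_real ((cmod \<alpha>)\<^sup>2) * T - cnj \<alpha> * z) * f (z + \<alpha> * T) + deriv f (z + \<alpha> * T) * \<alpha> * e T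
     = - \<i> * advect lam \<alpha> (shifted lam \<alpha> t f) z"
    unfolding advect_def dz Fs F_def T_def[symmetric] a2 by (simp add: algebra_simps)
  with d3 have "(F has_field_derivative - \<i> * advect lam \<alpha> (shifted lam \<alpha> t f) z) (at (of_real t))" unfolding T_def by simp
  then show ?thesis unfolding Fs using has_vector_derivative_real_field[of F _ t UNIV] by simp
qed

lemma shifted_0: "shifted lam \<alpha> 0 f = f"
  by (simp add: shifted_def fun_eq_iff)

text \<open>
  The Gaussian never vanishes, so the evolution equation at time \<open>t\<close> is the stationary equation for
  the entire factors of the profiles translated up to time \<open>t\<close>.
\<close>

lemma progressive_wave_iff:
  assumes f: "f holomorphic_on UNIV" and g: "g holomorphic_on UNIV"
  shows "progressive_wave_initial (fock f) (fock g) lam mu \<alpha> \<longleftrightarrow>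
    (\<forall>t. fock (shifted lam \<alpha> t f) \<in> bargmann_fock \<and> fock (shifted mu \<alpha> t g) \<in> bargmann_fock \<and>
      (\<forall>z. advect lam \<alpha> (shifted lam \<alpha> t f) z = cubic (shifted mu \<alpha> t g) (shifted lam \<alpha> t f) z \<and>
           advect mu \<alpha> (shifted mu \<alpha> t g) z = - cubic (shifted lam \<alpha> t f) (shifted mu \<alpha> t g) z))"
proof -
  have D: "((\<lambda>s. fock (shifted lam \<alpha> s f) z) has_vector_derivative
      exp (- of_real ((cmod z)\<^sup>2 / 2)) * (- \<i> * advect lam \<alpha> (shifted lam \<alpha> t f) z)) (at t)"
    if "f holomorphic_on UNIV" for f lam t z
    unfolding fock_def by (intro has_vector_derivative_mult_right shifted_deriv_t that)
  have D': "((\<lambda>s. fock (shifted lam \<alpha> s f) z) has_vector_derivative d) (at t) \<longleftrightarrow>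
      d = exp (- of_real ((cmod z)\<^sup>2 / 2)) * (- \<i> * advect lam \<alpha> (shifted lam \<alpha> t f) z)"
    if "f holomorphic_on UNIV" for f lam t z d
    using D[OF that] vector_derivative_unique_at by metis
  have I: "\<i> * (e * (- \<i> * A)) = e * A" for e A :: complex
  proof -
    have "\<i> * (e * (- \<i> * A)) = - (\<i> * \<i>) * (e * A)" by algebra
    then show ?thesis by simp
  qed
  have K: "\<i> * (exp x * (- \<i> * A)) = exp x * B \<longleftrightarrow> A = B" "\<i> * (exp x * (- \<i> * A)) = - (exp x * B) \<longleftrightarrow> A = - B"
    for x A B :: complex
    unfolding I mult_minus_right[of "exp x" B, symmetric] mult_cancel_left by simp_all
  have ex: "(\<exists>du dv. du = p \<and> dv = q \<and> P du \<and> Q dv) \<longleftrightarrow> P p \<and> Q q" for p q :: complex and P Q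
    by blast
  show ?thesis
    unfolding progressive_wave_initial_def is_solution_def travelling_fock D'[OF f] D'[OF g] fock_proj_cubic ex K
    by (simp only: all_conj_distrib conj_assoc)
qed

section \<open>Fock functions with finitely many zeros\<close>

lemma lborel_complex_eq_vec: "distr lborel borel (\<lambda>v::real^2. Complex (v$1) (v$2)) = lborel"
proof (rule lborel_eqI[symmetric])
  have [measurable]: "(\<lambda>v::real^2. Complex (v$1) (v$2)) \<in> borel_measurable borel"
    unfolding Complex_eq by (intro borel_measurable_continuous_onI continuous_intros)
  fix l u :: complex assume le: "\<And>b. b \<in> Basis \<Longrightarrow> l \<bullet> b \<le> u \<bullet> b"
  then have le': "Re l \<le> Re u" "Im l \<le> Im u" using le[of 1] le[of \<i>] by (simp_all add: Basis_complex_def)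
  have "(\<lambda>v::real^2. Complex (v$1) (v$2)) -` box l u = box (vector [Re l, Im l]) (vector [Re u, Im u])"
    by (rule set_eqI) (auto simp: mem_box_cart mem_box Basis_complex_def forall_2)
  moreover have "emeasure lborel (box (vector [Re l, Im l]) (vector [Re u, Im u] :: real^2)) = ennreal ((Re u - Re l) * (Im u - Im l))"
  proof -
    have "emeasure lborel (box (vector [Re l, Im l]) (vector [Re u, Im u] :: real^2)) = emeasure lborel (cbox (vector [Re l, Im l]) (vector [Re u, Im u] :: real^2))"
      by (simp add: emeasure_lborel_box_eq emeasure_lborel_cbox_eq)
    also have "\<dots> = ennreal (measure lborel (cbox (vector [Re l, Im l]) (vector [Re u, Im u] :: real^2)))"
      by (intro emeasure_eq_ennreal_measure) (metis emeasure_lborel_cbox_finite infinity_ennreal_def less_irrefl)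
    also have "measure lborel (cbox (vector [Re l, Im l]) (vector [Re u, Im u] :: real^2)) = (Re u - Re l) * (Im u - Im l)"
      using le' by (subst content_cbox_cart) (auto simp: prod_2 UNIV_2 interval_ne_empty_cart forall_2)
    finally show ?thesis .
  qed
  ultimately show "emeasure (distr lborel borel (\<lambda>v::real^2. Complex (v$1) (v$2))) (box l u) = ennreal (\<Prod>b\<in>Basis. (u - l) \<bullet> b)"
    by (subst emeasure_distr) (auto simp: Basis_complex_def)
qed simp

text \<open>
  Orthogonal maps of \<open>real^2\<close> preserve volume; the identification with the complex plane carries this
  over to multiplication by unimodular numbers.
\<close>

lemma lborel_rotate:
  fixes u :: complex assumes "cmod u = 1"
  shows "distr lborel borel (\<lambda>w. u * w) = (lborel :: complex measure)"
proof -
  define T where "T = (\<lambda>v::real^2. Complex (v$1) (v$2))"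
  define Ti where "Ti = (\<lambda>z. vector [Re z, Im z] :: real^2)"
  have TTi [simp]: "T (Ti z) = z" "Ti (T v) = v" for z v
    by (auto simp: T_def Ti_def vec_eq_iff forall_2)
  have [measurable]: "T \<in> borel_measurable borel"
    unfolding T_def Complex_eq by (intro borel_measurable_continuous_onI continuous_intros)
  have n: "norm (Ti z) = cmod z" for z
    by (simp add: Ti_def norm_vec_def L2_set_def sum_2 cmod_def)
  define \<rho> where "\<rho> = (\<lambda>v. Ti (cnj u * T v))"
  have uu: "u * cnj u = 1" using assms by (simp add: complex_mult_cnj cmod_def)
  then have uu': "u * (cnj u * x) = x" "cnj u * (u * x) = x" for x
    by (metis mult.assoc mult_1, metis mult.assoc mult.commute mult_1)
  have orth: "orthogonal_transformation \<rho>"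
  proof -
    have lin: "linear \<rho>"
      by (rule linearI) (simp_all add: \<rho>_def Ti_def T_def vec_eq_iff forall_2 ring_distribs)
    have "norm (\<rho> v) = norm v" for v
      using n[of "T v"] assms by (simp add: \<rho>_def n norm_mult)
    with lin show ?thesis by (simp add: orthogonal_transformation)
  qed
  have em: "emeasure (distr lborel borel (\<lambda>w. u * w)) (box l r) = emeasure lborel (box l r)" for l r :: complex
  proof -
  have bd: "bounded (T -` box l r)"
  proof -
    obtain B where B: "\<And>z. z \<in> box l r \<Longrightarrow> cmod z \<le> B" using bounded_box[of l r] unfolding bounded_iff by blast
    have "norm v \<le> B" if "v \<in> T -` box l r" for v using n[of "T v"] that B[of "T v"] by simp
    then show ?thesis by (rule boundedI)
  qed
  have bor: "T -` box l r \<in> sets borel"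
    using measurable_sets[of T borel borel "box l r"] by simp
  then have lm: "T -` box l r \<in> lmeasurable"
    by (intro bounded_set_imp_lmeasurable bd) (auto simp: sets_completionI_sets)
  have im: "T -` ((\<lambda>w. u * w) -` box l r) = \<rho> ` (T -` box l r)"
  proof (intro equalityI subsetI)
    fix v assume "v \<in> T -` ((\<lambda>w. u * w) -` box l r)"
    then have "Ti (u * T v) \<in> T -` box l r" "\<rho> (Ti (u * T v)) = v" by (simp_all add: \<rho>_def uu')
    then show "v \<in> \<rho> ` (T -` box l r)" by (metis image_eqI)
  next
    fix v assume "v \<in> \<rho> ` (T -` box l r)"
    then show "v \<in> T -` ((\<lambda>w. u * w) -` box l r)" by (auto simp: \<rho>_def uu')
  qed
  have bor2: "T -` ((\<lambda>w. u * w) -` box l r) \<in> sets borel"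
    using measurable_sets[of "\<lambda>v. u * T v" borel borel "box l r"] by (simp add: vimage_comp comp_def)
  have "emeasure (distr lborel borel (\<lambda>w. u * w)) (box l r) = emeasure (distr lborel borel T) ((\<lambda>w. u * w) -` box l r)"
    unfolding T_def lborel_complex_eq_vec by (subst emeasure_distr) auto
  also have "\<dots> = emeasure lborel (T -` ((\<lambda>w. u * w) -` box l r))"
    using measurable_sets[of "\<lambda>w. u * w" borel borel "box l r"] by (subst emeasure_distr) auto
  also have "\<dots> = emeasure lebesgue (T -` ((\<lambda>w. u * w) -` box l r))" using bor2 by simp
  also have "\<dots> = emeasure lebesgue (\<rho> ` (T -` box l r))" unfolding im ..
  also have "\<dots> = ennreal (measure lebesgue (\<rho> ` (T -` box l r)))"
    by (rule emeasure_eq_measure2[OF measurable_orthogonal_image[OF orth lm]])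
  also have "\<dots> = ennreal (measure lebesgue (T -` box l r))" by (simp add: measure_orthogonal_image[OF orth lm])
  also have "\<dots> = emeasure lebesgue (T -` box l r)" by (rule emeasure_eq_measure2[OF lm, symmetric])
  also have "\<dots> = emeasure lborel (T -` box l r)" using bor by simp
  also have "\<dots> = emeasure (distr lborel borel T) (box l r)" by (subst emeasure_distr) auto
  also have "\<dots> = emeasure lborel (box l r)" unfolding T_def lborel_complex_eq_vec ..
  finally show ?thesis .
  qed
  show ?thesis
    by (rule lborel_eqI[symmetric]) (simp_all add: em)
qed

lemma circle_mean:
  assumes "F holomorphic_on UNIV"
  shows "(LINT t|lborel. indicator {0..1} t *\<^sub>R F (exp (2 * of_real pi * \<i> * of_real t) * v)) = F 0"
proof -
  have h: "(\<lambda>w. F (w * v)) holomorphic_on A" for A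
    by (rule holomorphic_on_compose_gen[of "\<lambda>w. w * v" A F UNIV, unfolded o_def, OF _ assms]) (auto intro!: holomorphic_intros)
  have "((\<lambda>w. F (w * v) / (w - 0)) has_contour_integral (2 * of_real pi * \<i> * F (0 * v))) (circlepath 0 1)"
    by (rule Cauchy_integral_circlepath) (auto intro!: h holomorphic_on_imp_continuous_on)
  then have A: "((\<lambda>t. F (circlepath 0 1 t * v) / (circlepath 0 1 t - 0) * vector_derivative (circlepath 0 1) (at t)) has_integral (2 * of_real pi * \<i> * F (0 * v))) {0..1}"
    unfolding has_contour_integral .
  have B: "F (circlepath 0 1 t * v) / (circlepath 0 1 t - 0) * vector_derivative (circlepath 0 1) (at t)
       = F (exp (2 * of_real pi * \<i> * of_real t) * v) * (2 * of_real pi * \<i>)" if "t \<in> {0..1}" for t :: real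
  proof -
    have "vector_derivative (circlepath 0 1) (at t) = 2 * of_real pi * \<i> * exp (2 * of_real pi * \<i> * of_real t)"
      by (simp add: vector_derivative_circlepath)
    then show ?thesis by (simp add: circlepath)
  qed
  have "((\<lambda>t. F (exp (2 * of_real pi * \<i> * of_real t) * v) * (2 * of_real pi * \<i>)) has_integral (2 * of_real pi * \<i> * F (0 * v))) {0..1}"
    by (rule has_integral_eq[OF B A])
  from has_integral_divide[OF this, of "2 * of_real pi * \<i>"]
  have "((\<lambda>t. F (exp (2 * of_real pi * \<i> * of_real t) * v)) has_integral F 0) {0..1}" by simp
  moreover have "continuous_on {0..1::real} (\<lambda>t. F (exp (2 * of_real pi * \<i> * of_real t) * v))"
    by (rule continuous_on_compose2[OF holomorphic_on_imp_continuous_on[OF h[of UNIV]]]) (auto intro!: continuous_intros)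
  then have "set_integrable lborel {0..1} (\<lambda>t. F (exp (2 * of_real pi * \<i> * of_real t) * v))"
    using borel_integrable_atLeastAtMost' by blast
  ultimately show ?thesis
    using set_borel_integral_eq_integral(2) by (metis integral_unique set_lebesgue_integral_def)
qed

lemma lborel_integral_rotate:
  fixes f :: "complex \<Rightarrow> complex"
  assumes [measurable]: "f \<in> borel_measurable borel" and "cmod u = 1"
  shows "(LINT w|lborel. f (u * w)) = (LINT w|lborel. f w)"
proof -
  have "(LINT w|lborel. f w) = (LINT w|distr lborel borel (\<lambda>w. u * w). f w)" by (simp add: lborel_rotate[OF assms(2)])
  also have "\<dots> = (LINT w|lborel. f (u * w))" by (rule integral_distr) auto
  finally show ?thesis ..
qed

text \<open>
  Averaging the integral over all rotations of the disc and exchanging the integrals turns the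
  integrand into its circle means, which all equal \<open>F 0\<close>.
\<close>

lemma area_mean:
  assumes F: "F holomorphic_on UNIV"
  shows "(LINT v|lborel. indicator (cball 0 1) v *\<^sub>R F v) = measure lborel (cball (0::complex) 1) *\<^sub>R F 0"
proof -
  define e where "e = (\<lambda>t::real. exp (2 * of_real pi * \<i> * of_real t))"
  have e1: "cmod (e t) = 1" for t by (simp add: e_def)
  have cF: "continuous_on A F" for A
    using F holomorphic_on_imp_continuous_on holomorphic_on_subset by blast
  have [measurable]: "F \<in> borel_measurable borel" by (rule borel_measurable_continuous_onI[OF cF])
  have m: "(\<lambda>v. indicator (cball 0 1) v *\<^sub>R F v) \<in> borel_measurable borel"
    by (intro borel_measurable_scaleR borel_measurable_indicator) auto
  define g where "g = (\<lambda>(t::real) v. (indicator {0..1} t * indicator (cball 0 1) v) *\<^sub>R F (e t * v))"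
  define I where "I = (LINT v|lborel. indicator (cball 0 1) v *\<^sub>R F v)"
  have int: "integrable (lborel \<Otimes>\<^sub>M lborel) (\<lambda>(t, v). g t v)"
  proof -
    have "integrable lborel (\<lambda>p::real\<times>complex. indicator ({0..1} \<times> cball 0 1) p *\<^sub>R F (e (fst p) * snd p))"
      unfolding set_integrable_def[symmetric]
      by (rule borel_integrable_compact[unfolded set_integrable_def[symmetric]])
         (auto intro!: compact_Times continuous_on_compose2[OF cF[of UNIV]] continuous_intros simp: e_def)
    then show ?thesis unfolding lborel_prod
      by (rule Bochner_Integration.integrable_cong[THEN iffD1, rotated 2]) (auto simp: g_def indicator_times)
  qed
  have "(LINT t|lborel. LINT v|lborel. g t v) = (LINT t|lborel. indicator {0..1::real} t *\<^sub>R I)"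
  proof (rule Bochner_Integration.integral_cong[OF refl])
    fix t
    have "(LINT v|lborel. g t v) = (LINT v|lborel. indicator {0..1} t *\<^sub>R (indicator (cball 0 1) (e t * v) *\<^sub>R F (e t * v)))"
      by (intro Bochner_Integration.integral_cong refl) (auto simp: g_def indicator_def norm_mult e1)
    also have "\<dots> = indicator {0..1} t *\<^sub>R (LINT v|lborel. indicator (cball 0 1) (e t * v) *\<^sub>R F (e t * v))"
      by (rule integral_scaleR_right)
    also have "\<dots> = indicator {0..1} t *\<^sub>R I"
      unfolding I_def by (rule arg_cong[where f = "(*\<^sub>R) _"], rule lborel_integral_rotate[OF m e1[of t]])
    finally show "(LINT v|lborel. g t v) = indicator {0..1} t *\<^sub>R I" .
  qed
  also have "\<dots> = I" by simp
  finally have 1: "(LINT t|lborel. LINT v|lborel. g t v) = I" .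
  have "(LINT v|lborel. LINT t|lborel. g t v) = (LINT v|lborel. indicator (cball (0::complex) 1) v *\<^sub>R F 0)"
  proof (rule Bochner_Integration.integral_cong[OF refl])
    fix v
    have "(LINT t|lborel. g t v) = (LINT t|lborel. indicator (cball 0 1) v *\<^sub>R (indicator {0..1} t *\<^sub>R F (e t * v)))"
      by (intro Bochner_Integration.integral_cong refl) (auto simp: g_def)
    also have "\<dots> = indicator (cball 0 1) v *\<^sub>R (LINT t|lborel. indicator {0..1} t *\<^sub>R F (e t * v))"
      by (rule integral_scaleR_right)
    also have "\<dots> = indicator (cball 0 1) v *\<^sub>R F 0"
      unfolding e_def circle_mean[OF F] ..
    finally show "(LINT t|lborel. g t v) = indicator (cball 0 1) v *\<^sub>R F 0" .
  qed
  also have "\<dots> = (LINT v|lborel. indicator (cball (0::complex) 1) v) *\<^sub>R F 0"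
    by (rule integral_scaleR_left, rule integrable_real_indicator) (simp_all add: emeasure_lborel_cball_finite[unfolded infinity_ennreal_def])
  also have "\<dots> = measure lborel (cball (0::complex) 1) *\<^sub>R F 0" by simp
  also have "(LINT v|lborel. LINT t|lborel. g t v) = (LINT t|lborel. LINT v|lborel. g t v)"
    using pair_sigma_finite.Fubini_integral[OF _ int] by (simp add: lborel_pair.pair_sigma_finite_axioms)
  finally show ?thesis using 1 by (simp add: I_def)
qed

text \<open>
  Magnetic translation to the centre \<open>z\<close> makes the estimate uniform in \<open>z\<close>: the function
  \<open>(f (z + v) * exp (- cnj z * v))\<^sup>2\<close> is entire in \<open>v\<close>, and its modulus is
  \<open>exp ((cmod z)\<^sup>2 + (cmod v)\<^sup>2)\<close> times the square of the Fock function at \<open>z + v\<close>.  The mean value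
  property at \<open>v = 0\<close> then gives the bound.
\<close>

lemma fock_local_bound:
  assumes f: "f holomorphic_on UNIV"
  shows "measure lborel (cball (0::complex) 1) * (cmod (exp (- of_real ((cmod z)\<^sup>2 / 2)) * f z))\<^sup>2
    \<le> exp 1 * (LINT v|lborel. indicator (cball z 1) v * (cmod (exp (- of_real ((cmod v)\<^sup>2 / 2)) * f v))\<^sup>2)"
proof -
  define U where "U = (\<lambda>z. exp (- of_real ((cmod z)\<^sup>2 / 2)) * f z)"
  define F where "F = (\<lambda>v. (f (z + v) * exp (- cnj z * v))\<^sup>2)"
  have contf: "continuous_on A f" for A
    using f holomorphic_on_imp_continuous_on holomorphic_on_subset by blast
  have [measurable]: "f \<in> borel_measurable borel" by (rule borel_measurable_continuous_onI[OF contf])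
  have [measurable]: "U \<in> borel_measurable borel" unfolding U_def by measurable
  have m [measurable]: "(\<lambda>v. indicator (cball z 1) v * (cmod (U v))\<^sup>2) \<in> borel_measurable borel" for z
    by (intro borel_measurable_times borel_measurable_indicator borel_measurable_power borel_measurable_norm) auto
  have hF: "F holomorphic_on UNIV"
    unfolding F_def
    by (intro holomorphic_intros holomorphic_on_compose_gen[of "\<lambda>v. z + v" UNIV f UNIV, unfolded o_def, OF _ f]) auto
  have nF: "cmod (F v) = exp ((cmod z)\<^sup>2 + (cmod v)\<^sup>2) * (cmod (U (z + v)))\<^sup>2" for v
  proof -
    have "(cmod (z + v))\<^sup>2 = (cmod z)\<^sup>2 + (cmod v)\<^sup>2 + 2 * Re (cnj z * v)"
      unfolding cmod_power2 by (simp add: algebra_simps power2_eq_square)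
    then have "exp ((cmod z)\<^sup>2 + (cmod v)\<^sup>2) * exp (- (cmod (z + v))\<^sup>2) = exp (2 * Re (- cnj z * v))"
      unfolding exp_add[symmetric] by simp
    moreover have "(cmod (U (z + v)))\<^sup>2 = exp (- (cmod (z + v))\<^sup>2) * (cmod (f (z + v)))\<^sup>2"
      unfolding U_def norm_mult norm_exp_eq_Re power_mult_distrib exp_double[symmetric] by simp
    moreover have "cmod (F v) = exp (2 * Re (- cnj z * v)) * (cmod (f (z + v)))\<^sup>2"
      unfolding F_def norm_mult norm_power norm_exp_eq_Re power_mult_distrib exp_double[symmetric] by simp
    ultimately show ?thesis by (metis mult.assoc)
  qed
  have int: "integrable lborel (\<lambda>v. indicator (cball z 1) v * (cmod (U v))\<^sup>2)"
  proof -
    have "continuous_on (cball z 1) (\<lambda>v. (cmod (U v))\<^sup>2)"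
      unfolding U_def by (intro continuous_intros contf) auto
    then show ?thesis using borel_integrable_compact[of "cball z 1" "\<lambda>v. (cmod (U v))\<^sup>2"] by (simp add: indicator_scaleR_eq_if)
  qed
  have intF: "integrable lborel (\<lambda>v. indicator (cball 0 1) v *\<^sub>R F v)"
    by (rule borel_integrable_compact[OF compact_cball holomorphic_on_imp_continuous_on[OF holomorphic_on_subset[OF hF subset_UNIV]]])
  have shift: "(LINT v|lborel. indicator (cball z 1) v * (cmod (U v))\<^sup>2) = (LINT v|lborel. indicator (cball 0 1) v * (cmod (U (z + v)))\<^sup>2)"
    and shift_int: "integrable lborel (\<lambda>v. indicator (cball 0 1) v * (cmod (U (z + v)))\<^sup>2)"
  proof -
    have eq: "indicator (cball z 1) (z + v) = (indicator (cball 0 1) v :: real)" for v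
      by (auto simp: indicator_def dist_norm)
    have "(LINT v|lborel. indicator (cball z 1) v * (cmod (U v))\<^sup>2) = (LINT v|distr lborel borel ((+) z). indicator (cball z 1) v * (cmod (U v))\<^sup>2)"
      by (simp add: lborel_distr_plus)
    also have "\<dots> = (LINT v|lborel. indicator (cball z 1) (z + v) * (cmod (U (z + v)))\<^sup>2)"
      by (rule integral_distr) (use m in auto)
    finally show "(LINT v|lborel. indicator (cball z 1) v * (cmod (U v))\<^sup>2) = (LINT v|lborel. indicator (cball 0 1) v * (cmod (U (z + v)))\<^sup>2)"
      unfolding eq .
    have "integrable (distr lborel borel ((+) z)) (\<lambda>v. indicator (cball z 1) v * (cmod (U v))\<^sup>2)"
      using int by (simp add: lborel_distr_plus)
    then have "integrable lborel (\<lambda>v. indicator (cball z 1) (z + v) * (cmod (U (z + v)))\<^sup>2)"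
      by (subst (asm) integrable_distr_eq) (use m in auto)
    then show "integrable lborel (\<lambda>v. indicator (cball 0 1) v * (cmod (U (z + v)))\<^sup>2)" unfolding eq .
  qed
  have "exp ((cmod z)\<^sup>2) * (measure lborel (cball (0::complex) 1) * (cmod (U z))\<^sup>2) = cmod (measure lborel (cball (0::complex) 1) *\<^sub>R F 0)"
    by (simp add: nF)
  also have "\<dots> = cmod (LINT v|lborel. indicator (cball 0 1) v *\<^sub>R F v)"
    by (simp only: area_mean[OF hF])
  also have "\<dots> \<le> (LINT v|lborel. exp ((cmod z)\<^sup>2 + 1) * (indicator (cball 0 1) v * (cmod (U (z + v)))\<^sup>2))"
  proof (rule Bochner_Integration.integral_norm_bound_integral[OF intF])
    show "integrable lborel (\<lambda>v. exp ((cmod z)\<^sup>2 + 1) * (indicator (cball 0 1) v * (cmod (U (z + v)))\<^sup>2))"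
      by (intro integrable_mult_right shift_int)
    fix v
    show "cmod (indicator (cball 0 1) v *\<^sub>R F v) \<le> exp ((cmod z)\<^sup>2 + 1) * (indicator (cball 0 1) v * (cmod (U (z + v)))\<^sup>2)"
    proof (cases "v \<in> cball 0 1")
      case True
      then have "(cmod v)\<^sup>2 \<le> 1" by (simp add: power_le_one)
      then have "cmod (F v) \<le> exp ((cmod z)\<^sup>2 + 1) * (cmod (U (z + v)))\<^sup>2"
        unfolding nF by (intro mult_right_mono) auto
      with True show ?thesis by simp
    qed simp
  qed
  also have "\<dots> = exp ((cmod z)\<^sup>2) * (exp 1 * (LINT v|lborel. indicator (cball z 1) v * (cmod (U v))\<^sup>2))"
    unfolding shift by (simp add: exp_add)
  finally show ?thesis unfolding U_def by simp
qed

lemma measure_cball_pos: "measure lborel (cball (0::complex) 1) > 0"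
  using content_cball_pos[of 1 "0::complex"] by simp

lemma fock_bounded:
  assumes f: "f holomorphic_on UNIV" and int: "integrable lborel (\<lambda>z. (cmod (exp (- of_real ((cmod z)\<^sup>2 / 2)) * f z))\<^sup>2)"
  shows "\<exists>M. \<forall>z. cmod (f z) \<le> M * exp ((cmod z)\<^sup>2 / 2)"
proof -
  define U where "U = (\<lambda>z. exp (- of_real ((cmod z)\<^sup>2 / 2)) * f z)"
  define \<kappa> where "\<kappa> = measure lborel (cball (0::complex) 1)"
  have \<kappa>: "\<kappa> > 0" unfolding \<kappa>_def by (rule measure_cball_pos)
  define N where "N = exp 1 * (LINT v|lborel. (cmod (U v))\<^sup>2) / \<kappa>"
  have "(cmod (U z))\<^sup>2 \<le> N" for z
  proof -
    have [measurable]: "U \<in> borel_measurable borel"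
      unfolding U_def by (intro borel_measurable_continuous_onI continuous_intros holomorphic_on_imp_continuous_on f) auto
    have mm [measurable]: "(\<lambda>v. indicator (cball z 1) v * (cmod (U v))\<^sup>2) \<in> borel_measurable borel" for z
      by (intro borel_measurable_times borel_measurable_indicator borel_measurable_power borel_measurable_norm) auto
    have "\<kappa> * (cmod (U z))\<^sup>2 \<le> exp 1 * (LINT v|lborel. indicator (cball z 1) v * (cmod (U v))\<^sup>2)"
      using fock_local_bound[OF f, of z] unfolding U_def \<kappa>_def .
    also have "\<dots> \<le> exp 1 * (LINT v|lborel. (cmod (U v))\<^sup>2)"
    proof (intro mult_left_mono Bochner_Integration.integral_mono)
      show i: "integrable lborel (\<lambda>v. (cmod (U v))\<^sup>2)" using int by (simp add: U_def)
      show "integrable lborel (\<lambda>v. indicator (cball z 1) v * (cmod (U v))\<^sup>2)"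
        by (rule Bochner_Integration.integrable_bound[OF i]) (use mm in \<open>auto simp: indicator_def\<close>)
    qed (auto simp: indicator_def)
    finally show ?thesis using \<kappa> by (simp add: N_def field_simps)
  qed
  then have U: "cmod (U z) \<le> sqrt N" for z by (simp add: real_le_rsqrt)
  have "cmod (f z) \<le> sqrt N * exp ((cmod z)\<^sup>2 / 2)" for z
  proof -
    have "cmod (f z) = exp ((cmod z)\<^sup>2 / 2) * cmod (U z)"
      unfolding U_def norm_mult norm_exp_eq_Re by (simp add: mult.assoc[symmetric] exp_add[symmetric] del: of_real_power)
    also have "\<dots> \<le> exp ((cmod z)\<^sup>2 / 2) * sqrt N" by (intro mult_left_mono U) auto
    finally show ?thesis by (simp add: mult.commute)
  qed
  then show ?thesis by blast
qed

text \<open>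
  The unit discs around the points \<open>z n\<close> leave every bounded set, so the mass of an integrable function
  on them tends to zero.
\<close>

lemma fock_decay:
  assumes f: "f holomorphic_on UNIV" and int: "integrable lborel (\<lambda>z. (cmod (exp (- of_real ((cmod z)\<^sup>2 / 2)) * f z))\<^sup>2)"
    and z: "filterlim (\<lambda>n. cmod (z n)) at_top sequentially"
  shows "(\<lambda>n. exp (- of_real ((cmod (z n))\<^sup>2 / 2)) * f (z n)) \<longlonglongrightarrow> 0"
proof -
  define U where "U = (\<lambda>z. exp (- of_real ((cmod z)\<^sup>2 / 2)) * f z)"
  define \<kappa> where "\<kappa> = measure lborel (cball (0::complex) 1)"
  have \<kappa>: "\<kappa> > 0" unfolding \<kappa>_def by (rule measure_cball_pos)
  have [measurable]: "U \<in> borel_measurable borel"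
    unfolding U_def by (intro borel_measurable_continuous_onI continuous_intros holomorphic_on_imp_continuous_on f) auto
  have m [measurable]: "(\<lambda>v. indicator (cball z 1) v * (cmod (U v))\<^sup>2) \<in> borel_measurable borel" for z
    by (intro borel_measurable_times borel_measurable_indicator borel_measurable_power borel_measurable_norm) auto
  have "(\<lambda>n. LINT v|lborel. indicator (cball (z n) 1) v * (cmod (U v))\<^sup>2) \<longlonglongrightarrow> (LINT v|(lborel :: complex measure). 0 :: real)"
  proof (rule integral_dominated_convergence)
    show "integrable lborel (\<lambda>v. (cmod (U v))\<^sup>2)" using int by (simp add: U_def)
    show "AE v in lborel. (\<lambda>n. indicator (cball (z n) 1) v * (cmod (U v))\<^sup>2) \<longlonglongrightarrow> 0"
    proof (intro AE_I2 tendsto_eventually)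
      fix v
      have "\<forall>\<^sub>F n in sequentially. cmod v + 1 < cmod (z n)"
        using z by (simp add: filterlim_at_top_dense)
      then show "\<forall>\<^sub>F n in sequentially. indicator (cball (z n) 1) v * (cmod (U v))\<^sup>2 = 0"
      proof eventually_elim
        case (elim n)
        have "cmod (z n) \<le> dist (z n) v + cmod v" by (simp add: dist_norm norm_triangle_sub add.commute)
        with elim show ?case by (simp add: indicator_def)
      qed
    qed
    show "AE v in lborel. norm (indicator (cball (z n) 1) v * (cmod (U v))\<^sup>2) \<le> (cmod (U v))\<^sup>2" for n
      by (intro AE_I2) (auto simp: indicator_def)
  qed (use m in auto)
  then have "(\<lambda>n. exp 1 / \<kappa> * (LINT v|lborel. indicator (cball (z n) 1) v * (cmod (U v))\<^sup>2)) \<longlonglongrightarrow> exp 1 / \<kappa> * 0"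
    by (intro tendsto_mult_left) simp
  then have lim: "(\<lambda>n. exp 1 / \<kappa> * (LINT v|lborel. indicator (cball (z n) 1) v * (cmod (U v))\<^sup>2)) \<longlonglongrightarrow> 0"
    by simp
  have "\<forall>\<^sub>F n in sequentially. norm ((cmod (U (z n)))\<^sup>2) \<le> exp 1 / \<kappa> * (LINT v|lborel. indicator (cball (z n) 1) v * (cmod (U v))\<^sup>2)"
  proof (intro always_eventually allI)
    fix n
    have "\<kappa> * (cmod (U (z n)))\<^sup>2 \<le> exp 1 * (LINT v|lborel. indicator (cball (z n) 1) v * (cmod (U v))\<^sup>2)"
      using fock_local_bound[OF f, of "z n"] unfolding U_def \<kappa>_def .
    then show "norm ((cmod (U (z n)))\<^sup>2) \<le> exp 1 / \<kappa> * (LINT v|lborel. indicator (cball (z n) 1) v * (cmod (U v))\<^sup>2)"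
      using \<kappa> by (simp add: field_simps)
  qed
  then have "(\<lambda>n. (cmod (U (z n)))\<^sup>2) \<longlonglongrightarrow> 0" by (rule Lim_null_comparison[OF _ lim])
  then have "(\<lambda>n. sqrt ((cmod (U (z n)))\<^sup>2)) \<longlonglongrightarrow> sqrt 0" by (intro tendsto_real_sqrt)
  then show ?thesis unfolding U_def by (simp add: tendsto_norm_zero_iff)
qed

lemma poly_lower_bound:
  fixes P :: "complex poly" assumes "P \<noteq> 0"
  shows "\<exists>r c. c > 0 \<and> (\<forall>z. r \<le> cmod z \<longrightarrow> c \<le> cmod (poly P z))"
proof (cases P)
  case (pCons a p)
  show ?thesis
  proof (cases "p = 0")
    case True
    with pCons assms show ?thesis by (intro exI[of _ 0] exI[of _ "cmod a"]) auto
  next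
    case False
    then obtain r where "\<And>z. r \<le> cmod z \<Longrightarrow> 1 \<le> cmod (poly (pCons a p) z)"
      using poly_infinity[of p 1 a] by blast
    with pCons show ?thesis by (intro exI[of _ r] exI[of _ 1]) auto
  qed
qed

lemma entire_finite_zeros_factor:
  assumes "finite S" "f holomorphic_on UNIV" "{z. f z = 0} = S"
  shows "\<exists>P g. P \<noteq> 0 \<and> g holomorphic_on UNIV \<and> (\<forall>z. g z \<noteq> 0) \<and> (\<forall>z. f z = poly P z * g z)"
  using assms
proof (induction S arbitrary: f rule: finite_induct)
  case empty
  then show ?case by (intro exI[of _ 1] exI[of _ f]) auto
next
  case (insert \<xi> S)
  have fz: "f \<xi> = 0" using insert.prems by auto
  have "finite {z. f z = 0}" using insert by simp
  then have "{z. f z = 0} \<noteq> UNIV" using infinite_UNIV_char_0[where 'a=complex] by force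
  then have nc: "\<not> f constant_on UNIV" using fz by (auto simp: constant_on_def)
  obtain g r n where n: "0 < n" and r: "0 < r" and g: "g holomorphic_on ball \<xi> r"
    and fg: "\<And>w. w \<in> ball \<xi> r \<Longrightarrow> f w = (w - \<xi>) ^ n * g w" and gn: "\<And>w. w \<in> ball \<xi> r \<Longrightarrow> g w \<noteq> 0"
    using holomorphic_factor_zero_nonconstant[OF insert.prems(1) open_UNIV connected_UNIV UNIV_I fz nc] by metis
  define h where "h = (\<lambda>z. if z = \<xi> then g \<xi> else f z / (z - \<xi>) ^ n)"
  have fh: "f z = (z - \<xi>) ^ n * h z" for z
    using fz n by (auto simp: h_def)
  have h1: "h holomorphic_on ball \<xi> r"
    by (rule holomorphic_transform[OF g]) (auto simp: h_def fg)
  have h2: "h holomorphic_on UNIV - {\<xi>}"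
  proof (rule holomorphic_transform)
    show "(\<lambda>z. f z / (z - \<xi>) ^ n) holomorphic_on UNIV - {\<xi>}"
      by (intro holomorphic_intros holomorphic_on_subset[OF insert.prems(1)]) auto
  qed (auto simp: h_def)
  have "h holomorphic_on ball \<xi> r \<union> (UNIV - {\<xi>})"
    by (rule holomorphic_on_Un[OF h1 h2]) auto
  moreover have "ball \<xi> r \<union> (UNIV - {\<xi>}) = UNIV" using r by auto
  ultimately have h: "h holomorphic_on UNIV" by simp
  have hx: "h \<xi> \<noteq> 0" using gn[of \<xi>] r by (simp add: h_def)
  have "{z. h z = 0} = S"
  proof -
    have "h z = 0 \<longleftrightarrow> z \<in> S" for z
    proof (cases "z = \<xi>")
      case True then show ?thesis using hx insert.hyps by auto
    next
      case False
      then have "h z = 0 \<longleftrightarrow> f z = 0" by (simp add: h_def)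
      also have "\<dots> \<longleftrightarrow> z \<in> S" using insert.prems(2) False by auto
      finally show ?thesis .
    qed
    then show ?thesis by auto
  qed
  from insert.IH[OF h this] obtain P k where "P \<noteq> 0" "k holomorphic_on UNIV" "\<forall>z. k z \<noteq> 0" "\<forall>z. h z = poly P z * k z" by blast
  then show ?case
    by (intro exI[of _ "[:-\<xi>, 1:] ^ n * P"] exI[of _ k]) (auto simp: fh poly_power)
qed

text \<open>
  With \<open>q = Q - Q 0\<close> and \<open>M\<close> a bound of \<open>Re q\<close> on the disc of radius \<open>R\<close>, the function \<open>q / (2 * M - q)\<close>
  maps that disc into the unit disc and vanishes at the origin.  The Schwarz lemma at radius \<open>R / 2\<close> bounds
  \<open>|q|\<close> by \<open>2 * M\<close> there (the Borel--Caratheodory argument), hence quadratically, and Liouville's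
  theorem finishes.
\<close>

lemma entire_Re_le_quadratic:
  assumes Q: "Q holomorphic_on UNIV" and le: "\<And>z. Re (Q z) \<le> K + (cmod z)\<^sup>2"
  shows "\<exists>a b c. \<forall>z. Q z = a * z\<^sup>2 + b * z + c"
proof -
  define q where "q = (\<lambda>z. Q z - Q 0)"
  have q: "q holomorphic_on UNIV" unfolding q_def by (intro holomorphic_intros Q)
  define L where "L = \<bar>K\<bar> + cmod (Q 0) + 1"
  have L: "L > 0" unfolding L_def by (simp add: add_nonneg_pos)
  have qle: "Re (q z) < L + (cmod z)\<^sup>2" for z
    using le[of z] complex_Re_le_cmod[of "- Q 0"] by (simp add: q_def L_def)
  have bd: "cmod (q z) \<le> (2 * L + 8) * cmod z ^ 2" if z1: "1 \<le> cmod z" for z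
  proof -
    define R where "R = 2 * cmod z"
    define M where "M = L + R\<^sup>2"
    have M: "M > 0" using L by (simp add: M_def add_pos_nonneg)
    define h where "h = (\<lambda>x. q (of_real R * x) / (2 * of_real M - q (of_real R * x)))"
    have less: "Re (q (of_real R * x)) < M" if "cmod x < 1" for x
    proof -
      have "cmod x ^ 2 \<le> 1" using that by (simp add: power_le_one)
      then have "(cmod (of_real R * x))\<^sup>2 \<le> R\<^sup>2"
        by (simp add: norm_mult power_mult_distrib mult_left_le)
      with qle[of "of_real R * x"] show ?thesis by (simp add: M_def)
    qed
    have ne: "2 * of_real M - q (of_real R * x) \<noteq> 0" if "cmod x < 1" for x
      using less[OF that] M by (auto simp: complex_eq_iff)
    have "cmod (h (1/2 * sgn z)) \<le> cmod (1/2 * sgn z)"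
    proof (rule Schwarz_Lemma(1))
      show "h holomorphic_on ball 0 1" unfolding h_def
        by (intro holomorphic_intros holomorphic_on_compose_gen[of "\<lambda>x. of_real R * x" _ q UNIV, unfolded o_def, OF _ q])
           (use ne in auto)
      show "h 0 = 0" by (simp add: h_def q_def)
      show "cmod (1/2 * sgn z) < 1" by (simp add: norm_mult norm_sgn)
      fix x :: complex assume x: "cmod x < 1"
      define y where "y = q (of_real R * x)"
      have "(cmod (2 * of_real M - y))\<^sup>2 - (cmod y)\<^sup>2 = 4 * M * (M - Re y)"
        unfolding cmod_power2 by (simp add: power2_eq_square algebra_simps)
      moreover have "4 * M * (M - Re y) > 0" using M less[OF x] by (simp add: y_def)
      ultimately have "(cmod y)\<^sup>2 < (cmod (2 * of_real M - y))\<^sup>2" by linarith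
      then have "cmod y < cmod (2 * of_real M - y)" using power2_less_imp_less norm_ge_zero by blast
      moreover have "cmod (2 * of_real M - y) > 0" using ne[OF x] by (simp add: y_def)
      ultimately show "cmod (h x) < 1" unfolding h_def y_def[symmetric] by (simp add: norm_divide)
    qed
    moreover have "z \<noteq> 0" using z1 by auto
    then have Rz: "of_real R * (1/2 * sgn z) = z" by (simp add: R_def sgn_div_norm scaleR_conv_of_real)
    ultimately have "cmod (q z / (2 * of_real M - q z)) \<le> 1 / 2"
      using \<open>z \<noteq> 0\<close> unfolding h_def Rz by (simp add: norm_mult norm_sgn)
    moreover have "2 * of_real M - q z \<noteq> 0" using ne[of "1/2 * sgn z"] unfolding Rz by (simp add: norm_mult norm_sgn \<open>z \<noteq> 0\<close>)
    ultimately have "cmod (q z) \<le> cmod (2 * of_real M - q z) / 2" by (simp add: norm_divide divide_simps)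
    also have "\<dots> \<le> (cmod (2 * of_real M) + cmod (q z)) / 2" by (intro divide_right_mono norm_triangle_ineq4) simp
    also have "cmod (2 * of_real M) = 2 * M" using M by (simp add: norm_mult)
    finally have "cmod (q z) \<le> 2 * M" by simp
    also have "2 * M = 2 * L + 8 * cmod z ^ 2" by (simp add: M_def R_def power_mult_distrib)
    also have "\<dots> \<le> (2 * L + 8) * cmod z ^ 2"
    proof -
      have "1 \<le> cmod z ^ 2" using z1 by (simp add: one_le_power)
      then have "2 * L * 1 \<le> 2 * L * cmod z ^ 2" using L by (intro mult_left_mono) auto
      then show ?thesis by (simp add: algebra_simps)
    qed
    finally show ?thesis .
  qed
  have qs: "q z = (\<Sum>k\<le>2. (deriv ^^ k) q 0 / fact k * z ^ k)" for z
    by (rule Liouville_polynomial[OF q bd])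
  have "Q z = (deriv ^^ 2) q 0 / 2 * z\<^sup>2 + deriv q 0 * z + (q 0 + Q 0)" for z
    using qs[of z] by (simp add: q_def numeral_2_eq_2 algebra_simps)
  then show ?thesis by blast
qed

text \<open>
  Dividing out the zeros leaves an exponential \<open>exp Q\<close>, and boundedness of the Fock function bounds
  \<open>Re Q\<close> quadratically.  If \<open>|a| \<ge> 1/2\<close>, then along the ray on which \<open>a * z\<^sup>2\<close> is positive, oriented so
  that \<open>Re (b * z) \<ge> 0\<close>, the factor \<open>exp (a * z\<^sup>2 + b * z)\<close> compensates the Gaussian and the Fock
  function does not decay.
\<close>

lemma fock_finite_zeros:
  assumes f: "f holomorphic_on UNIV" and int: "integrable lborel (\<lambda>z. (cmod (exp (- of_real ((cmod z)\<^sup>2 / 2)) * f z))\<^sup>2)"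
    and fin: "finite {z. f z = 0}"
  shows "\<exists>P a b. P \<noteq> 0 \<and> cmod a < 1 / 2 \<and> (\<forall>z. f z = poly P z * exp (a * z\<^sup>2 + b * z))"
proof -
  obtain P0 g where P0: "P0 \<noteq> 0" and g: "g holomorphic_on UNIV" "\<And>z. g z \<noteq> 0" and fg: "\<And>z. f z = poly P0 z * g z"
    using entire_finite_zeros_factor[OF fin f refl] by blast
  obtain Q where Q: "Q holomorphic_on UNIV" "\<And>z. exp (Q z) = g z"
    using holomorphic_logarithm_exists[OF convex_UNIV open_UNIV g(1) _ UNIV_I[of 0]] g(2) by (metis UNIV_I)
  obtain M where M: "\<And>z. cmod (f z) \<le> M * exp ((cmod z)\<^sup>2 / 2)" using fock_bounded[OF f int] by blast
  obtain r c where c: "c > 0" and r: "\<And>z. r \<le> cmod z \<Longrightarrow> c \<le> cmod (poly P0 z)" using poly_lower_bound[OF P0] by blast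
  have "\<exists>K. \<forall>z. Re (Q z) \<le> K + (cmod z)\<^sup>2"
  proof -
    have "compact ((\<lambda>z. Re (Q z)) ` cball 0 r)"
      by (intro compact_continuous_image continuous_intros holomorphic_on_imp_continuous_on holomorphic_on_subset[OF Q(1)]) auto
    then have "bdd_above ((\<lambda>z. Re (Q z)) ` cball 0 r)" by (intro bounded_imp_bdd_above compact_imp_bounded)
    then obtain K1 where "\<forall>y\<in>(\<lambda>z. Re (Q z)) ` cball 0 r. y \<le> K1" unfolding bdd_above_def by blast
    then have K1: "Re (Q z) \<le> K1" if "cmod z \<le> r" for z using that by simp
    have "Re (Q z) \<le> max K1 (ln ((\<bar>M\<bar> + 1) / c)) + (cmod z)\<^sup>2" for z
    proof (cases "cmod z \<le> r")
      case True
      then show ?thesis using K1[of z] by (smt (verit) zero_le_power2)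
    next
      case False
      then have "c * exp (Re (Q z)) \<le> cmod (poly P0 z) * exp (Re (Q z))" using r[of z] by (intro mult_right_mono) auto
      also have "\<dots> = cmod (f z)" by (simp add: fg Q(2)[symmetric] norm_mult)
      also have "\<dots> \<le> M * exp ((cmod z)\<^sup>2 / 2)" by (rule M)
      also have "\<dots> \<le> (\<bar>M\<bar> + 1) * exp ((cmod z)\<^sup>2 / 2)" by (intro mult_right_mono) auto
      finally have "exp (Re (Q z)) \<le> (\<bar>M\<bar> + 1) / c * exp ((cmod z)\<^sup>2 / 2)" using c by (simp add: field_simps)
      also have "\<dots> = exp (ln ((\<bar>M\<bar> + 1) / c) + (cmod z)\<^sup>2 / 2)" using c by (simp add: exp_add add_nonneg_pos)
      finally have "Re (Q z) \<le> ln ((\<bar>M\<bar> + 1) / c) + (cmod z)\<^sup>2 / 2" by simp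
      then show ?thesis by (smt (verit) zero_le_power2 field_sum_of_halves)
    qed
    then show ?thesis by blast
  qed
  then obtain K where "\<And>z. Re (Q z) \<le> K + (cmod z)\<^sup>2" by blast
  from entire_Re_le_quadratic[OF Q(1) this] obtain a b d where Qe: "\<And>z. Q z = a * z\<^sup>2 + b * z + d" by blast
  define P where "P = smult (exp d) P0"
  have P: "P \<noteq> 0" using P0 by (simp add: P_def)
  have fP: "f z = poly P z * exp (a * z\<^sup>2 + b * z)" for z
    by (simp add: fg Q(2)[symmetric] Qe P_def exp_add)
  have "cmod a < 1 / 2"
  proof (rule ccontr)
    assume na: "\<not> cmod a < 1 / 2"
    (* the direction in which a * z^2 is positive *)
    obtain u where u: "cmod u = 1" "a * u\<^sup>2 = of_real (cmod a)"
    proof -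
      define v where "v = csqrt (cnj (sgn a))"
      have "a \<noteq> 0" using na by auto
      then have "v\<^sup>2 = cnj (sgn a)" "cmod (cnj (sgn a)) = 1" by (simp_all add: v_def norm_sgn)
      moreover from this have "(cmod v)\<^sup>2 = 1" by (metis norm_power)
      then have "cmod v = 1" by (simp add: power2_eq_1_iff) (smt (verit) norm_ge_zero)
      moreover have "a * cnj (sgn a) = of_real (cmod a)"
      proof -
        have "a * cnj (sgn a) = a * cnj a / of_real (cmod a)" by (simp add: sgn_eq)
        also have "a * cnj a = of_real (cmod a) * of_real (cmod a)"
          by (simp add: complex_norm_square[symmetric] power2_eq_square)
        finally show ?thesis using \<open>a \<noteq> 0\<close> by simp
      qed
      ultimately show ?thesis using that[of v] by simp
    qed
    define s where "s = (if Re (b * u) \<ge> 0 then u else - u)"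
    have s: "cmod s = 1" "a * s\<^sup>2 = of_real (cmod a)" "Re (b * s) \<ge> 0" using u by (auto simp: s_def)
    define z where "z = (\<lambda>n::nat. of_nat n * s)"
    have nz: "cmod (z n) = real n" for n by (simp add: z_def norm_mult s)
    have lim: "(\<lambda>n. exp (- of_real ((cmod (z n))\<^sup>2 / 2)) * f (z n)) \<longlonglongrightarrow> 0"
      by (rule fock_decay[OF f int]) (simp add: nz filterlim_real_sequentially)
    have ge: "cmod (poly P (z n)) \<le> cmod (exp (- of_real ((cmod (z n))\<^sup>2 / 2)) * f (z n))" for n
    proof -
      have "a * (z n)\<^sup>2 = of_real (cmod a * (real n)\<^sup>2)"
        using s(2) by (simp add: z_def power_mult_distrib mult.left_commute)
      moreover have "b * z n = of_real (real n) * (b * s)" by (simp add: z_def)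
      ultimately have "Re (a * (z n)\<^sup>2 + b * z n) = cmod a * (real n)\<^sup>2 + real n * Re (b * s)"
        by (simp only: plus_complex.sel times_complex.sel(1)[of "of_real _"] Re_complex_of_real Im_complex_of_real mult_zero_left diff_0_right)
      moreover have "real n * Re (b * s) \<ge> 0" using s by simp
      moreover have "cmod a * (real n)\<^sup>2 \<ge> 1 / 2 * (real n)\<^sup>2" using na by (intro mult_right_mono) auto
      ultimately have "0 \<le> - (real n)\<^sup>2 / 2 + Re (a * (z n)\<^sup>2 + b * z n)" by simp
      then have "1 \<le> exp (- (real n)\<^sup>2 / 2 + Re (a * (z n)\<^sup>2 + b * z n))" by simp
      then have "cmod (poly P (z n)) * 1 \<le> cmod (poly P (z n)) * exp (- (real n)\<^sup>2 / 2 + Re (a * (z n)\<^sup>2 + b * z n))"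
        by (intro mult_left_mono) auto
      also have "\<dots> = cmod (exp (- of_real ((cmod (z n))\<^sup>2 / 2)) * f (z n))"
        unfolding fP norm_mult norm_exp_eq_Re nz by (simp only: exp_add mult_ac uminus_complex.sel Re_complex_of_real minus_divide_left)
      finally show ?thesis by simp
    qed
    have lim0: "(\<lambda>n. poly P (z n)) \<longlonglongrightarrow> 0"
      by (rule Lim_null_comparison[OF _ tendsto_norm_zero[OF lim]]) (intro always_eventually allI ge)
    obtain r c where c: "c > 0" and r: "\<And>z. r \<le> cmod z \<Longrightarrow> c \<le> cmod (poly P z)" using poly_lower_bound[OF P] by blast
    have "\<forall>\<^sub>F n in sequentially. cmod (poly P (z n)) < c"
      using tendstoD[OF lim0 c] by simp
    moreover have "\<forall>\<^sub>F n in sequentially. r \<le> real n"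
      using filterlim_real_sequentially by (simp add: filterlim_at_top)
    ultimately have "\<forall>\<^sub>F n in sequentially. False"
      by eventually_elim (metis r nz not_less)
    then show False by simp
  qed
  with P fP show ?thesis by blast
qed

section \<open>Matching the exponents\<close>

lemma (in gaussian_weight) cubic_integrand:
  assumes "\<And>w. f w = poly P w * exp (a * w\<^sup>2 + b * w)" "\<And>w. g w = poly R w * exp (c * w\<^sup>2 + d * w)"
    and A: "A = a + c" and C: "C = cnj c"
  shows "exp (cnj w * z - 2 * of_real ((cmod w)\<^sup>2)) * of_real ((cmod (g w))\<^sup>2) * f w
    = poly (P * R) w * cnj (poly R w) * (exp ((b + d) * w + (z + cnj d) * cnj w) * wt w)"
proof -
  have e: "exp (cnj w * z - 2 * of_real ((cmod w)\<^sup>2)) * exp (c * w\<^sup>2 + d * w) * exp (cnj (c * w\<^sup>2 + d * w)) * exp (a * w\<^sup>2 + b * w)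
    = exp ((b + d) * w + (z + cnj d) * cnj w) * wt w"
    unfolding wt_def exp_add[symmetric] unfolding A C by (rule arg_cong[where f = exp]) (simp add: algebra_simps)
  show ?thesis unfolding assms(1,2) complex_norm_square[of "poly R w * _"] e[symmetric] complex_cnj_mult exp_cnj
    by (simp only: poly_mult mult_ac)
qed

text \<open>
  The integrand is a polynomial times a Gaussian weight with \<open>A = a + c\<close>, \<open>C = cnj c\<close>, and \<open>z\<close> enters only
  through the coefficient of \<open>cnj w\<close>.
\<close>

lemma cubic_form:
  fixes a b c d :: complex
  assumes f: "\<And>w. f w = poly P w * exp (a * w\<^sup>2 + b * w)" and g: "\<And>w. g w = poly R w * exp (c * w\<^sup>2 + d * w)"
    and a: "cmod a < 1 / 2" and c: "cmod c < 1 / 2"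
  shows "1 - (a + c) * cnj c \<noteq> 0"
    and "\<exists>S. \<forall>z. cubic g f z = poly S z * exp ((a + c) / (4 * (1 - (a + c) * cnj c)) * z\<^sup>2
       + ((b + d) + (a + c) * cnj d) / (2 * (1 - (a + c) * cnj c)) * z)"
proof -
  have "cmod (a + c) + cmod (cnj c) < 2"
    using norm_triangle_ineq[of a c] a c by simp
  then interpret gaussian_weight "a + c" "cnj c" by unfold_locales
  show ne: "1 - (a + c) * cnj c \<noteq> 0" by (rule AC_ne)
  define k where "k = 1 - (a + c) * cnj c"
  define s where "s = b + d"
  obtain S where S: "\<And>t. (LINT w|lborel. poly (P * R) w * cnj (poly R w) * (exp (s * w + t * cnj w) * wt w)) = poly S t * E s t"
    using poly_integral_form[of "P * R" R s] by blast
  define q where "q = (\<lambda>z. (a + c) / (4 * k) * z\<^sup>2 + (s + (a + c) * cnj d) / (2 * k) * z)"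
  define q0 where "q0 = (2 * s * cnj d + (a + c) * (cnj d)\<^sup>2) / (4 * k)"
  have Eq: "E s (z + cnj d) = exp q0 * exp (q z)" for z
  proof -
    have "k \<noteq> 0" using ne by (simp add: k_def)
    then have "(2 * s * (z + cnj d) + (a + c) * (z + cnj d)\<^sup>2) / (4 * k) = q0 + q z"
      unfolding q_def q0_def by (simp add: field_simps power2_eq_square)
    then show ?thesis unfolding E_def k_def[symmetric] exp_add[symmetric] by simp
  qed
  define S' where "S' = smult (of_real (1 / pi) * exp q0) (pcompose S [:cnj d, 1:])"
  have "cubic g f z = poly S' z * exp (q z)" for z
  proof -
    have "cubic g f z = of_real (1 / pi) * (poly S (z + cnj d) * E s (z + cnj d))"
      unfolding cubic_def cubic_integrand[of f P a b g R c d, OF f g refl refl] S[unfolded s_def] s_def ..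
    also have "\<dots> = poly S' z * exp (q z)"
      unfolding Eq by (simp add: S'_def poly_pcompose add.commute)
    finally show ?thesis .
  qed
  then show "\<exists>S. \<forall>z. cubic g f z = poly S z * exp ((a + c) / (4 * (1 - (a + c) * cnj c)) * z\<^sup>2
       + ((b + d) + (a + c) * cnj d) / (2 * (1 - (a + c) * cnj c)) * z)"
    unfolding q_def k_def s_def by blast
qed

text \<open>
  The quotient of the two exponentials is \<open>exp (u * z\<^sup>2 + v * z)\<close>.  Differentiating \<open>p = q * exp (\<dots>)\<close>
  gives \<open>p' * q - q' * p = (2 * u * z + v) * p * q\<close>, where the left side has smaller degree than
  \<open>p * q\<close>.
\<close>

lemma poly_exp_unique:
  fixes p q :: "complex poly"
  assumes eq: "\<And>z. poly p z * exp (a * z\<^sup>2 + b * z) = poly q z * exp (a' * z\<^sup>2 + b' * z)" and p: "p \<noteq> 0"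
  shows "a = a' \<and> b = b'"
proof -
  define u where "u = a' - a"
  define v where "v = b' - b"
  have pq: "poly p z = poly q z * exp (u * z\<^sup>2 + v * z)" for z
  proof -
    have "poly p z = poly p z * exp (a * z\<^sup>2 + b * z) * exp (- (a * z\<^sup>2 + b * z))" by (simp add: mult.assoc exp_add[symmetric])
    also have "\<dots> = poly q z * (exp (a' * z\<^sup>2 + b' * z) * exp (- (a * z\<^sup>2 + b * z)))" unfolding eq by simp
    also have "exp (a' * z\<^sup>2 + b' * z) * exp (- (a * z\<^sup>2 + b * z)) = exp (u * z\<^sup>2 + v * z)"
      unfolding exp_add[symmetric] by (rule arg_cong[where f = exp]) (simp add: u_def v_def algebra_simps)
    finally show ?thesis .
  qed
  have q: "q \<noteq> 0"
  proof
    assume "q = 0" then have "\<And>z. poly p z = 0" by (simp add: pq)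
    then show False using p poly_all_0_iff_0 by blast
  qed
  have "poly (pderiv p * q) z = poly (pderiv q * p + [:v, 2 * u:] * p * q) z" for z
  proof -
    define e where "e = (\<lambda>z. exp (u * z\<^sup>2 + v * z))"
    have de: "(e has_field_derivative e z * (2 * u * z + v)) (at z)"
      unfolding e_def by (rule DERIV_fun_exp) (auto intro!: derivative_eq_intros)
    have "((\<lambda>z. poly q z * e z) has_field_derivative poly (pderiv q) z * e z + e z * (2 * u * z + v) * poly q z) (at z)"
      by (rule DERIV_mult[OF poly_DERIV de])
    then have "(poly p has_field_derivative poly (pderiv q) z * e z + e z * (2 * u * z + v) * poly q z) (at z)"
      unfolding e_def pq[abs_def, symmetric] .
    from DERIV_unique[OF poly_DERIV this]
    have "poly (pderiv p) z = poly (pderiv q) z * e z + e z * (2 * u * z + v) * poly q z" .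
    then have "poly (pderiv p) z * poly q z = poly (pderiv q) z * (poly q z * e z) + (2 * u * z + v) * (poly q z * e z) * poly q z"
      by (simp add: algebra_simps)
    also have "poly q z * e z = poly p z" by (simp add: pq e_def)
    finally show ?thesis by (simp add: algebra_simps)
  qed
  then have id: "pderiv p * q - pderiv q * p = [:v, 2 * u:] * (p * q)"
    by (simp add: poly_eq_poly_eq_iff[symmetric] fun_eq_iff algebra_simps)
  have "[:v, 2 * u:] = 0"
  proof (rule ccontr)
    assume nz: "[:v, 2 * u:] \<noteq> 0"
    have pq0: "p * q \<noteq> 0" using p q by simp
    have "degree ([:v, 2 * u:] * (p * q)) \<ge> degree p + degree q"
      using nz pq0 p q by (simp add: degree_mult_eq del: mult_pCons_left)
    moreover have "[:v, 2 * u:] * (p * q) \<noteq> 0" using nz pq0 by (simp del: mult_pCons_left)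
    ultimately have ge: "degree (pderiv p * q - pderiv q * p) \<ge> degree p + degree q" and nz2: "pderiv p * q - pderiv q * p \<noteq> 0"
      unfolding id by auto
    show False
    proof (cases "degree p + degree q = 0")
      case True
      then have "pderiv p = 0" "pderiv q = 0" by (simp_all add: pderiv_eq_0_iff)
      with nz2 show False by simp
    next
      case False
      have "degree (pderiv p * q) < degree p + degree q \<and> degree (pderiv q * p) < degree p + degree q"
        using degree_mult_le[of "pderiv p" q] degree_mult_le[of "pderiv q" p] False
        by (cases "degree p = 0"; cases "degree q = 0") (auto simp: degree_pderiv pderiv_eq_0_iff[THEN iffD2])
      then have "degree (pderiv p * q - pderiv q * p) < degree p + degree q"
        using degree_diff_less by blast
      with ge show False by simp
    qed
  qed
  then show ?thesis by (simp add: u_def v_def)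
qed

text \<open>
  This excludes that the equation degenerates to \<open>0 = 0\<close>.  The \<open>z\<close>-derivatives of \<open>cubic g f\<close> are the
  moments of \<open>exp (- 2 * |w|\<^sup>2) * |g|\<^sup>2 * f\<close> against \<open>cnj w ^ j * exp (cnj w * z)\<close>.  Were they all zero,
  then so would be the pairing with \<open>cnj f\<close>, by expanding \<open>exp (cnj a * (cnj w)\<^sup>2)\<close> into its power
  series; but that pairing is the integral of \<open>exp (- 2 * |w|\<^sup>2) * |g|\<^sup>2 * |f|\<^sup>2\<close>.  The series may be
  integrated termwise because \<open>|a|\<close> and \<open>|c|\<close> are below \<open>1/2\<close>.
\<close>

lemma cubic_nonzero:
  assumes f: "\<And>w. f w = poly P w * exp (a * w\<^sup>2 + b * w)" and g: "\<And>w. g w = poly R w * exp (c * w\<^sup>2 + d * w)"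
    and a: "cmod a < 1 / 2" and c: "cmod c < 1 / 2" and nz: "P \<noteq> 0" "R \<noteq> 0"
  shows "\<exists>z. cubic g f z \<noteq> 0"
proof (rule ccontr)
  assume "\<not> (\<exists>z. cubic g f z \<noteq> 0)"
  then have z0: "cubic g f z = 0" for z by blast
  have "cmod (a + c) + cmod (cnj c) < 2"
    using norm_triangle_ineq[of a c] a c by simp
  then interpret gaussian_weight "a + c" "cnj c" by unfold_locales
  define k where "k = (\<lambda>z w. exp (cnj w * z - 2 * of_real ((cmod w)\<^sup>2)) * of_real ((cmod (g w))\<^sup>2) * f w)"
  have k_eq: "k z w = poly (P * R) w * cnj (poly R w) * (exp ((b + d) * w + (z + cnj d) * cnj w) * wt w)" for z w
    unfolding k_def by (rule cubic_integrand[OF f g refl refl])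
  have kr: "rapid (k z)" for z unfolding k_eq[abs_def] by (rule poly_integral(2))
  have kexp: "k z w = exp (z * cnj w) * k 0 w" for z w
  proof -
    have "exp (cnj w * z - 2 * of_real ((cmod w)\<^sup>2)) = exp (z * cnj w) * exp (cnj w * 0 - 2 * of_real ((cmod w)\<^sup>2))"
      unfolding exp_add[symmetric] by (simp add: mult.commute)
    then show ?thesis unfolding k_def by (simp only: mult.assoc)
  qed
  have mom: "(LINT w|lborel. cnj w ^ j * k z w) = 0" for j z
  proof (induction j arbitrary: z)
    case 0
    show ?case using z0[of z] by (simp add: cubic_def k_def)
  next
    case (Suc j)
    have e: "exp (z * cnj w) * (cnj w ^ j * k 0 w) = cnj w ^ j * k z w" for z w
      by (subst (2) kexp) simp
    have "((\<lambda>z. LINT w|lborel. exp (z * cnj w) * (cnj w ^ j * k 0 w)) has_field_derivative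
      (LINT w|lborel. cnj w * (exp (z * cnj w) * (cnj w ^ j * k 0 w)))) (at z)"
      by (rule moment_deriv[OF rapid_mult_power(2)[OF kr], of _ 1]) auto
    then have "((\<lambda>z. 0) has_field_derivative (LINT w|lborel. cnj w ^ Suc j * k z w)) (at z)"
      unfolding e Suc.IH by (simp add: mult.assoc)
    then show ?case using DERIV_unique DERIV_const by blast
  qed
  define h where "h = (\<lambda>n w. cnj (poly P w) * (\<Sum>i<n. (cnj a * (cnj w)\<^sup>2) ^ i /\<^sub>R fact i) * k (cnj b) w)"
  define h' where "h' = (\<lambda>w. cnj (poly P w) * exp (cnj a * (cnj w)\<^sup>2) * k (cnj b) w)"
  have pmom: "(LINT w|lborel. cnj w ^ i * (cnj (poly P w) * k z w)) = 0" for i z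
  proof -
    have "(LINT w|lborel. cnj w ^ i * (cnj (poly P w) * k z w)) = (LINT w|lborel. (\<Sum>j\<le>degree P. cnj (coeff P j) * (cnj w ^ (i + j) * k z w)))"
      by (intro Bochner_Integration.integral_cong refl)
         (simp add: poly_altdef sum_distrib_left sum_distrib_right power_add mult_ac)
    also have "\<dots> = (\<Sum>j\<le>degree P. cnj (coeff P j) * (LINT w|lborel. cnj w ^ (i + j) * k z w))"
      using rapid_integrable[OF rapid_mult_power(2)[OF kr]] by simp
    finally show ?thesis by (simp add: mom)
  qed
  have hint: "(LINT w|lborel. h n w) = 0" for n
  proof -
    have "h n w = (\<Sum>i<n. (cnj a ^ i /\<^sub>R fact i) * (cnj w ^ (2 * i) * (cnj (poly P w) * k (cnj b) w)))" for w
      unfolding h_def sum_distrib_left sum_distrib_right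
      by (intro sum.cong refl) (simp add: power_mult_distrib power_mult[symmetric] mult_ac)
    then have "(LINT w|lborel. h n w) = (\<Sum>i<n. (cnj a ^ i /\<^sub>R fact i) * (LINT w|lborel. cnj w ^ (2 * i) * (cnj (poly P w) * k (cnj b) w)))"
      using rapid_integrable[OF rapid_mult_power(2)[OF rapid_poly(2)[OF kr]]] by simp
    then show ?thesis by (simp add: pmom)
  qed
  define m where "m = (\<lambda>w. cmod (cnj (poly P w) * exp (of_real (cmod a * (cmod w)\<^sup>2)) * k (cnj b) w))"
  have mint: "integrable lborel m"
  proof -
    define \<kappa> where "\<kappa> = (\<lambda>w. exp (of_real (cmod a * (cmod w)\<^sup>2)) * wt w)"
    have [measurable]: "\<kappa> \<in> borel_measurable borel" unfolding \<kappa>_def by measurable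
    have "rapid \<kappa>"
    proof (rule rapidI)
      show "0 < 2 - 2 * cmod a - 2 * cmod c" using a c by simp
      fix w
      have "Re ((a + c) * w\<^sup>2 + cnj c * (cnj w)\<^sup>2) \<le> cmod (a + c) * (cmod w)\<^sup>2 + cmod c * (cmod w)\<^sup>2"
        by (rule order_trans[OF complex_Re_le_cmod]) (rule order_trans[OF norm_triangle_ineq], simp add: norm_mult norm_power)
      also have "\<dots> \<le> (cmod a + cmod c) * (cmod w)\<^sup>2 + cmod c * (cmod w)\<^sup>2"
        by (intro add_right_mono mult_right_mono norm_triangle_ineq) auto
      finally have "cmod a * (cmod w)\<^sup>2 + (Re ((a + c) * w\<^sup>2 + cnj c * (cnj w)\<^sup>2) - 2 * (cmod w)\<^sup>2) \<le> - (2 - 2 * cmod a - 2 * cmod c) * (cmod w)\<^sup>2"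
        by (simp add: algebra_simps)
      moreover have "cmod (\<kappa> w) = exp (cmod a * (cmod w)\<^sup>2 + (Re ((a + c) * w\<^sup>2 + cnj c * (cnj w)\<^sup>2) - 2 * (cmod w)\<^sup>2))"
        unfolding \<kappa>_def wt_def norm_mult norm_exp_eq_Re exp_add[symmetric] by simp
      ultimately show "cmod (\<kappa> w) \<le> exp (- (2 - 2 * cmod a - 2 * cmod c) * (cmod w)\<^sup>2)" by simp
    qed auto
    then have "rapid (\<lambda>w. exp ((b + d) * w + (cnj b + cnj d) * cnj w) * \<kappa> w)"
      by (rule rapid_mult_exp[OF _ _ lin_bound]) measurable
    then have "rapid (\<lambda>w. cnj (poly P w) * (poly (P * R) w * (cnj (poly R w) * (exp ((b + d) * w + (cnj b + cnj d) * cnj w) * \<kappa> w))))"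
      by (intro rapid_poly)
    then have "integrable lborel (\<lambda>w. cmod (cnj (poly P w) * (poly (P * R) w * (cnj (poly R w) * (exp ((b + d) * w + (cnj b + cnj d) * cnj w) * \<kappa> w)))))"
      by (intro integrable_norm rapid_integrable)
    then show ?thesis unfolding m_def k_eq \<kappa>_def by (simp only: norm_mult mult_ac)
  qed
  have [measurable]: "k z \<in> borel_measurable borel" for z using kr by (simp add: rapid_def)
  have [measurable]: "poly p \<in> borel_measurable borel" for p :: "complex poly"
    by (intro borel_measurable_continuous_onI continuous_intros)
  have "(\<lambda>n. LINT w|lborel. h n w) \<longlonglongrightarrow> (LINT w|lborel. h' w)"
  proof (rule integral_dominated_convergence[OF _ _ mint])
    show "h' \<in> borel_measurable lborel" "h n \<in> borel_measurable lborel" for n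
      unfolding h_def h'_def by measurable
    show "AE w in lborel. (\<lambda>n. h n w) \<longlonglongrightarrow> h' w"
    proof (intro AE_I2)
      fix w
      have "(\<lambda>i. (cnj a * (cnj w)\<^sup>2) ^ i /\<^sub>R fact i) sums exp (cnj a * (cnj w)\<^sup>2)" by (rule exp_converges)
      then show "(\<lambda>n. h n w) \<longlonglongrightarrow> h' w" unfolding h_def h'_def sums_def by (intro tendsto_intros)
    qed
    show "AE w in lborel. norm (h n w) \<le> m w" for n
    proof (intro AE_I2)
      fix w
      define x where "x = cnj a * (cnj w)\<^sup>2"
      have "cmod (\<Sum>i<n. x ^ i /\<^sub>R fact i) \<le> (\<Sum>i<n. cmod x ^ i /\<^sub>R fact i)"
        by (rule order_trans[OF norm_sum]) (simp add: norm_power)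
      also have "\<dots> \<le> exp (cmod x)"
        unfolding exp_def by (rule sum_le_suminf[OF summable_exp_generic]) auto
      also have "cmod x = cmod a * (cmod w)\<^sup>2" by (simp add: x_def norm_mult norm_power)
      finally have "cmod (\<Sum>i<n. x ^ i /\<^sub>R fact i) \<le> cmod (exp (of_real (cmod a * (cmod w)\<^sup>2) :: complex))" by simp
      then show "norm (h n w) \<le> m w"
        unfolding h_def m_def x_def[symmetric] norm_mult by (intro mult_left_mono mult_right_mono) auto
    qed
  qed
  then have "(LINT w|lborel. h' w) = 0" unfolding hint using LIMSEQ_unique tendsto_const by metis
  moreover have h'_eq: "h' w = of_real (exp (- 2 * (cmod w)\<^sup>2) * (cmod (g w) * cmod (f w))\<^sup>2)" for w
  proof -
    have 1: "cnj (poly P w) * exp (cnj a * (cnj w)\<^sup>2) * exp (cnj b * cnj w) = cnj (f w)"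
      by (simp add: f exp_cnj exp_add)
    have "h' w = (cnj (poly P w) * exp (cnj a * (cnj w)\<^sup>2) * exp (cnj b * cnj w)) * k 0 w"
      unfolding h'_def by (subst kexp) (simp add: mult_ac)
    also have "\<dots> = of_real (exp (- 2 * (cmod w)\<^sup>2)) * of_real ((cmod (g w))\<^sup>2) * (f w * cnj (f w))"
      unfolding 1 k_def by (simp add: exp_of_real[symmetric] mult_ac)
    also have "f w * cnj (f w) = of_real ((cmod (f w))\<^sup>2)" by (rule complex_norm_square[symmetric])
    finally show ?thesis by (simp add: power_mult_distrib)
  qed
  ultimately have I0: "(LINT w|lborel. exp (- 2 * (cmod w)\<^sup>2) * (cmod (g w) * cmod (f w))\<^sup>2) = 0"
    by (simp only: h'_eq integral_complex_of_real of_real_eq_0_iff)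
  have "integrable lborel h'"
  proof (rule Bochner_Integration.integrable_bound[OF mint])
    show "h' \<in> borel_measurable lborel" unfolding h'_def by measurable
    have "cmod (h' w) \<le> m w" for w
    proof -
      have "cmod (exp (cnj a * (cnj w)\<^sup>2)) \<le> cmod (exp (of_real (cmod a * (cmod w)\<^sup>2) :: complex))"
        using norm_exp[of "cnj a * (cnj w)\<^sup>2"] by (simp add: norm_mult norm_power)
      then show ?thesis unfolding h'_def m_def norm_mult by (intro mult_left_mono mult_right_mono) auto
    qed
    then show "AE w in lborel. norm (h' w) \<le> norm (m w)" by (simp add: m_def)
  qed
  then have "integrable lborel (\<lambda>w. exp (- 2 * (cmod w)\<^sup>2) * (cmod (g w) * cmod (f w))\<^sup>2)"
    using integrable_Re[of lborel h'] by (simp add: h'_eq)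
  from integral_nonneg_eq_0_iff_AE[OF this] I0
  have "AE w in lborel. exp (- 2 * (cmod w)\<^sup>2) * (cmod (g w) * cmod (f w))\<^sup>2 = 0" by simp
  then have ae: "AE w in lborel. poly (P * R) w = 0"
    by (rule AE_mp) (auto simp: f g)
  have "finite {w. poly (P * R) w = 0}" using nz by (intro poly_roots_finite) simp
  then have "{w. poly (P * R) w = 0} \<in> null_sets lborel" by (rule finite_imp_null_set_lborel)
  then have "AE w in lborel. poly (P * R) w \<noteq> 0" by (auto dest: AE_not_in)
  with ae have "AE w in (lborel :: complex measure). False" by eventually_elim simp
  then show False using AE_iff_measurable[of UNIV "lborel :: complex measure" "\<lambda>_. False"] by simp
qed

text \<open>
  The left side is a polynomial times \<open>exp (a * z\<^sup>2 + b * z)\<close>.  The polynomial is not zero: for \<open>\<alpha> \<noteq> 0\<close> its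
  top coefficient is a nonzero multiple of \<open>2 * \<alpha> * a - cnj \<alpha>\<close>, which cannot vanish as \<open>|a| < 1/2\<close>, and for
  \<open>\<alpha> = 0\<close> its vanishing would contradict the preceding lemma.  The factor \<open>\<epsilon>\<close> is the sign that
  distinguishes the two equations of the system.
\<close>

lemma exponents_agree:
  assumes f: "\<And>w. f w = poly P w * exp (a * w\<^sup>2 + b * w)" and g: "\<And>w. g w = poly R w * exp (c * w\<^sup>2 + d * w)"
    and a: "cmod a < 1 / 2" and c: "cmod c < 1 / 2" and nz: "P \<noteq> 0" "R \<noteq> 0"
    and st: "\<And>z. advect lam \<alpha> f z = \<epsilon> * cubic g f z" and eps: "\<epsilon> \<noteq> 0"
  shows "a = (a + c) / (4 * (1 - (a + c) * cnj c))"
    and "b = ((b + d) + (a + c) * cnj d) / (2 * (1 - (a + c) * cnj c))"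
proof -
  define L where "L = smult (of_real lam) P + smult (\<i> * \<alpha>) (pderiv P) + [:\<i> * \<alpha> * b, 2 * \<i> * \<alpha> * a - \<i> * cnj \<alpha>:] * P"
  have df: "deriv f z = (poly (pderiv P) z + (2 * a * z + b) * poly P z) * exp (a * z\<^sup>2 + b * z)" for z
  proof (rule DERIV_imp_deriv)
    have e: "((\<lambda>z. exp (a * z\<^sup>2 + b * z)) has_field_derivative exp (a * z\<^sup>2 + b * z) * (2 * a * z + b)) (at z)"
      by (rule DERIV_fun_exp) (auto intro!: derivative_eq_intros)
    show "(f has_field_derivative (poly (pderiv P) z + (2 * a * z + b) * poly P z) * exp (a * z\<^sup>2 + b * z)) (at z)"
      unfolding f[abs_def] by (rule DERIV_cong[OF DERIV_mult[OF poly_DERIV e]]) (simp add: algebra_simps)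
  qed
  have LHS: "advect lam \<alpha> f z = poly L z * exp (a * z\<^sup>2 + b * z)" for z
    unfolding advect_def df by (simp add: f L_def algebra_simps)
  obtain S where S: "\<And>z. cubic g f z = poly S z * exp ((a + c) / (4 * (1 - (a + c) * cnj c)) * z\<^sup>2
       + ((b + d) + (a + c) * cnj d) / (2 * (1 - (a + c) * cnj c)) * z)"
    using cubic_form(2)[OF f g a c] by blast
  have "L \<noteq> 0"
  proof
    assume L0: "L = 0"
    show False
    proof (cases "\<alpha> = 0")
      case True
      from cubic_nonzero[OF f g a c nz] obtain z where "cubic g f z \<noteq> 0" by blast
      with st[of z] LHS[of z] L0 eps show False by simp
    next
      case False
      have "cmod (2 * \<alpha> * a) < cmod (cnj \<alpha>)"
        using a False by (simp add: norm_mult)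
      then have "2 * \<alpha> * a - cnj \<alpha> \<noteq> 0" by (metis less_irrefl right_minus_eq)
      moreover have "2 * \<i> * \<alpha> * a - \<i> * cnj \<alpha> = \<i> * (2 * \<alpha> * a - cnj \<alpha>)" by (simp add: algebra_simps)
      ultimately have n: "2 * \<i> * \<alpha> * a - \<i> * cnj \<alpha> \<noteq> 0" by simp
      have "coeff L (Suc (degree P)) = (2 * \<i> * \<alpha> * a - \<i> * cnj \<alpha>) * lead_coeff P"
        by (simp add: L_def coeff_pderiv coeff_eq_0)
      with n nz(1) L0 show False by simp
    qed
  qed
  moreover have "poly L z * exp (a * z\<^sup>2 + b * z) = poly (smult \<epsilon> S) z * exp ((a + c) / (4 * (1 - (a + c) * cnj c)) * z\<^sup>2
       + ((b + d) + (a + c) * cnj d) / (2 * (1 - (a + c) * cnj c)) * z)" for z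
    using st[of z] unfolding LHS S by simp
  ultimately show "a = (a + c) / (4 * (1 - (a + c) * cnj c))"
    "b = ((b + d) + (a + c) * cnj d) / (2 * (1 - (a + c) * cnj c))"
    using poly_exp_unique by blast+
qed

text \<open>
  Adding the two relations for the quadratic coefficients gives
  \<open>2 * (a + c) = 8 * (a + c) * Re (a * cnj c)\<close>.  If \<open>a + c \<noteq> 0\<close>, then \<open>Re (a * cnj c) = 1/4\<close>, which is
  impossible for \<open>|a|, |c| < 1/2\<close>; if \<open>a + c = 0\<close>, the relations give \<open>a = c = 0\<close>.
\<close>

lemma exponents_trivial:
  assumes f: "\<And>w. f w = poly P w * exp (a * w\<^sup>2 + b * w)" and g: "\<And>w. g w = poly R w * exp (c * w\<^sup>2 + d * w)"
    and a: "cmod a < 1 / 2" and c: "cmod c < 1 / 2" and nz: "P \<noteq> 0" "R \<noteq> 0"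
    and st1: "\<And>z. advect lam \<alpha> f z = cubic g f z" and st2: "\<And>z. advect mu \<alpha> g z = - cubic f g z"
  shows "a = 0" "c = 0" "b = d"
proof -
  have 1: "a = (a + c) / (4 * (1 - (a + c) * cnj c))" "b = ((b + d) + (a + c) * cnj d) / (2 * (1 - (a + c) * cnj c))"
    by (rule exponents_agree[OF f g a c nz, of lam \<alpha> 1]; simp add: st1)+
  have 2: "c = (c + a) / (4 * (1 - (c + a) * cnj a))"
    by (rule exponents_agree(1)[OF g f c a nz(2) nz(1), of mu \<alpha> "-1"]; simp add: st2)
  have n1: "1 - (a + c) * cnj c \<noteq> 0" by (rule cubic_form(1)[OF f g a c])
  have n2: "1 - (c + a) * cnj a \<noteq> 0" by (rule cubic_form(1)[OF g f c a])
  have dv: "4 * x * k = y" if "x = y / (4 * k)" "k \<noteq> 0" for x y k :: complex using that by simp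
  have e1: "4 * a * (1 - (a + c) * cnj c) = a + c" by (rule dv[OF 1(1) n1])
  have e2: "4 * c * (1 - (c + a) * cnj a) = c + a" by (rule dv[OF 2 n2])
  have sum0: "a + c = 0"
  proof (rule ccontr)
    assume s: "a + c \<noteq> 0"
    have "(a + c) * (2 * (a * cnj c + c * cnj a) - 1) = 0" using e1 e2 by algebra
    then have "2 * (a * cnj c + c * cnj a) = 1" using s by (metis mult_eq_0_iff right_minus_eq)
    moreover have "a * cnj c + c * cnj a = of_real (2 * Re (a * cnj c))" by (simp add: complex_eq_iff)
    ultimately have "2 * (2 * Re (a * cnj c)) = 1" by (metis of_real_eq_1_iff of_real_mult of_real_numeral)
    moreover have "Re (a * cnj c) \<le> cmod a * cmod c" using complex_Re_le_cmod[of "a * cnj c"] by (simp add: norm_mult)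
    moreover have "cmod a * cmod c < 1/2 * (1/2)" by (rule mult_strict_mono) (use a c in auto)
    ultimately show False by simp
  qed
  then show a0: "a = 0" using 1(1) by simp
  show c0: "c = 0" using sum0 a0 by simp
  show "b = d" using 1(2) a0 c0 by (simp add: field_simps)
qed

section \<open>Reduction to polynomials\<close>

text \<open>
  The cubic term seen on the polynomial factors: it is \<open>r\<close> with conjugated coefficients, applied as a
  differential operator to \<open>H (x / 2)\<close>, because \<open>cnj w\<close> in the integral acts as the derivative in \<open>z\<close>.
\<close>

definition cubic_poly :: "complex poly \<Rightarrow> complex poly \<Rightarrow> complex poly" where
  "cubic_poly H r = (\<Sum>j\<le>degree H. \<Sum>k\<le>degree r. smult (coeff H j * cnj (coeff r k)) ((pderiv ^^ k) (monom (1 / 2 ^ j) j)))"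

lemma coeff_pderiv_iter: "coeff ((pderiv ^^ k) p) i = fact (i + k) / fact i * coeff p (i + k)" for p :: "complex poly"
proof (induction k arbitrary: i)
  case (Suc k)
  have "coeff ((pderiv ^^ Suc k) p) i = of_nat (Suc i) * coeff ((pderiv ^^ k) p) (Suc i)"
    by (simp add: coeff_pderiv)
  also have "\<dots> = of_nat (Suc i) * (fact (Suc (i + k)) / fact (Suc i)) * coeff p (Suc (i + k))" unfolding Suc by simp
  also have "of_nat (Suc i) * (fact (Suc (i + k)) / fact (Suc i)) = (fact (i + Suc k) / fact i :: complex)"
    by (simp del: of_nat_Suc add: fact_Suc[of i] divide_simps)
  finally show ?case by simp
qed simp

lemma coeff_cubic_poly:
  "coeff (cubic_poly H r) i = (\<Sum>k\<le>degree r. cnj (coeff r k) * coeff H (i + k) * (fact (i + k) / (fact i * 2 ^ (i + k))))"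
proof -
  have "coeff (cubic_poly H r) i = (\<Sum>j\<le>degree H. \<Sum>k\<le>degree r. coeff H j * cnj (coeff r k) * (fact (i + k) / fact i * (if j = i + k then 1 / 2 ^ j else 0)))"
    by (simp add: cubic_poly_def coeff_sum coeff_pderiv_iter)
  also have "\<dots> = (\<Sum>k\<le>degree r. \<Sum>j\<le>degree H. coeff H j * cnj (coeff r k) * (fact (i + k) / fact i * (if j = i + k then 1 / 2 ^ j else 0)))"
    by (rule sum.swap)
  also have "\<dots> = (\<Sum>k\<le>degree r. cnj (coeff r k) * coeff H (i + k) * (fact (i + k) / (fact i * 2 ^ (i + k))))"
  proof (rule sum.cong[OF refl])
    fix k
    have "(\<Sum>j\<le>degree H. coeff H j * cnj (coeff r k) * (fact (i + k) / fact i * (if j = i + k then 1 / 2 ^ j else 0)))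
      = (\<Sum>j\<le>degree H. if j = i + k then coeff H j * cnj (coeff r k) * (fact (i + k) / fact i * (1 / 2 ^ j)) else 0)"
      by (intro sum.cong refl) simp
    also have "\<dots> = (if i + k \<le> degree H then coeff H (i + k) * cnj (coeff r k) * (fact (i + k) / fact i * (1 / 2 ^ (i + k))) else 0)"
      by (subst sum.delta) auto
    also have "\<dots> = cnj (coeff r k) * coeff H (i + k) * (fact (i + k) / (fact i * 2 ^ (i + k)))"
      by (auto simp: coeff_eq_0)
    finally show "(\<Sum>j\<le>degree H. coeff H j * cnj (coeff r k) * (fact (i + k) / fact i * (if j = i + k then 1 / 2 ^ j else 0)))
      = cnj (coeff r k) * coeff H (i + k) * (fact (i + k) / (fact i * 2 ^ (i + k)))" .
  qed
  finally show ?thesis .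
qed

text \<open>
  Profiles centred at \<open>cnj \<gamma>\<close>.  The scalar \<open>\<kappa>\<close> is kept apart from \<open>p\<close> because time evolution changes only
  \<open>\<kappa>\<close> and \<open>\<gamma>\<close>.
\<close>

definition wave :: "complex \<Rightarrow> complex poly \<Rightarrow> complex \<Rightarrow> complex \<Rightarrow> complex" where
  "wave \<kappa> p \<gamma> z = \<kappa> * poly p (z - cnj \<gamma>) * exp (\<gamma> * z)"

text \<open>
  Moving the origin to \<open>cnj \<gamma>\<close> absorbs all the linear exponentials and leaves isotropic moments.
\<close>

lemma cubic_wave:
  "cubic (wave \<kappa>' r \<gamma>) (wave \<kappa> p \<gamma>) z
     = \<kappa> * of_real ((cmod \<kappa>')\<^sup>2 * exp ((cmod \<gamma>)\<^sup>2) / 2) * exp (\<gamma> * z) * poly (cubic_poly (p * r) r) (z - cnj \<gamma>)"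
proof -
  define C where "C = \<kappa> * of_real ((cmod \<kappa>')\<^sup>2 * exp ((cmod \<gamma>)\<^sup>2)) * exp (\<gamma> * z)"
  define I where "I = (\<lambda>w. exp (cnj w * z - 2 * of_real ((cmod w)\<^sup>2)) * of_real ((cmod (wave \<kappa>' r \<gamma> w))\<^sup>2) * wave \<kappa> p \<gamma> w)"
  have contI: "continuous_on UNIV I"
    unfolding I_def wave_def by (intro continuous_intros)
  have I_shift: "I (cnj \<gamma> + x) = C * (poly (p * r) x * cnj (poly r x) * (exp (0 * x + (z - cnj \<gamma>) * cnj x) * iso.wt x))" for x
  proof -
    define w where "w = cnj \<gamma> + x"
    have xw: "w - cnj \<gamma> = x" by (simp add: w_def)
    have e: "exp (cnj w * z - 2 * (w * cnj w)) * exp (\<gamma> * w) * exp (cnj (\<gamma> * w)) * exp (\<gamma> * w)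
      = exp (\<gamma> * cnj \<gamma>) * exp (\<gamma> * z) * (exp (0 * x + (z - cnj \<gamma>) * cnj x) * iso.wt x)"
      unfolding iso.wt_def exp_add[symmetric] complex_norm_square w_def
      by (rule arg_cong[where f = exp]) (simp add: algebra_simps)
    have g: "of_real (exp ((cmod \<gamma>)\<^sup>2)) = exp (\<gamma> * cnj \<gamma>)"
      unfolding exp_of_real[symmetric] complex_norm_square ..
    have "I w = \<kappa> * (\<kappa>' * cnj \<kappa>') * (poly p x * poly r x * cnj (poly r x)) *
       (exp (cnj w * z - 2 * (w * cnj w)) * exp (\<gamma> * w) * exp (cnj (\<gamma> * w)) * exp (\<gamma> * w))"
      unfolding I_def wave_def xw complex_norm_square complex_cnj_mult exp_cnj by (simp only: mult_ac)
    also have "\<dots> = C * (poly (p * r) x * cnj (poly r x) * (exp (0 * x + (z - cnj \<gamma>) * cnj x) * iso.wt x))"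
      unfolding e C_def of_real_mult g complex_norm_square poly_mult by (simp only: mult_ac)
    finally show ?thesis unfolding w_def .
  qed
  have "cubic (wave \<kappa>' r \<gamma>) (wave \<kappa> p \<gamma>) z = of_real (1 / pi) * (LINT w|lborel. I w)"
    unfolding cubic_def I_def ..
  also have "(LINT w|lborel. I w) = (LINT x|lborel. I (cnj \<gamma> + x))"
    by (rule lborel_integral_translate[symmetric]) (rule borel_measurable_continuous_onI[OF contI])
  also have "\<dots> = C * (LINT x|lborel. poly (p * r) x * cnj (poly r x) * (exp (0 * x + (z - cnj \<gamma>) * cnj x) * iso.wt x))"
    unfolding I_shift by (rule integral_mult_right_zero)
  also have "\<dots> = C * (of_real (pi / 2) * poly (cubic_poly (p * r) r) (z - cnj \<gamma>))"
    unfolding iso.poly_integral(1) iso_G cubic_poly_def by (simp add: poly_sum sum_distrib_left mult_ac)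
  finally show ?thesis by (simp add: C_def)
qed

lemma deriv_wave: "deriv (wave \<kappa> p \<gamma>) z = \<kappa> * (poly (pderiv p) (z - cnj \<gamma>) + \<gamma> * poly p (z - cnj \<gamma>)) * exp (\<gamma> * z)"
proof (rule DERIV_imp_deriv)
  have 1: "((\<lambda>z. poly p (z - cnj \<gamma>)) has_field_derivative poly (pderiv p) (z - cnj \<gamma>)) (at z)"
    using DERIV_shift[of "poly p" "poly (pderiv p) (z - cnj \<gamma>)" z "- cnj \<gamma>"] poly_DERIV[of p] by simp
  have 2: "((\<lambda>z. exp (\<gamma> * z)) has_field_derivative exp (\<gamma> * z) * \<gamma>) (at z)"
    by (rule DERIV_fun_exp) (auto intro!: derivative_eq_intros)
  show "(wave \<kappa> p \<gamma> has_field_derivative \<kappa> * (poly (pderiv p) (z - cnj \<gamma>) + \<gamma> * poly p (z - cnj \<gamma>)) * exp (\<gamma> * z)) (at z)"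
    unfolding wave_def by (rule DERIV_cong[OF DERIV_mult[OF DERIV_cmult[OF 1] 2]]) (simp add: algebra_simps)
qed

definition poly_advect :: "real \<Rightarrow> complex \<Rightarrow> complex poly \<Rightarrow> complex poly" where
  "poly_advect l \<alpha> p = smult (of_real l) p + smult (\<i> * \<alpha>) (pderiv p) - smult (\<i> * cnj \<alpha>) (pCons 0 p)"

lemma advect_wave:
  "advect lam \<alpha> (wave \<kappa> p \<gamma>) z = \<kappa> * exp (\<gamma> * z) * poly (poly_advect (lam - 2 * Im (\<alpha> * \<gamma>)) \<alpha> p) (z - cnj \<gamma>)"
proof -
  have im: "of_real (lam - 2 * Im (\<alpha> * \<gamma>)) = of_real lam + \<i> * \<alpha> * \<gamma> - \<i> * cnj \<alpha> * cnj \<gamma>"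
    by (simp add: complex_eq_iff)
  show ?thesis unfolding advect_def deriv_wave unfolding poly_advect_def wave_def im
    by (simp add: algebra_simps)
qed

lemma wave_equation_iff:
  assumes "\<kappa> \<noteq> 0"
  shows "(\<forall>z. advect lam \<alpha> (wave \<kappa> p \<gamma>) z = \<epsilon> * cubic (wave \<kappa>' r \<gamma>) (wave \<kappa> p \<gamma>) z) \<longleftrightarrow>
    poly_advect (lam - 2 * Im (\<alpha> * \<gamma>)) \<alpha> p = smult (\<epsilon> * of_real ((cmod \<kappa>')\<^sup>2 * exp ((cmod \<gamma>)\<^sup>2) / 2)) (cubic_poly (p * r) r)"
    (is "?L \<longleftrightarrow> ?A = ?B")
proof -
  have "advect lam \<alpha> (wave \<kappa> p \<gamma>) z = \<epsilon> * cubic (wave \<kappa>' r \<gamma>) (wave \<kappa> p \<gamma>) z \<longleftrightarrow> poly ?A (z - cnj \<gamma>) = poly ?B (z - cnj \<gamma>)" for z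
  proof -
    have E: "\<epsilon> * cubic (wave \<kappa>' r \<gamma>) (wave \<kappa> p \<gamma>) z = \<kappa> * exp (\<gamma> * z) * poly ?B (z - cnj \<gamma>)"
      unfolding cubic_wave poly_smult by (simp only: mult_ac)
    have "\<kappa> * exp (\<gamma> * z) \<noteq> 0" using assms by simp
    then show ?thesis unfolding advect_wave E by (simp only: mult_cancel_left simp_thms)
  qed
  then have "?L \<longleftrightarrow> (\<forall>z. poly ?A (z - cnj \<gamma>) = poly ?B (z - cnj \<gamma>))" by simp
  also have "\<dots> \<longleftrightarrow> (\<forall>x. poly ?A x = poly ?B x)" by (metis add_diff_cancel)
  also have "\<dots> \<longleftrightarrow> ?A = ?B" by (metis poly_eq_poly_eq_iff ext)
  finally show ?thesis .
qed

lemma wave_fock: "fock (wave \<kappa> p \<gamma>) \<in> bargmann_fock" "wave \<kappa> p \<gamma> holomorphic_on UNIV"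
proof -
  show h: "wave \<kappa> p \<gamma> holomorphic_on UNIV" unfolding wave_def by (intro holomorphic_intros)
  define q where "q = pcompose p [:- cnj \<gamma>, 1:]"
  have "rapid (\<lambda>w. \<kappa> * (poly q w * (cnj (poly q w) * (exp (\<gamma> * w + cnj \<gamma> * cnj w) * (cnj \<kappa> * of_real (exp (- (cmod w)\<^sup>2)))))))"
    by (intro rapid_cmult rapid_poly rapid_mult_exp[OF _ _ lin_bound] rapidI[of _ 1]) auto
  then have "integrable lborel (\<lambda>w. cmod (\<kappa> * (poly q w * (cnj (poly q w) * (exp (\<gamma> * w + cnj \<gamma> * cnj w) * (cnj \<kappa> * of_real (exp (- (cmod w)\<^sup>2))))))))"
    by (intro integrable_norm rapid_integrable)
  moreover have "cmod (\<kappa> * (poly q w * (cnj (poly q w) * (exp (\<gamma> * w + cnj \<gamma> * cnj w) * (cnj \<kappa> * of_real (exp (- (cmod w)\<^sup>2)))))))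
     = (cmod (fock (wave \<kappa> p \<gamma>) w))\<^sup>2" for w
  proof -
    have q: "poly q w = poly p (w - cnj \<gamma>)" by (simp add: q_def poly_pcompose)
    have r: "Re (\<gamma> * w + cnj \<gamma> * cnj w) = 2 * Re (\<gamma> * w)" by simp
    show ?thesis unfolding fock_def wave_def q norm_mult norm_exp_eq_Re r power_mult_distrib exp_double[symmetric]
      by (simp add: power2_eq_square mult_ac)
  qed
  ultimately have "integrable lborel (\<lambda>w. (cmod (fock (wave \<kappa> p \<gamma>) w))\<^sup>2)" by simp
  with h show "fock (wave \<kappa> p \<gamma>) \<in> bargmann_fock"
    unfolding bargmann_fock_def by (auto simp: fock_def)
qed

lemma shifted_wave:
  "shifted lam \<alpha> t (wave \<kappa> p \<gamma>) = wave (exp (- \<i> * of_real (lam * t) - of_real ((cmod \<alpha>)\<^sup>2 * t\<^sup>2 / 2) + \<gamma> * \<alpha> * of_real t) * \<kappa>) p (\<gamma> - cnj \<alpha> * of_real t)"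
proof
  fix z
  have "exp (- \<i> * of_real (lam * t) - of_real ((cmod \<alpha>)\<^sup>2 * t\<^sup>2 / 2) - cnj \<alpha> * of_real t * z) * exp (\<gamma> * (z + \<alpha> * of_real t))
    = exp (- \<i> * of_real (lam * t) - of_real ((cmod \<alpha>)\<^sup>2 * t\<^sup>2 / 2) + \<gamma> * \<alpha> * of_real t) * exp ((\<gamma> - cnj \<alpha> * of_real t) * z)"
    unfolding exp_add[symmetric] by (rule arg_cong[where f = exp]) (simp add: algebra_simps)
  moreover have "e1 * (\<kappa> * F * e2) = e3 * \<kappa> * F * e4" if "e1 * e2 = e3 * e4" for e1 e2 e3 e4 F :: complex
    using that by algebra
  ultimately show "shifted lam \<alpha> t (wave \<kappa> p \<gamma>) z = wave (exp (- \<i> * of_real (lam * t) - of_real ((cmod \<alpha>)\<^sup>2 * t\<^sup>2 / 2) + \<gamma> * \<alpha> * of_real t) * \<kappa>) p (\<gamma> - cnj \<alpha> * of_real t) z"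
    unfolding shifted_def wave_def by (simp add: algebra_simps)
qed

text \<open>
  Magnetic translations are unitary, so they preserve the size of the profile; for a given polynomial that
  size is governed by \<open>|\<kappa>|\<^sup>2 * exp (|\<gamma>|\<^sup>2)\<close>, the quantity through which \<open>\<kappa>\<close> enters the cubic term.
\<close>

lemma wave_norm_invariant:
  "(cmod (exp (- \<i> * of_real (lam * t) - of_real ((cmod \<alpha>)\<^sup>2 * t\<^sup>2 / 2) + \<gamma> * \<alpha> * of_real t) * \<kappa>))\<^sup>2 * exp ((cmod (\<gamma> - cnj \<alpha> * of_real t))\<^sup>2)
    = (cmod \<kappa>)\<^sup>2 * exp ((cmod \<gamma>)\<^sup>2)"
proof -
  have re: "Re (- \<i> * of_real (lam * t) - of_real ((cmod \<alpha>)\<^sup>2 * t\<^sup>2 / 2) + \<gamma> * \<alpha> * of_real t) = - ((cmod \<alpha>)\<^sup>2 * t\<^sup>2 / 2) + Re (\<gamma> * \<alpha>) * t"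
    by simp
  have "(cmod (\<gamma> - cnj \<alpha> * of_real t))\<^sup>2 = (cmod \<gamma>)\<^sup>2 - 2 * (Re (\<gamma> * \<alpha>) * t) + (cmod \<alpha>)\<^sup>2 * t\<^sup>2"
    unfolding cmod_power2 by (simp add: power2_eq_square algebra_simps)
  then have "2 * (- ((cmod \<alpha>)\<^sup>2 * t\<^sup>2 / 2) + Re (\<gamma> * \<alpha>) * t) + (cmod (\<gamma> - cnj \<alpha> * of_real t))\<^sup>2 = (cmod \<gamma>)\<^sup>2" by simp
  then have e: "exp (2 * (- ((cmod \<alpha>)\<^sup>2 * t\<^sup>2 / 2) + Re (\<gamma> * \<alpha>) * t)) * exp ((cmod (\<gamma> - cnj \<alpha> * of_real t))\<^sup>2) = exp ((cmod \<gamma>)\<^sup>2)"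
    unfolding exp_add[symmetric] by simp
  show ?thesis unfolding norm_mult norm_exp_eq_Re re power_mult_distrib exp_double[symmetric] e[symmetric] by (simp only: mult_ac)
qed

text \<open>
  The polynomials stay fixed along the evolution while \<open>Im (\<alpha> * \<gamma>)\<close> and the constant in front of the cubic
  term are conserved, so the equations at all times coincide with those at time zero.
\<close>

lemma progressive_wave_polynomials_iff:
  "progressive_wave_initial (fock (wave 1 p \<gamma>)) (fock (wave 1 r \<gamma>)) lam mu \<alpha> \<longleftrightarrow>
     poly_advect (lam - 2 * Im (\<alpha> * \<gamma>)) \<alpha> p = smult (of_real (exp ((cmod \<gamma>)\<^sup>2) / 2)) (cubic_poly (p * r) r) \<and>
     poly_advect (mu - 2 * Im (\<alpha> * \<gamma>)) \<alpha> r = - smult (of_real (exp ((cmod \<gamma>)\<^sup>2) / 2)) (cubic_poly (r * p) p)"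
proof -
  define k where "k = (\<lambda>(l::real) (t::real). exp (- \<i> * of_real (l * t) - of_real ((cmod \<alpha>)\<^sup>2 * t\<^sup>2 / 2) + \<gamma> * \<alpha> * of_real t))"
  define G where "G = (\<lambda>t::real. \<gamma> - cnj \<alpha> * of_real t)"
  have sh: "shifted l \<alpha> t (wave 1 p \<gamma>) = wave (k l t) p (G t)" for l t p
    unfolding shifted_wave k_def G_def by simp
  have kn: "k l t \<noteq> 0" for l t by (simp add: k_def)
  have inv: "(cmod (k l t))\<^sup>2 * exp ((cmod (G t))\<^sup>2) = exp ((cmod \<gamma>)\<^sup>2)" for l t
    using wave_norm_invariant[of l t \<alpha> \<gamma> 1] by (simp add: k_def G_def)
  have im: "Im (\<alpha> * G t) = Im (\<alpha> * \<gamma>)" for t by (simp add: G_def algebra_simps)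
  have eq: "(\<forall>z. advect l \<alpha> (wave (k l t) p (G t)) z = \<epsilon> * cubic (wave (k m t) r (G t)) (wave (k l t) p (G t)) z) \<longleftrightarrow>
     poly_advect (l - 2 * Im (\<alpha> * \<gamma>)) \<alpha> p = smult (\<epsilon> * of_real (exp ((cmod \<gamma>)\<^sup>2) / 2)) (cubic_poly (p * r) r)" for l m t p r \<epsilon>
    unfolding wave_equation_iff[OF kn] inv im ..
  have "progressive_wave_initial (fock (wave 1 p \<gamma>)) (fock (wave 1 r \<gamma>)) lam mu \<alpha> \<longleftrightarrow>
     (\<forall>t. (\<forall>z. advect lam \<alpha> (wave (k lam t) p (G t)) z = 1 * cubic (wave (k mu t) r (G t)) (wave (k lam t) p (G t)) z) \<and>
          (\<forall>z. advect mu \<alpha> (wave (k mu t) r (G t)) z = - 1 * cubic (wave (k lam t) p (G t)) (wave (k mu t) r (G t)) z))"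
    unfolding progressive_wave_iff[OF wave_fock(2) wave_fock(2)] sh using wave_fock(1) by auto
  then show ?thesis unfolding eq by simp
qed

section \<open>Solving the polynomial system\<close>

lemma coeff_poly_advect:
  "coeff (poly_advect l \<alpha> p) i = of_real l * coeff p i + \<i> * \<alpha> * (of_nat (Suc i) * coeff p (Suc i))
     - \<i> * cnj \<alpha> * (case i of 0 \<Rightarrow> 0 | Suc j \<Rightarrow> coeff p j)"
  by (simp add: poly_advect_def coeff_pderiv coeff_pCons split: nat.split)

lemma lowest_coeff:
  fixes r :: "complex poly" assumes "r \<noteq> 0"
  obtains k where "k \<le> degree r" "coeff r k \<noteq> 0" "\<And>j. j < k \<Longrightarrow> coeff r j = 0"
proof -
  define k where "k = (LEAST k. coeff r k \<noteq> 0)"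
  have "coeff r (degree r) \<noteq> 0" using assms by simp
  then have "coeff r k \<noteq> 0" "k \<le> degree r" unfolding k_def by (rule LeastI, rule Least_le)
  moreover have "coeff r j = 0" if "j < k" for j using not_less_Least[of j "\<lambda>k. coeff r k \<noteq> 0"] that by (auto simp: k_def)
  ultimately show ?thesis using that by blast
qed

text \<open>
  As a differential operator, \<open>r\<close> lowers the degree by at least its order of vanishing \<open>k\<close> at the origin,
  and the term of order exactly \<open>k\<close> produces the top coefficient.
\<close>

lemma coeff_cubic_poly_top:
  assumes "p \<noteq> 0" "r \<noteq> 0" and k: "k \<le> degree r" and low: "\<And>j. j < k \<Longrightarrow> coeff r j = 0"
  shows "coeff (cubic_poly (p * r) r) (degree p + degree r - k) =
    cnj (coeff r k) * (lead_coeff p * lead_coeff r) * (fact (degree p + degree r) / (fact (degree p + degree r - k) * 2 ^ (degree p + degree r)))"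
proof -
  define N where "N = degree p + degree r"
  have dH: "degree (p * r) = N" using assms by (simp add: degree_mult_eq N_def)
  have "coeff (cubic_poly (p * r) r) (N - k) = (\<Sum>j\<le>degree r. if j = k then cnj (coeff r k) * coeff (p * r) N * (fact N / (fact (N - k) * 2 ^ N)) else 0)"
    unfolding coeff_cubic_poly
  proof (rule sum.cong[OF refl])
    fix j assume "j \<in> {..degree r}"
    have kN: "k \<le> N" using k by (simp add: N_def)
    consider "j < k" | "j = k" | "j > k" by linarith
    then show "cnj (coeff r j) * coeff (p * r) (N - k + j) * (fact (N - k + j) / (fact (N - k) * 2 ^ (N - k + j)))
      = (if j = k then cnj (coeff r k) * coeff (p * r) N * (fact N / (fact (N - k) * 2 ^ N)) else 0)"
    proof cases
      case 3
      then have "coeff (p * r) (N - k + j) = 0" using kN by (intro coeff_eq_0) (simp add: dH)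
      with 3 show ?thesis by simp
    qed (use low kN in auto)
  qed
  also have "\<dots> = cnj (coeff r k) * coeff (p * r) N * (fact N / (fact (N - k) * 2 ^ N))"
    using k by simp
  also have "coeff (p * r) N = lead_coeff p * lead_coeff r" unfolding N_def by (rule coeff_mult_degree_sum)
  finally show ?thesis unfolding N_def .
qed

text \<open>
  For \<open>\<alpha> = 0\<close> the left side has degree at most that of \<open>p\<close>, hence the order of vanishing of \<open>r\<close> is its
  degree.
\<close>

lemma partner_monomial:
  assumes eq: "poly_advect l 0 p = smult c (cubic_poly (p * r) r)" and c: "c \<noteq> 0" and nz: "p \<noteq> 0" "r \<noteq> 0"
  shows "r = monom (lead_coeff r) (degree r)"
proof -
  obtain k where k: "k \<le> degree r" "coeff r k \<noteq> 0" and low: "\<And>j. j < k \<Longrightarrow> coeff r j = 0" using lowest_coeff[OF nz(2)] by blast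
  have ne: "coeff (smult c (cubic_poly (p * r) r)) (degree p + degree r - k) \<noteq> 0"
    by (subst coeff_smult, subst coeff_cubic_poly_top[OF nz k(1)]) (use low c nz k(2) in auto)
  have "degree r \<le> k"
  proof (rule ccontr)
    assume "\<not> degree r \<le> k"
    then have "coeff (poly_advect l 0 p) (degree p + degree r - k) = 0"
      by (simp add: coeff_poly_advect coeff_eq_0)
    with ne show False unfolding eq by simp
  qed
  then have "k = degree r" using k by simp
  then show ?thesis using low by (intro poly_eqI) (auto simp: coeff_eq_0 not_less nat_neq_iff)
qed

text \<open>
  For \<open>\<alpha> \<noteq> 0\<close> the left side has degree exactly one more than \<open>p\<close>, hence the order of vanishing of \<open>r\<close> is one
  less than its degree.
\<close>

lemma partner_two_terms:
  assumes eq: "poly_advect l \<alpha> p = smult c (cubic_poly (p * r) r)" and c: "c \<noteq> 0" and nz: "p \<noteq> 0" "r \<noteq> 0" and \<alpha>: "\<alpha> \<noteq> 0"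
  obtains m r0 r1 where "r = monom 1 m * [:r0, r1:]" "r0 \<noteq> 0" "r1 \<noteq> 0"
proof -
  obtain k where k: "k \<le> degree r" "coeff r k \<noteq> 0" and low: "\<And>j. j < k \<Longrightarrow> coeff r j = 0" using lowest_coeff[OF nz(2)] by blast
  have ne: "coeff (smult c (cubic_poly (p * r) r)) (degree p + degree r - k) \<noteq> 0"
    by (subst coeff_smult, subst coeff_cubic_poly_top[OF nz k(1)]) (use low c nz k(2) in auto)
  have lhs: "coeff (poly_advect l \<alpha> p) i = 0" if "i > Suc (degree p)" for i
    using that by (cases i) (auto simp: coeff_poly_advect coeff_eq_0)
  have lhs1: "coeff (poly_advect l \<alpha> p) (Suc (degree p)) \<noteq> 0"
    using \<alpha> nz by (simp add: coeff_poly_advect coeff_eq_0)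
  have 1: "degree p + degree r - k \<le> Suc (degree p)"
    using lhs[of "degree p + degree r - k"] ne unfolding eq by (meson not_less)
  have "k \<noteq> degree r"
  proof
    assume kr: "k = degree r"
    have "coeff (cubic_poly (p * r) r) (Suc (degree p)) = 0"
      unfolding coeff_cubic_poly
    proof (rule sum.neutral, intro ballI)
      fix j assume j: "j \<in> {..degree r}"
      show "cnj (coeff r j) * coeff (p * r) (Suc (degree p) + j) * (fact (Suc (degree p) + j) / (fact (Suc (degree p)) * 2 ^ (Suc (degree p) + j))) = 0"
      proof (cases "j < k")
        case True then show ?thesis by (simp add: low)
      next
        case False
        then have "coeff (p * r) (Suc (degree p) + j) = 0"
          using j kr nz by (intro coeff_eq_0) (simp add: degree_mult_eq)
        then show ?thesis by simp
      qed
    qed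
    with lhs1 show False unfolding eq by simp
  qed
  with 1 k(1) have kd: "degree r = Suc k" by simp
  have "r = monom 1 k * [:coeff r k, coeff r (Suc k):]"
  proof (rule poly_eqI)
    fix i
    have "coeff r i = 0" if "i > Suc k" using that kd by (simp add: coeff_eq_0)
    then show "coeff r i = coeff (monom 1 k * [:coeff r k, coeff r (Suc k):]) i"
      using low[of i] by (cases "i < k"; cases "i = k"; cases "i = Suc k")
        (auto simp: coeff_monom_mult coeff_pCons not_less split: nat.split)
  qed
  moreover have "coeff r (Suc k) \<noteq> 0" using kd nz(2) by (metis leading_coeff_0_iff)
  ultimately show ?thesis using that k(2) by blast
qed

lemma coeff_cubic_poly_two_terms:
  assumes "r1 \<noteq> 0"
  shows "coeff (cubic_poly H (monom 1 m * [:r0, r1:])) i =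
    cnj r0 * coeff H (i + m) * (fact (i + m) / (fact i * 2 ^ (i + m)))
    + cnj r1 * coeff H (i + Suc m) * (fact (i + Suc m) / (fact i * 2 ^ (i + Suc m)))"
proof -
  define r where "r = monom 1 m * [:r0, r1:]"
  have d: "degree r = Suc m" using assms unfolding r_def by (subst degree_mult_eq) (simp_all add: degree_monom_eq)
  have cr: "coeff r k = (if k = m then r0 else if k = Suc m then r1 else 0)" for k
    unfolding r_def by (auto simp: coeff_monom_mult coeff_pCons split: nat.split)
  have "coeff (cubic_poly H r) i = (\<Sum>k\<in>{m, Suc m}. cnj (coeff r k) * coeff H (i + k) * (fact (i + k) / (fact i * 2 ^ (i + k))))"
    unfolding coeff_cubic_poly d by (rule sum.mono_neutral_right) (auto simp: cr)
  then show ?thesis unfolding r_def[symmetric] by (simp add: cr)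
qed

text \<open>
  The coefficients of \<open>x ^ (n + 2)\<close> and of \<open>x ^ (n - 1)\<close> each involve a single term on both sides.  They
  determine \<open>\<i> * \<alpha>\<close> twice, and the ratio of the factorials must match.
\<close>

lemma top_and_bottom:
  assumes eq: "poly_advect l \<alpha> p = smult (of_real c) (cubic_poly (p * r) r)" and c: "c \<noteq> 0"
    and p: "p = monom 1 n * [:p0, p1:]" and r: "r = monom 1 m * [:r0, r1:]"
    and nz: "p0 \<noteq> 0" "p1 \<noteq> 0" "r0 \<noteq> 0" "r1 \<noteq> 0"
  shows "n > 0 \<Longrightarrow> (n + m + 2) * (n + m + 1) = 4 * ((n + 2) * (n + 1))"
proof -
  assume n: "n > 0"
  then obtain n' where n': "n = Suc n'" by (cases n) auto
  have cp: "coeff p k = (if k = n then p0 else if k = Suc n then p1 else 0)" for k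
    unfolding p by (auto simp: coeff_monom_mult coeff_pCons split: nat.split)
  have pr: "p * r = monom 1 (n + m) * [:p0 * r0, p0 * r1 + p1 * r0, p1 * r1:]"
  proof -
    have "p * r = (monom 1 n * monom 1 m) * ([:p0, p1:] * [:r0, r1:])" unfolding p r by (simp only: mult_ac)
    then show ?thesis by (simp add: mult_monom algebra_simps)
  qed
  have cpr: "coeff (p * r) k = (if k = n + m then p0 * r0 else if k = n + m + 1 then p0 * r1 + p1 * r0 else if k = n + m + 2 then p1 * r1 else 0)" for k
    unfolding pr by (auto simp: coeff_monom_mult coeff_pCons split: nat.split)
  have cO: "coeff (cubic_poly H r) i = cnj r0 * coeff H (i + m) * (fact (i + m) / (fact i * 2 ^ (i + m)))
    + cnj r1 * coeff H (i + Suc m) * (fact (i + Suc m) / (fact i * 2 ^ (i + Suc m)))" for H i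
    unfolding r by (rule coeff_cubic_poly_two_terms[OF nz(4)])
  define T where "T = fact (n + m + 2) / (fact (n + 2) * 2 ^ (n + m + 2) :: real)"
  define S where "S = fact (n + m) / (fact n' * 2 ^ (n + m) :: real)"
  have "coeff (poly_advect l \<alpha> p) (n + 2) = of_real c * coeff (cubic_poly (p * r) r) (n + 2)" unfolding eq by simp
  then have "- \<i> * cnj \<alpha> * p1 = of_real c * (cnj r0 * (p1 * r1) * of_real T)"
    unfolding coeff_poly_advect cO by (simp add: cp cpr T_def add.commute)
  then have "p1 * (- \<i> * cnj \<alpha>) = p1 * (of_real c * (cnj r0 * r1 * of_real T))" by (simp only: mult_ac)
  then have top: "- \<i> * cnj \<alpha> = of_real c * (cnj r0 * r1 * of_real T)" using nz(2) by (simp only: mult_cancel_left simp_thms)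
  have "cnj (- \<i> * cnj \<alpha>) = cnj (of_real c * (cnj r0 * r1 * of_real T))" unfolding top ..
  then have top': "\<i> * \<alpha> = of_real c * (r0 * cnj r1 * of_real T)" by simp
  have zc: "(case n' of 0 \<Rightarrow> 0 | Suc j \<Rightarrow> coeff p j) = 0"
    by (cases n') (simp_all add: cp n')
  have "coeff (poly_advect l \<alpha> p) n' = of_real c * coeff (cubic_poly (p * r) r) n'" unfolding eq by simp
  then have "\<i> * \<alpha> * (of_nat n * p0) = of_real c * (cnj r1 * (p0 * r0) * of_real S)"
    unfolding coeff_poly_advect cO zc by (simp add: cp cpr S_def n')
  then have "of_real c * (r0 * cnj r1) * p0 * (of_nat n * of_real T) = of_real c * (r0 * cnj r1) * p0 * of_real S"
    unfolding top' by (simp add: mult_ac)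
  then have "of_nat n * of_real T = (of_real S :: complex)" using nz c by simp
  then have nTS: "real n * T = S" by (metis of_real_eq_iff of_real_mult of_real_of_nat_eq)
  have f1: "fact (n + m + 2) = real ((n + m + 2) * (n + m + 1)) * fact (n + m)"
    by (simp add: algebra_simps)
  have f2: "fact (n + 2) = real ((n + 2) * (n + 1)) * (real n * fact n')"
    by (simp add: n' algebra_simps)
  have "real n * T = real ((n + m + 2) * (n + m + 1)) / real (4 * ((n + 2) * (n + 1))) * S"
    unfolding T_def S_def f1 f2 using n by (simp add: power_add divide_simps)
  moreover have "S > 0" by (simp add: S_def)
  ultimately have "real ((n + m + 2) * (n + m + 1)) = real (4 * ((n + 2) * (n + 1)))"
    unfolding nTS by (simp add: divide_simps del: of_nat_mult of_nat_add)
  then show ?thesis by (simp only: of_nat_eq_iff)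
qed

lemma linear_equation_iff:
  assumes "p1 \<noteq> 0" "r1 \<noteq> 0"
  shows "poly_advect l \<alpha> [:p0, p1:] = smult c (cubic_poly ([:p0, p1:] * [:r0, r1:]) [:r0, r1:]) \<longleftrightarrow>
    - \<i> * cnj \<alpha> = c * cnj r0 * r1 / 4 \<and>
    of_real l * p1 - \<i> * cnj \<alpha> * p0 = c * (cnj r0 * (p0 * r1 + p1 * r0) + cnj r1 * (p1 * r1)) / 2 \<and>
    of_real l * p0 + \<i> * \<alpha> * p1 = c * (cnj r0 * (p0 * r0) + cnj r1 * (p0 * r1 + p1 * r0) / 2)"
    (is "?A = smult c (cubic_poly ?H ?r) \<longleftrightarrow> ?E2 \<and> ?E1 \<and> ?E0")
proof -
  have co: "coeff (cubic_poly ?H ?r) i = cnj r0 * coeff ?H i * (1 / 2 ^ i) + cnj r1 * coeff ?H (Suc i) * (of_nat (Suc i) / 2 ^ Suc i)" for i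
  proof -
    have "fact (Suc i) / (fact i * 2 ^ Suc i) = (of_nat (Suc i) / 2 ^ Suc i :: complex)" by (simp del: of_nat_Suc)
    then show ?thesis using coeff_cubic_poly_two_terms[OF assms(2), of ?H 0 r0 i] by (simp add: monom_0 one_pCons[symmetric])
  qed
  have H: "?H = [:p0 * r0, p0 * r1 + p1 * r0, p1 * r1:]" by (simp add: algebra_simps)
  have "?A = smult c (cubic_poly ?H ?r) \<longleftrightarrow> (\<forall>i. coeff ?A i = c * coeff (cubic_poly ?H ?r) i)"
    by (simp only: poly_eq_iff coeff_smult)
  also have "\<dots> \<longleftrightarrow> (\<forall>i\<in>{2, 1, 0}. coeff ?A i = c * coeff (cubic_poly ?H ?r) i)"
  proof -
    have "coeff ?A i = c * coeff (cubic_poly ?H ?r) i" if "i \<notin> {2, 1, 0}" for i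
    proof -
      obtain j where "i = Suc (Suc (Suc j))" using \<open>i \<notin> {2, 1, 0}\<close> by (metis One_nat_def Suc_1 insertCI not0_implies_Suc)
      then show ?thesis unfolding co unfolding H coeff_poly_advect by simp
    qed
    then show ?thesis by blast
  qed
  also have "\<dots> \<longleftrightarrow> ?E2 \<and> ?E1 \<and> ?E0"
  proof -
    have "coeff ?A 2 = c * coeff (cubic_poly ?H ?r) 2 \<longleftrightarrow> - \<i> * cnj \<alpha> * p1 = c * cnj r0 * r1 / 4 * p1"
      unfolding co unfolding H coeff_poly_advect by (simp add: numeral_2_eq_2 mult_ac)
    then have 2: "coeff ?A 2 = c * coeff (cubic_poly ?H ?r) 2 \<longleftrightarrow> ?E2" using assms(1) by (simp only: mult_cancel_right simp_thms)
    have 1: "coeff ?A 1 = c * coeff (cubic_poly ?H ?r) 1 \<longleftrightarrow> ?E1"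
      unfolding co unfolding H coeff_poly_advect by (simp add: algebra_simps add_divide_distrib)
    have 0: "coeff ?A 0 = c * coeff (cubic_poly ?H ?r) 0 \<longleftrightarrow> ?E0"
      unfolding co unfolding H coeff_poly_advect by (simp add: algebra_simps add_divide_distrib)
    show ?thesis using 0 1 2 by simp
  qed
  finally show ?thesis .
qed

text \<open>
  The two leading coefficients give \<open>cnj r0 * r1 = - (cnj p0 * p1)\<close>.  Eliminating \<open>l\<close> and \<open>m\<close> gives
  \<open>|p1|\<^sup>2 = |p0|\<^sup>2 + 2 * |r0|\<^sup>2\<close> and \<open>|r1|\<^sup>2 = |r0|\<^sup>2 + 2 * |p0|\<^sup>2\<close>, and together with
  \<open>|r0| * |r1| = |p0| * |p1|\<close> this forces \<open>|r0| = |p0|\<close>.  Numbers and their conjugates are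
  named separately, so that each step is a polynomial identity.
\<close>

lemma linear_system:
  fixes c :: real
  assumes c: "c > 0" and nz: "p0 \<noteq> 0" "p1 \<noteq> 0" "r0 \<noteq> 0" "r1 \<noteq> 0"
  shows "poly_advect l \<alpha> [:p0, p1:] = smult (of_real c) (cubic_poly ([:p0, p1:] * [:r0, r1:]) [:r0, r1:]) \<and>
     poly_advect m \<alpha> [:r0, r1:] = - smult (of_real c) (cubic_poly ([:r0, r1:] * [:p0, p1:]) [:p0, p1:]) \<longleftrightarrow>
    (cmod p1)\<^sup>2 = 3 * (cmod p0)\<^sup>2 \<and> (cmod r0)\<^sup>2 = (cmod p0)\<^sup>2 \<and> r0 * p1 = - (p0 * r1) \<and>
    l = 7 * c * (cmod p0)\<^sup>2 / 4 \<and> m = - (7 * c * (cmod p0)\<^sup>2 / 4) \<and> \<alpha> = \<i> * of_real c * p0 * cnj p1 / 4"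
    (is "?L \<longleftrightarrow> ?R")
proof -
  define P0 where "P0 = cnj p0"
  define P1 where "P1 = cnj p1"
  define R0 where "R0 = cnj r0"
  define R1 where "R1 = cnj r1"
  define a where "a = \<i> * \<alpha>"
  define a' where "a' = - \<i> * cnj \<alpha>"
  define C where "C = complex_of_real c"
  define x where "x = (cmod p0)\<^sup>2"
  define y where "y = (cmod r0)\<^sup>2"
  have C: "C \<noteq> 0" using c by (simp add: C_def)
  have nz': "P0 \<noteq> 0" "P1 \<noteq> 0" "R0 \<noteq> 0" "R1 \<noteq> 0" using nz by (simp_all add: P0_def P1_def R0_def R1_def)
  have xP: "complex_of_real x = p0 * P0" unfolding x_def P0_def by (rule complex_norm_square)
  have yR: "complex_of_real y = r0 * R0" unfolding y_def R0_def by (rule complex_norm_square)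
  have sq1: "complex_of_real ((cmod p1)\<^sup>2) = p1 * P1" unfolding P1_def by (rule complex_norm_square)
  have "?L \<longleftrightarrow>
    (a' = C * R0 * r1 / 4 \<and>
     of_real l * p1 + a' * p0 = C * (R0 * (p0 * r1 + p1 * r0) + R1 * (p1 * r1)) / 2 \<and>
     of_real l * p0 + a * p1 = C * (R0 * (p0 * r0) + R1 * (p0 * r1 + p1 * r0) / 2)) \<and>
    (a' = - C * P0 * p1 / 4 \<and>
     of_real m * r1 + a' * r0 = - C * (P0 * (r0 * p1 + r1 * p0) + P1 * (r1 * p1)) / 2 \<and>
     of_real m * r0 + a * r1 = - C * (P0 * (r0 * p0) + P1 * (r0 * p1 + r1 * p0) / 2))" (is "_ \<longleftrightarrow> ?E")
    using linear_equation_iff[OF nz(2) nz(4), of l \<alpha> p0 "of_real c" r0] linear_equation_iff[OF nz(4) nz(2), of m \<alpha> r0 "- of_real c" p0]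
    unfolding P0_def P1_def R0_def R1_def a_def a'_def C_def by (simp only: smult_minus_left diff_conv_add_uminus mult_minus_left)
  also have "\<dots> \<longleftrightarrow> ?R"
  proof
    assume ?E
    then have e2: "a' = C * R0 * r1 / 4"
      and e1: "of_real l * p1 + a' * p0 = C * (R0 * (p0 * r1 + p1 * r0) + R1 * (p1 * r1)) / 2"
      and e0: "of_real l * p0 + a * p1 = C * (R0 * (p0 * r0) + R1 * (p0 * r1 + p1 * r0) / 2)"
      and h2: "a' = - C * P0 * p1 / 4"
      and h1: "of_real m * r1 + a' * r0 = - C * (P0 * (r0 * p1 + r1 * p0) + P1 * (r1 * p1)) / 2"
      and h0: "of_real m * r0 + a * r1 = - C * (P0 * (r0 * p0) + P1 * (r0 * p1 + r1 * p0) / 2)" by blast+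
    have aa: "a = cnj a'" by (simp add: a_def a'_def)
    have e2': "a = C * r0 * R1 / 4" unfolding aa e2 by (simp add: C_def R0_def R1_def)
    have h2': "a = - C * p0 * P1 / 4" unfolding aa h2 by (simp add: C_def P0_def P1_def)
    have k1: "R0 * r1 = - (P0 * p1)"
    proof -
      have "C * (R0 * r1) = C * (- (P0 * p1))" using e2 h2 by (simp add: mult.assoc)
      then show ?thesis using C by (simp only: mult_cancel_left simp_thms)
    qed
    have k2: "r0 * R1 = - (p0 * P1)"
    proof -
      have "C * (r0 * R1) = C * (- (p0 * P1))" using e2' h2' by (simp add: mult.assoc)
      then show ?thesis using C by (simp only: mult_cancel_left simp_thms)
    qed
    have q: "4 * a' = C * R0 * r1" "4 * a = C * r0 * R1" "4 * a' = - C * P0 * p1" "4 * a = - C * p0 * P1"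
      by (simp add: e2, simp add: e2', simp add: h2, simp add: h2')
    have half: "2 * u = C' * (2 * Y + Z)" if "u = C' * (Y + Z / 2)" for u C' Y Z :: complex
      using that by (simp add: algebra_simps)
    have half': "2 * u = Y" if "u = Y / 2" for u Y :: complex unfolding that by simp
    have d1: "2 * (of_real l * p1 + a' * p0) = C * (R0 * (p0 * r1 + p1 * r0) + R1 * (p1 * r1))" by (rule half'[OF e1])
    have d2: "2 * (of_real m * r1 + a' * r0) = - C * (P0 * (r0 * p1 + r1 * p0) + P1 * (r1 * p1))" by (rule half'[OF h1])
    have e1': "4 * of_real l * p1 = C * (R0 * p0 * r1 + 2 * R0 * p1 * r0 + 2 * R1 * p1 * r1)"
      using d1 q(1) by algebra
    have e0': "4 * of_real l * p0 = C * (4 * R0 * p0 * r0 + 2 * R1 * p0 * r1 + R1 * p1 * r0)"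
      using half[OF e0] q(2) by algebra
    have h1': "4 * of_real m * r1 = - C * (P0 * r0 * p1 + 2 * P0 * r1 * p0 + 2 * P1 * r1 * p1)"
      using d2 q(3) by algebra
    have h0': "4 * of_real m * r0 = - C * (4 * P0 * r0 * p0 + 2 * P1 * r0 * p1 + P1 * r1 * p0)"
      using half[OF h0] q(4) by algebra
    have "C * (p0 * p1 * (p1 * P1 - p0 * P0 - 2 * (r0 * R0))) = 0"
      using e1' e0' k1 k2 by algebra
    then have "p1 * P1 - p0 * P0 - 2 * (r0 * R0) = 0" using C nz by (simp only: mult_eq_0_iff simp_thms)
    then have m1: "p1 * P1 = p0 * P0 + 2 * (r0 * R0)" by algebra
    have "C * (r0 * r1 * (r1 * R1 - r0 * R0 - 2 * (p0 * P0))) = 0"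
      using h1' h0' k1 k2 by algebra
    then have "r1 * R1 - r0 * R0 - 2 * (p0 * P0) = 0" using C nz by (simp only: mult_eq_0_iff simp_thms)
    then have m2: "r1 * R1 = r0 * R0 + 2 * (p0 * P0)" by algebra
    have "(r0 * R0) * (r1 * R1) = (p0 * P0) * (p1 * P1)" using k1 k2 by algebra
    then have "(of_real y)\<^sup>2 = (of_real x :: complex)\<^sup>2" unfolding m1 m2 xP yR by algebra
    then have "y\<^sup>2 = x\<^sup>2" by (metis of_real_eq_iff of_real_power)
    moreover have "0 \<le> y" "0 \<le> x" by (simp_all add: x_def y_def)
    ultimately have yx: "y = x" by (simp add: power2_eq_iff_nonneg)
    have rp: "r0 * R0 = p0 * P0" using yx xP yR by simp
    have p13: "p1 * P1 = 3 * (p0 * P0)" unfolding m1 rp by simp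
    have r13: "r1 * R1 = 3 * (p0 * P0)" unfolding m2 rp by simp
    have "complex_of_real ((cmod p1)\<^sup>2) = of_real (3 * x)" unfolding sq1 p13 by (simp add: xP)
    then have g1: "(cmod p1)\<^sup>2 = 3 * x" by (simp only: of_real_eq_iff)
    have "(r0 * p1 + p0 * r1) * (P1 * R1) = 0" using k2 p13 r13 by algebra
    then have g3: "r0 * p1 = - (p0 * r1)" using nz' by (simp add: eq_neg_iff_add_eq_0)
    have "4 * of_real l * p1 = 7 * C * (p0 * P0) * p1" using e1' k1 rp r13 by algebra
    then have "of_real (4 * l) = complex_of_real (7 * c * x)" using nz by (simp add: xP C_def)
    then have g4: "l = 7 * c * x / 4" unfolding of_real_eq_iff by simp
    have "4 * of_real m * r1 = - 7 * C * (p0 * P0) * r1"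
    proof -
      have "P0 * r0 * p1 = - (r0 * R0) * r1" using k1 by algebra
      then show ?thesis using h1' p13 rp by algebra
    qed
    then have "r1 * of_real (4 * m) = r1 * complex_of_real (- 7 * c * x)" by (simp add: xP C_def mult_ac)
    then have "of_real (4 * m) = complex_of_real (- 7 * c * x)" using nz by (simp only: mult_cancel_left simp_thms)
    then have g5: "m = - (7 * c * x / 4)" unfolding of_real_eq_iff by simp
    have "\<alpha> = - \<i> * a" by (simp add: a_def)
    then have g6: "\<alpha> = \<i> * of_real c * p0 * cnj p1 / 4" unfolding h2' by (simp add: C_def P1_def)
    show ?R using g1 g3 g4 g5 g6 yx unfolding x_def y_def by blast
  next
    assume ?R
    then have g1: "(cmod p1)\<^sup>2 = 3 * x" and g2: "y = x" and g3: "r0 * p1 = - (p0 * r1)"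
      and g4: "l = 7 * c * x / 4" and g5: "m = - (7 * c * x / 4)" and g6: "\<alpha> = \<i> * of_real c * p0 * cnj p1 / 4"
      unfolding x_def y_def by blast+
    have rp: "r0 * R0 = p0 * P0" using g2 xP yR by simp
    have "p1 * P1 = of_real (3 * x)" using sq1 unfolding g1 by simp
    then have p13: "p1 * P1 = 3 * (p0 * P0)" by (simp add: xP)
    have g3': "R0 * P1 = - (P0 * R1)" using arg_cong[OF g3, of cnj] by (simp add: R0_def P1_def P0_def R1_def)
    have "(p0 * P0) * (r1 * R1) = (p0 * P0) * (3 * (p0 * P0))" using g3 g3' rp p13 by algebra
    then have r13: "r1 * R1 = 3 * (p0 * P0)" using nz nz' by simp
    have "(R0 * r1 + P0 * p1) * P1 = 0" using g3' p13 r13 by algebra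
    then have k1: "R0 * r1 = - (P0 * p1)" using nz' by (simp add: eq_neg_iff_add_eq_0)
    have "(r0 * R1 + p0 * P1) * p1 = 0" using g3 p13 r13 by algebra
    then have k2: "r0 * R1 = - (p0 * P1)" using nz by (simp add: eq_neg_iff_add_eq_0)
    have "j * (j * X * p0 * Y / 4) = j * j * X * p0 * Y / 4" for j X Y :: complex by (simp add: mult.assoc)
    then have h2': "a = - C * p0 * P1 / 4" unfolding a_def g6 C_def P1_def by (simp only: i_squared mult_minus_left mult_1)
    have "a' = cnj a" by (simp add: a_def a'_def)
    then have h2: "a' = - C * P0 * p1 / 4" unfolding h2' by (simp add: C_def P0_def P1_def)
    have L: "of_real l = 7 * C * (p0 * P0) / 4" unfolding g4 C_def xP[symmetric] by simp
    have M: "of_real m = - (7 * C * (p0 * P0) / 4)" unfolding g5 C_def xP[symmetric] by simp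
    show ?E
    proof (intro conjI)
      have f1: "u = Y / 2" if "4 * u = 2 * Y" for u Y :: complex
      proof -
        have "2 * (2 * u - Y) = 0" using that by algebra
        then show ?thesis by (simp add: eq_divide_eq mult.commute)
      qed
      have f2: "u = X * (Y + Z / 2)" if "4 * u = 4 * (X * Y) + 2 * (X * Z)" for u X Y Z :: complex
      proof -
        have "u = (2 * (X * Y) + X * Z) / 2" by (rule f1) (use that in simp)
        then show ?thesis by (simp add: algebra_simps add_divide_distrib)
      qed
      show "a' = C * R0 * r1 / 4" using h2 k1 by (simp add: mult.assoc)
      show "a' = - C * P0 * p1 / 4" by (rule h2)
      have "4 * (of_real l * p1 + a' * p0) = 2 * (C * (R0 * (p0 * r1 + p1 * r0) + R1 * (p1 * r1)))"
      proof -
        have "4 * (of_real l * p1 + a' * p0) = 7 * C * (p0 * P0) * p1 - C * P0 * p1 * p0" unfolding L h2 by (simp add: algebra_simps)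
        also have "\<dots> = 2 * (C * (R0 * (p0 * r1 + p1 * r0) + R1 * (p1 * r1)))" using k1 rp r13 by algebra
        finally show ?thesis .
      qed
      then show "of_real l * p1 + a' * p0 = C * (R0 * (p0 * r1 + p1 * r0) + R1 * (p1 * r1)) / 2" by (rule f1)
      have "4 * (of_real l * p0 + a * p1) = 4 * (C * (R0 * (p0 * r0))) + 2 * (C * (R1 * (p0 * r1 + p1 * r0)))"
      proof -
        have "4 * (of_real l * p0 + a * p1) = 7 * C * (p0 * P0) * p0 - C * p0 * P1 * p1" unfolding L h2' by (simp add: algebra_simps)
        also have "\<dots> = 4 * (C * (R0 * (p0 * r0))) + 2 * (C * (R1 * (p0 * r1 + p1 * r0)))" using k2 rp r13 p13 by algebra
        finally show ?thesis .
      qed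
      then show "of_real l * p0 + a * p1 = C * (R0 * (p0 * r0) + R1 * (p0 * r1 + p1 * r0) / 2)" by (rule f2)
      have "4 * (of_real m * r1 + a' * r0) = 2 * (- C * (P0 * (r0 * p1 + r1 * p0) + P1 * (r1 * p1)))"
      proof -
        have "4 * (of_real m * r1 + a' * r0) = - 7 * C * (p0 * P0) * r1 - C * P0 * p1 * r0" unfolding M h2 by (simp add: algebra_simps)
        also have "\<dots> = 2 * (- C * (P0 * (r0 * p1 + r1 * p0) + P1 * (r1 * p1)))" using g3 p13 by algebra
        finally show ?thesis .
      qed
      then show "of_real m * r1 + a' * r0 = - C * (P0 * (r0 * p1 + r1 * p0) + P1 * (r1 * p1)) / 2" by (rule f1)
      have "4 * (of_real m * r0 + a * r1) = 4 * (- C * (P0 * (r0 * p0))) + 2 * (- C * (P1 * (r0 * p1 + r1 * p0)))"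
      proof -
        have "4 * (of_real m * r0 + a * r1) = - 7 * C * (p0 * P0) * r0 - C * p0 * P1 * r1" unfolding M h2' by (simp add: algebra_simps)
        also have "\<dots> = 4 * (- C * (P0 * (r0 * p0))) + 2 * (- C * (P1 * (r0 * p1 + r1 * p0)))" using g3 p13 by algebra
        finally show ?thesis .
      qed
      then show "of_real m * r0 + a * r1 = - C * (P0 * (r0 * p0) + P1 * (r0 * p1 + r1 * p0) / 2)" by (rule f2)
    qed
  qed
  finally show ?thesis .
qed

lemma monomial_equation_iff:
  assumes "a \<noteq> 0" "b \<noteq> 0"
  shows "poly_advect l 0 (monom a n) = smult (of_real c) (cubic_poly (monom a n * monom b m) (monom b m)) \<longleftrightarrow>
    l = c * (cmod b)\<^sup>2 * (fact (n + m) / (fact n * 2 ^ (n + m)))"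
proof -
  have cubic_poly: "cubic_poly (monom a n * monom b m) (monom b m) = monom (cnj b * (a * b) * (fact (n + m) / (fact n * 2 ^ (n + m)))) n"
  proof (rule poly_eqI)
    fix i
    have "coeff (cubic_poly (monom a n * monom b m) (monom b m)) i = (\<Sum>k\<le>m. if k = m then cnj b * coeff (monom (a * b) (n + m)) (i + m) * (fact (i + m) / (fact i * 2 ^ (i + m))) else 0)"
      unfolding coeff_cubic_poly mult_monom using assms by (intro sum.cong) (auto simp: degree_monom_eq)
    also have "\<dots> = coeff (monom (cnj b * (a * b) * (fact (n + m) / (fact n * 2 ^ (n + m)))) n) i"
      by simp
    finally show "coeff (cubic_poly (monom a n * monom b m) (monom b m)) i = coeff (monom (cnj b * (a * b) * (fact (n + m) / (fact n * 2 ^ (n + m)))) n) i" .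
  qed
  define F where "F = fact (n + m) / (fact n * 2 ^ (n + m) :: real)"
  have "poly_advect l 0 (monom a n) = smult (of_real c) (cubic_poly (monom a n * monom b m) (monom b m)) \<longleftrightarrow>
    of_real l * a = of_real c * (cnj b * (a * b) * of_real F)"
    unfolding cubic_poly poly_advect_def by (simp add: smult_monom monom_eq_iff F_def)
  also have "of_real c * (cnj b * (a * b) * of_real F) = of_real (c * (cmod b)\<^sup>2 * F) * a"
    unfolding of_real_mult complex_norm_square by (simp only: mult_ac)
  also have "of_real l * a = of_real (c * (cmod b)\<^sup>2 * F) * a \<longleftrightarrow> l = c * (cmod b)\<^sup>2 * F"
    using assms(1) by (simp only: mult_cancel_right of_real_eq_iff simp_thms)
  finally show ?thesis unfolding F_def .
qed

text \<open>
  For \<open>\<alpha> \<noteq> 0\<close> both polynomials are a power of \<open>x\<close> times a linear factor.  If \<open>n\<close> and \<open>k\<close> are those powers,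
  a positive one gives \<open>(n + k + 2) * (n + k + 1) = 4 * ((n + 2) * (n + 1))\<close> or the same with \<open>n\<close> and \<open>k\<close>
  exchanged.  These equations admit no solution in which \<open>n\<close> or \<open>k\<close> is positive, so only the linear case
  remains.
\<close>

lemma polynomial_system_iff:
  fixes c :: real
  assumes c: "c > 0" and nz: "p \<noteq> 0" "r \<noteq> 0"
  shows "poly_advect l \<alpha> p = smult (of_real c) (cubic_poly (p * r) r) \<and> poly_advect m \<alpha> r = - smult (of_real c) (cubic_poly (r * p) p) \<longleftrightarrow>
    (\<exists>a b n1 n2. a \<noteq> 0 \<and> b \<noteq> 0 \<and> p = monom a n1 \<and> r = monom b n2 \<and> \<alpha> = 0 \<and>
       l = c * (cmod b)\<^sup>2 * (fact (n1 + n2) / (fact n1 * 2 ^ (n1 + n2))) \<and>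
       m = - (c * (cmod a)\<^sup>2 * (fact (n1 + n2) / (fact n2 * 2 ^ (n1 + n2))))) \<or>
    (\<exists>p0 p1 r0 r1. p0 \<noteq> 0 \<and> p1 \<noteq> 0 \<and> r0 \<noteq> 0 \<and> r1 \<noteq> 0 \<and> p = [:p0, p1:] \<and> r = [:r0, r1:] \<and>
       (cmod p1)\<^sup>2 = 3 * (cmod p0)\<^sup>2 \<and> (cmod r0)\<^sup>2 = (cmod p0)\<^sup>2 \<and> r0 * p1 = - (p0 * r1) \<and>
       l = 7 * c * (cmod p0)\<^sup>2 / 4 \<and> m = - (7 * c * (cmod p0)\<^sup>2 / 4) \<and> \<alpha> = \<i> * of_real c * p0 * cnj p1 / 4)"
    (is "?L \<longleftrightarrow> ?M \<or> ?T")
proof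
  assume ?L
  then have e1: "poly_advect l \<alpha> p = smult (of_real c) (cubic_poly (p * r) r)" and e2: "poly_advect m \<alpha> r = smult (of_real (- c)) (cubic_poly (r * p) p)"
    by simp_all
  have c1: "complex_of_real c \<noteq> 0" "complex_of_real (- c) \<noteq> 0" using c by simp_all
  show "?M \<or> ?T"
  proof (cases "\<alpha> = 0")
    case True
    define a b n1 n2 where "a = lead_coeff p" and "b = lead_coeff r" and "n1 = degree p" and "n2 = degree r"
    have p: "p = monom a n1" using partner_monomial[of m r "of_real (- c)" p] e2 c1 nz True unfolding a_def n1_def by simp
    have r: "r = monom b n2" using partner_monomial[of l p "of_real c" r] e1 c1 nz True unfolding b_def n2_def by simp
    have ab: "a \<noteq> 0" "b \<noteq> 0" using nz by (simp_all add: a_def b_def)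
    have "l = c * (cmod b)\<^sup>2 * (fact (n1 + n2) / (fact n1 * 2 ^ (n1 + n2)))"
      using e1 unfolding True p r monomial_equation_iff[OF ab] .
    moreover have "m = - c * (cmod a)\<^sup>2 * (fact (n2 + n1) / (fact n2 * 2 ^ (n2 + n1)))"
      using e2 unfolding True p r monomial_equation_iff[OF ab(2) ab(1)] .
    ultimately show ?thesis using p r ab True by (intro disjI1 exI[of _ a] exI[of _ b] exI[of _ n1] exI[of _ n2]) (simp add: add.commute)
  next
    case False
    obtain n p0 p1 where p: "p = monom 1 n * [:p0, p1:]" "p0 \<noteq> 0" "p1 \<noteq> 0" using partner_two_terms[OF e2 c1(2) nz(2) nz(1) False] by blast
    obtain k r0 r1 where r: "r = monom 1 k * [:r0, r1:]" "r0 \<noteq> 0" "r1 \<noteq> 0" using partner_two_terms[OF e1 c1(1) nz False] by blast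
    have n: "n > 0 \<Longrightarrow> (n + k + 2) * (n + k + 1) = 4 * ((n + 2) * (n + 1))"
      by (rule top_and_bottom[OF e1 _ p(1) r(1) p(2,3) r(2,3)]) (use c in auto)
    have k: "k > 0 \<Longrightarrow> (k + n + 2) * (k + n + 1) = 4 * ((k + 2) * (k + 1))"
      by (rule top_and_bottom[OF e2 _ r(1) p(1) r(2,3) p(2,3)]) (use c in auto)
    have "n = 0 \<and> k = 0"
    proof (rule ccontr)
      assume *: "\<not> (n = 0 \<and> k = 0)"
      consider "n > 0" "k = 0" | "n = 0" "k > 0" | "n > 0" "k > 0" using * by auto
      then show False
      proof cases
        case 3
        then have "(n + 2) * (n + 1) = (k + 2) * (k + 1)" using n k by (simp add: add.commute)
        then have "n = k"
        proof (cases n k rule: linorder_cases)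
          case less
          then have "(n + 2) * (n + 1) < (k + 2) * (k + 1)" by (intro mult_strict_mono) auto
          with \<open>(n + 2) * (n + 1) = (k + 2) * (k + 1)\<close> show ?thesis by simp
        next
          case greater
          then have "(k + 2) * (k + 1) < (n + 2) * (n + 1)" by (intro mult_strict_mono) auto
          with \<open>(n + 2) * (n + 1) = (k + 2) * (k + 1)\<close> show ?thesis by simp
        qed
        with n[OF 3(1)] show False by (simp add: algebra_simps)
      qed (use n k in auto)
    qed
    then have p': "p = [:p0, p1:]" and r': "r = [:r0, r1:]" using p(1) r(1) by (simp_all add: monom_0 one_pCons[symmetric])
    have e2': "poly_advect m \<alpha> r = - smult (of_real c) (cubic_poly (r * p) p)" using e2 by simp
    show ?thesis
      using linear_system[OF c p(2,3) r(2,3), of l \<alpha> m, THEN iffD1, OF conjI, OF e1[unfolded p' r'] e2'[unfolded p' r']] p' r' p r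
      by blast
  qed
next
  assume "?M \<or> ?T"
  then show ?L
  proof
    assume ?M
    then obtain a b n1 n2 where ab: "a \<noteq> 0" "b \<noteq> 0" and p: "p = monom a n1" and r: "r = monom b n2" and \<alpha>: "\<alpha> = 0"
       and l: "l = c * (cmod b)\<^sup>2 * (fact (n1 + n2) / (fact n1 * 2 ^ (n1 + n2)))"
       and m: "m = - (c * (cmod a)\<^sup>2 * (fact (n1 + n2) / (fact n2 * 2 ^ (n1 + n2))))" by blast
    have "poly_advect m 0 (monom b n2) = smult (of_real (- c)) (cubic_poly (monom b n2 * monom a n1) (monom a n1))"
      unfolding monomial_equation_iff[OF ab(2) ab(1)] m by (simp add: add.commute)
    then show ?L unfolding p r \<alpha> monomial_equation_iff[OF ab] using l by simp
  next
    assume ?T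
    then show ?L using linear_system[OF c] by blast
  qed
qed

section \<open>Classification of the progressive waves\<close>

text \<open>
  The constant of \<open>phi n \<gamma>\<close> with its factor \<open>exp (- |\<gamma>|\<^sup>2 / 2)\<close> included, so that \<open>phi n \<gamma>\<close> is the Fock
  function of a profile centred at \<open>cnj \<gamma>\<close>.
\<close>

definition phi_coeff :: "complex \<Rightarrow> nat \<Rightarrow> real" where
  "phi_coeff \<gamma> n = exp (- (cmod \<gamma>)\<^sup>2 / 2) / sqrt (pi * fact n)"

lemma phi_coeff_pos: "phi_coeff \<gamma> n > 0"
  by (simp add: phi_coeff_def)

lemma phi_coeff_sq: "(phi_coeff \<gamma> n)\<^sup>2 = exp (- (cmod \<gamma>)\<^sup>2) / (pi * fact n)"
  by (simp add: phi_coeff_def power_divide exp_double[symmetric])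

lemma phi_coeff_1: "phi_coeff \<gamma> 1 = phi_coeff \<gamma> 0"
  by (simp add: phi_coeff_def)

lemma phi_eq: "phi n \<gamma> z = exp (- complex_of_real ((cmod z)\<^sup>2 / 2)) * (of_real (phi_coeff \<gamma> n) * (z - cnj \<gamma>) ^ n * exp (\<gamma> * z))"
proof -
  have "exp (- complex_of_real ((cmod z)\<^sup>2 / 2) - complex_of_real ((cmod \<gamma>)\<^sup>2 / 2) + \<gamma> * z)
    = exp (- complex_of_real ((cmod z)\<^sup>2 / 2)) * of_real (exp (- (cmod \<gamma>)\<^sup>2 / 2)) * exp (\<gamma> * z)"
    unfolding exp_of_real[symmetric] exp_add[symmetric] by (rule arg_cong[where f = exp]) simp
  moreover have "of_real (phi_coeff \<gamma> n) = complex_of_real (1 / sqrt (pi * fact n)) * of_real (exp (- (cmod \<gamma>)\<^sup>2 / 2))"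
    unfolding phi_coeff_def of_real_mult[symmetric] by simp
  ultimately show ?thesis unfolding phi_def by (simp only: mult_ac)
qed

lemma fock_monom: "fock (wave 1 (monom (a * of_real (phi_coeff \<gamma> n)) n) \<gamma>) z = a * phi n \<gamma> z"
  unfolding fock_def wave_def phi_eq poly_monom by (simp only: mult_ac mult_1)

lemma fock_linear:
  assumes p0: "p0 = w / 2 * of_real (phi_coeff \<gamma> 0)" and p1: "p1 = of_real (sqrt 3) * \<i> * e * p0"
  shows "fock (wave 1 [:p0, p1:] \<gamma>) z = w * (1 / 2 * phi 0 \<gamma> z + of_real (sqrt 3 / 2) * \<i> * e * phi 1 \<gamma> z)"
proof -
  have p: "poly [:p0, p1:] x = w * of_real (phi_coeff \<gamma> 0) * (1 / 2 + of_real (sqrt 3 / 2) * \<i> * e * x)" for x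
    unfolding p1 p0 by (simp add: algebra_simps)
  have "E * (1 * (w * s * (h + T * i * e * y)) * X) = w * (h * (E * (s * 1 * X)) + T * i * e * (E * (s * y * X)))"
    for E s h T i y X :: complex by algebra
  then show ?thesis unfolding fock_def wave_def phi_eq phi_coeff_1 p power_0 power_one_right by blast
qed

lemma bargmann_fock_polynomial_form:
  assumes U: "U \<in> bargmann_fock" and fin: "finite {z. U z = 0}"
  obtains f P a b where "f holomorphic_on UNIV" "U = fock f" "P \<noteq> 0" "cmod a < 1 / 2" "\<And>z. f z = poly P z * exp (a * z\<^sup>2 + b * z)"
proof -
  obtain f where f: "f holomorphic_on UNIV" and Uf: "\<And>z. U z = exp (- complex_of_real ((cmod z)\<^sup>2 / 2)) * f z"
    and int: "integrable lborel (\<lambda>z. (cmod (U z))\<^sup>2)"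
    using U unfolding bargmann_fock_def by blast
  have "{z. f z = 0} = {z. U z = 0}" by (simp add: Uf)
  with fin have fin': "finite {z. f z = 0}" by simp
  from fock_finite_zeros[OF f int[unfolded Uf] fin'] obtain P a b where "P \<noteq> 0" "cmod a < 1 / 2" "\<forall>z. f z = poly P z * exp (a * z\<^sup>2 + b * z)"
    by blast
  moreover have "U = fock f" by (simp add: fun_eq_iff Uf fock_def)
  ultimately show ?thesis using that f by blast
qed

lemma progressive_wave_polynomial_form:
  assumes "U \<in> bargmann_fock" and "V \<in> bargmann_fock"
    and "finite {z. U z = 0}" and "finite {z. V z = 0}" and prog: "progressive_wave_initial U V lam mu \<alpha>"
  obtains p r \<gamma> where "p \<noteq> 0" "r \<noteq> 0" "U = fock (wave 1 p \<gamma>)" "V = fock (wave 1 r \<gamma>)"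
proof -
  obtain f P a b where f: "f holomorphic_on UNIV" "U = fock f" "P \<noteq> 0" "cmod a < 1 / 2" "\<And>z. f z = poly P z * exp (a * z\<^sup>2 + b * z)"
    using bargmann_fock_polynomial_form[OF assms(1,3)] by metis
  obtain g R c d where g: "g holomorphic_on UNIV" "V = fock g" "R \<noteq> 0" "cmod c < 1 / 2" "\<And>z. g z = poly R z * exp (c * z\<^sup>2 + d * z)"
    using bargmann_fock_polynomial_form[OF assms(2,4)] by metis
  have "\<forall>z. advect lam \<alpha> f z = cubic g f z \<and> advect mu \<alpha> g z = - cubic f g z"
    using prog unfolding f(2) g(2) progressive_wave_iff[OF f(1) g(1)] by (metis shifted_0)
  then have "a = 0" "c = 0" "b = d"
    using exponents_trivial[of f P a b g R c d lam \<alpha> mu] f(3-5) g(3-5) by auto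
  then have "f = wave 1 (pcompose P [:cnj d, 1:]) d" "g = wave 1 (pcompose R [:cnj d, 1:]) d"
    by (auto simp: fun_eq_iff wave_def f(5) g(5) poly_pcompose)
  moreover have "pcompose P [:cnj d, 1:] \<noteq> 0" "pcompose R [:cnj d, 1:] \<noteq> 0"
    using f(3) g(3) by (simp_all add: pcompose_eq_0_iff)
  ultimately show ?thesis using that f(2) g(2) by metis
qed

lemma polar_form:
  fixes a :: complex and s :: real assumes "a \<noteq> 0" "s > 0"
  obtains A \<theta> where "A > 0" "a = of_real A * exp (\<i> * of_real \<theta>) * of_real s"
proof
  show "cmod a / s > 0" using assms by simp
  have "a = of_real (cmod a) * exp (\<i> * of_real (Arg a))" by (rule Arg_eq[OF assms(1)])
  then show "a = of_real (cmod a / s) * exp (\<i> * of_real (Arg a)) * of_real s" using assms(2) by simp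
qed

lemma monomial_constant:
  "exp ((cmod \<gamma>)\<^sup>2) / 2 * (cmod (of_real B * exp (\<i> * of_real \<theta>) * of_real (phi_coeff \<gamma> n2)))\<^sup>2 * (fact (n1 + n2) / (fact n1 * 2 ^ (n1 + n2)))
    = fact (n1 + n2) / (2 ^ (n1 + n2 + 1) * pi * fact n1 * fact n2) * B\<^sup>2"
proof -
  have "(cmod (of_real B * exp (\<i> * of_real \<theta>) * of_real (phi_coeff \<gamma> n2)))\<^sup>2 = B\<^sup>2 * (phi_coeff \<gamma> n2)\<^sup>2"
    by (simp add: norm_mult power_mult_distrib)
  moreover have "exp ((cmod \<gamma>)\<^sup>2) * (phi_coeff \<gamma> n2)\<^sup>2 = 1 / (pi * fact n2)"
    unfolding phi_coeff_sq by (simp add: exp_minus)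
  ultimately have "exp ((cmod \<gamma>)\<^sup>2) / 2 * (cmod (of_real B * exp (\<i> * of_real \<theta>) * of_real (phi_coeff \<gamma> n2)))\<^sup>2 = B\<^sup>2 / (2 * (pi * fact n2))"
    by (simp add: mult.left_commute)
  then show ?thesis by (simp add: mult_ac)
qed

lemma linear_constants:
  fixes K :: real
  assumes p0: "p0 = of_real K * exp (\<i> * of_real \<theta>1) / 2 * of_real (phi_coeff \<gamma> 0)"
    and p1: "p1 = of_real (sqrt 3) * \<i> * exp (\<i> * of_real \<theta>) * p0"
  shows "7 * (exp ((cmod \<gamma>)\<^sup>2) / 2) * (cmod p0)\<^sup>2 / 4 = 7 * K\<^sup>2 / (32 * pi)"
    and "\<i> * of_real (exp ((cmod \<gamma>)\<^sup>2) / 2) * p0 * cnj p1 / 4 = of_real (sqrt 3 / (32 * pi) * K\<^sup>2) * exp (- \<i> * of_real \<theta>)"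
    and "(cmod p1)\<^sup>2 = 3 * (cmod p0)\<^sup>2"
    and "(cmod p0)\<^sup>2 = K\<^sup>2 * (phi_coeff \<gamma> 0)\<^sup>2 / 4"
proof -
  show n0: "(cmod p0)\<^sup>2 = K\<^sup>2 * (phi_coeff \<gamma> 0)\<^sup>2 / 4"
    unfolding p0 by (simp add: norm_mult norm_divide power_mult_distrib power_divide)
  have e: "exp ((cmod \<gamma>)\<^sup>2) * (phi_coeff \<gamma> 0)\<^sup>2 = 1 / pi"
    unfolding phi_coeff_sq by (simp add: exp_minus)
  have x: "exp ((cmod \<gamma>)\<^sup>2) * (cmod p0)\<^sup>2 = K\<^sup>2 / (4 * pi)"
  proof -
    have "exp ((cmod \<gamma>)\<^sup>2) * (cmod p0)\<^sup>2 = K\<^sup>2 / 4 * (exp ((cmod \<gamma>)\<^sup>2) * (phi_coeff \<gamma> 0)\<^sup>2)" unfolding n0 by simp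
    also have "\<dots> = K\<^sup>2 / (4 * pi)" unfolding e by simp
    finally show ?thesis .
  qed
  have "7 * (exp ((cmod \<gamma>)\<^sup>2) / 2) * (cmod p0)\<^sup>2 / 4 = 7 / 8 * (exp ((cmod \<gamma>)\<^sup>2) * (cmod p0)\<^sup>2)" by simp
  then show "7 * (exp ((cmod \<gamma>)\<^sup>2) / 2) * (cmod p0)\<^sup>2 / 4 = 7 * K\<^sup>2 / (32 * pi)" unfolding x by simp
  show "(cmod p1)\<^sup>2 = 3 * (cmod p0)\<^sup>2"
    unfolding p1 by (simp add: norm_mult power_mult_distrib)
  have c: "cnj p1 = - of_real (sqrt 3) * \<i> * exp (- \<i> * of_real \<theta>) * cnj p0"
    unfolding p1 by (simp add: exp_cnj)
  have "\<i> * of_real (exp ((cmod \<gamma>)\<^sup>2) / 2) * p0 * cnj p1 / 4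
    = - (\<i> * \<i>) * of_real (sqrt 3) / 8 * (of_real (exp ((cmod \<gamma>)\<^sup>2)) * (p0 * cnj p0)) * exp (- \<i> * of_real \<theta>)"
  proof -
    have "j * (E / 2) * p0 * (- t * j * X * P) / 4 = - (j * j) * t / 8 * (E * (p0 * P)) * X" for j E t X P :: complex
      by (simp add: field_simps)
    then show ?thesis unfolding c of_real_divide of_real_numeral by blast
  qed
  also have "p0 * cnj p0 = of_real ((cmod p0)\<^sup>2)" by (rule complex_norm_square[symmetric])
  also have "of_real (exp ((cmod \<gamma>)\<^sup>2)) * of_real ((cmod p0)\<^sup>2) = complex_of_real (K\<^sup>2 / (4 * pi))"
    unfolding of_real_mult[symmetric] x ..
  also have "- (\<i> * \<i>) * of_real (sqrt 3) / 8 * complex_of_real (K\<^sup>2 / (4 * pi)) = of_real (sqrt 3 / (32 * pi) * K\<^sup>2)" by simp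
  finally show "\<i> * of_real (exp ((cmod \<gamma>)\<^sup>2) / 2) * p0 * cnj p1 / 4 = of_real (sqrt 3 / (32 * pi) * K\<^sup>2) * exp (- \<i> * of_real \<theta>)" .
qed

text \<open>
  Recentring the profile at \<open>cnj \<gamma>\<close> shifts both frequencies by \<open>2 * Im (\<alpha> * \<gamma>)\<close>; this is where the
  imaginary part in the formulas for \<open>lam\<close> and \<open>mu\<close> comes from.
\<close>

lemma galilean_shift:
  fixes K :: real
  assumes "\<alpha> = of_real (sqrt 3 / (32 * pi) * K\<^sup>2) * e"
  shows "l - 2 * Im (\<alpha> * \<gamma>) = x * K\<^sup>2 / (32 * pi) \<longleftrightarrow> l = K\<^sup>2 / (32 * pi) * (x + 2 * sqrt 3 * Im (\<gamma> * e))"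
proof -
  have "\<alpha> * \<gamma> = of_real (sqrt 3 / (32 * pi) * K\<^sup>2) * (\<gamma> * e)" unfolding assms by (simp only: mult_ac)
  then have "Im (\<alpha> * \<gamma>) = sqrt 3 / (32 * pi) * K\<^sup>2 * Im (\<gamma> * e)"
    by (simp only: times_complex.sel(2)[of "of_real _"] Re_complex_of_real Im_complex_of_real mult_zero_left add_0_right)
  then have "2 * Im (\<alpha> * \<gamma>) = K\<^sup>2 / (32 * pi) * (2 * sqrt 3 * Im (\<gamma> * e))" by simp
  moreover have "K\<^sup>2 / (32 * pi) * (x + 2 * sqrt 3 * Im (\<gamma> * e)) = x * K\<^sup>2 / (32 * pi) + K\<^sup>2 / (32 * pi) * (2 * sqrt 3 * Im (\<gamma> * e))"
    by (simp add: distrib_left)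
  ultimately show ?thesis by linarith
qed

theorem theorem1p6:
  fixes U V :: "complex \<Rightarrow> complex" and lam mu :: real and \<alpha> :: complex
  assumes "U \<in> bargmann_fock" and "V \<in> bargmann_fock"
    and "finite {z. U z = 0}" and "finite {z. V z = 0}"
  shows "progressive_wave_initial U V lam mu \<alpha> \<longleftrightarrow>
    (\<exists>(A::real) (B::real) (n1::nat) (n2::nat) (\<theta>1::real) (\<theta>2::real) (\<gamma>::complex).
        A > 0 \<and> B > 0 \<and>
        (\<forall>z. U z = complex_of_real A * exp (\<i> * complex_of_real \<theta>1) * phi n1 \<gamma> z) \<and>
        (\<forall>z. V z = complex_of_real B * exp (\<i> * complex_of_real \<theta>2) * phi n2 \<gamma> z) \<and>
        \<alpha> = 0 \<and>
        lam = fact (n1 + n2) / (2 ^ (n1 + n2 + 1) * pi * fact n1 * fact n2) * B\<^sup>2 \<and>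
        mu = - (fact (n1 + n2) / (2 ^ (n1 + n2 + 1) * pi * fact n1 * fact n2) * A\<^sup>2)) \<or>
    (\<exists>(K::real) (\<theta>::real) (\<theta>1::real) (\<theta>2::real) (\<gamma>::complex).
        K > 0 \<and>
        (\<forall>z. U z = complex_of_real K * exp (\<i> * complex_of_real \<theta>1) *
                 (1 / 2 * phi 0 \<gamma> z +
                  complex_of_real (sqrt 3 / 2) * \<i> * exp (\<i> * complex_of_real \<theta>) * phi 1 \<gamma> z)) \<and>
        (\<forall>z. V z = complex_of_real K * exp (\<i> * complex_of_real \<theta>2) *
                 (1 / 2 * phi 0 \<gamma> z -
                  complex_of_real (sqrt 3 / 2) * \<i> * exp (\<i> * complex_of_real \<theta>) * phi 1 \<gamma> z)) \<and>
        lam = K\<^sup>2 / (32 * pi) * (7 + 2 * sqrt 3 * Im (\<gamma> * exp (- \<i> * complex_of_real \<theta>))) \<and>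
        mu = K\<^sup>2 / (32 * pi) * (- 7 + 2 * sqrt 3 * Im (\<gamma> * exp (- \<i> * complex_of_real \<theta>))) \<and>
        \<alpha> = complex_of_real (sqrt 3 / (32 * pi) * K\<^sup>2) * exp (- \<i> * complex_of_real \<theta>))"
    (is "?W \<longleftrightarrow> ?I \<or> ?II")
proof
  assume W: ?W
  obtain p r \<gamma> where nz: "p \<noteq> 0" "r \<noteq> 0" and U: "U = fock (wave 1 p \<gamma>)" and V: "V = fock (wave 1 r \<gamma>)"
    using progressive_wave_polynomial_form[OF assms W] by metis
  define c where "c = exp ((cmod \<gamma>)\<^sup>2) / 2"
  have c: "c > 0" by (simp add: c_def)
  define l where "l = lam - 2 * Im (\<alpha> * \<gamma>)"
  define m where "m = mu - 2 * Im (\<alpha> * \<gamma>)"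
  have "poly_advect l \<alpha> p = smult (of_real c) (cubic_poly (p * r) r) \<and> poly_advect m \<alpha> r = - smult (of_real c) (cubic_poly (r * p) p)"
    using W unfolding U V progressive_wave_polynomials_iff l_def m_def c_def .
  then consider (mono) a b n1 n2 where "a \<noteq> 0" "b \<noteq> 0" "p = monom a n1" "r = monom b n2" "\<alpha> = 0"
       "l = c * (cmod b)\<^sup>2 * (fact (n1 + n2) / (fact n1 * 2 ^ (n1 + n2)))"
       "m = - (c * (cmod a)\<^sup>2 * (fact (n1 + n2) / (fact n2 * 2 ^ (n1 + n2))))"
    | (lin) p0 p1 r0 r1 where "p0 \<noteq> 0" "p1 \<noteq> 0" "r0 \<noteq> 0" "r1 \<noteq> 0" "p = [:p0, p1:]" "r = [:r0, r1:]"
       "(cmod p1)\<^sup>2 = 3 * (cmod p0)\<^sup>2" "(cmod r0)\<^sup>2 = (cmod p0)\<^sup>2" "r0 * p1 = - (p0 * r1)"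
       "l = 7 * c * (cmod p0)\<^sup>2 / 4" "m = - (7 * c * (cmod p0)\<^sup>2 / 4)" "\<alpha> = \<i> * of_real c * p0 * cnj p1 / 4"
    unfolding polynomial_system_iff[OF c nz] by blast
  then show "?I \<or> ?II"
  proof cases
    case mono
    obtain A \<theta>1 where A: "A > 0" "a = of_real A * exp (\<i> * of_real \<theta>1) * of_real (phi_coeff \<gamma> n1)"
      using polar_form[OF mono(1) phi_coeff_pos] by metis
    obtain B \<theta>2 where B: "B > 0" "b = of_real B * exp (\<i> * of_real \<theta>2) * of_real (phi_coeff \<gamma> n2)"
      using polar_form[OF mono(2) phi_coeff_pos] by metis
    have "\<forall>z. U z = of_real A * exp (\<i> * of_real \<theta>1) * phi n1 \<gamma> z" "\<forall>z. V z = of_real B * exp (\<i> * of_real \<theta>2) * phi n2 \<gamma> z"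
      unfolding U V mono(3,4) A(2) B(2) fock_monom by blast+
    moreover have "lam = fact (n1 + n2) / (2 ^ (n1 + n2 + 1) * pi * fact n1 * fact n2) * B\<^sup>2"
      using mono(6) unfolding l_def mono(5) c_def B(2) monomial_constant by simp
    moreover have "mu = - (fact (n1 + n2) / (2 ^ (n1 + n2 + 1) * pi * fact n1 * fact n2) * A\<^sup>2)"
      using mono(7) monomial_constant[of \<gamma> A \<theta>1 n1 n2] unfolding m_def mono(5) c_def A(2) by (simp add: add.commute mult_ac)
    ultimately show ?thesis using A(1) B(1) mono(5) by blast
  next
    case lin
    define s where "s = phi_coeff \<gamma> 0"
    have s: "s > 0" unfolding s_def by (rule phi_coeff_pos)
    obtain K \<theta>1 where K: "K > 0" and p0': "p0 = of_real K * exp (\<i> * of_real \<theta>1) * of_real (s / 2)"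
      using polar_form[OF lin(1), of "s / 2"] s by auto
    then have p0: "p0 = of_real K * exp (\<i> * of_real \<theta>1) / 2 * of_real (phi_coeff \<gamma> 0)" by (simp add: s_def)
    obtain K' \<theta>2 where K': "K' > 0" and r0': "r0 = of_real K' * exp (\<i> * of_real \<theta>2) * of_real (s / 2)"
      using polar_form[OF lin(3), of "s / 2"] s by auto
    have "cmod p0 = K * (s / 2)" "cmod r0 = K' * (s / 2)"
      unfolding p0' r0' using K K' s by (simp_all add: norm_mult)
    moreover have "cmod r0 = cmod p0" using lin(8) by (simp add: power2_eq_iff_nonneg)
    ultimately have "K' = K" using s by simp
    then have r0: "r0 = of_real K * exp (\<i> * of_real \<theta>2) / 2 * of_real (phi_coeff \<gamma> 0)" using r0' by (simp add: s_def)
    (* this quotient is unimodular; its argument is the angle theta of the statement *)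
    define u where "u = p1 / (of_real (sqrt 3) * \<i> * p0)"
    have "(cmod u)\<^sup>2 = 1" unfolding u_def using lin(1,7) by (simp add: norm_divide norm_mult power_divide power_mult_distrib)
    then have "cmod u = 1" using norm_ge_zero[of u] by (simp add: power2_eq_1_iff)
    then obtain \<theta> where \<theta>: "u = exp (\<i> * of_real \<theta>)" using complex_unimodular_polar[of u] by (metis Arg_eq mult_1 norm_zero of_real_1 zero_neq_one)
    have p1: "p1 = of_real (sqrt 3) * \<i> * exp (\<i> * of_real \<theta>) * p0"
      unfolding \<theta>[symmetric] u_def using lin(1) by simp
    have "p0 * r1 = p0 * (of_real (sqrt 3) * \<i> * - exp (\<i> * of_real \<theta>) * r0)"
      using lin(9) unfolding p1 by (simp add: mult_ac minus_equation_iff[of "p0 * r1"])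
    then have r1: "r1 = of_real (sqrt 3) * \<i> * - exp (\<i> * of_real \<theta>) * r0"
      using lin(1) by (simp only: mult_cancel_left simp_thms)
    have \<alpha>: "\<alpha> = of_real (sqrt 3 / (32 * pi) * K\<^sup>2) * exp (- \<i> * of_real \<theta>)"
      unfolding lin(12) c_def by (rule linear_constants(2)[OF p0 p1])
    have l: "l = 7 * K\<^sup>2 / (32 * pi)" unfolding lin(10) c_def by (rule linear_constants(1)[OF p0 p1])
    have m: "m = - 7 * K\<^sup>2 / (32 * pi)" unfolding lin(11) c_def linear_constants(1)[OF p0 p1] by simp
    have "\<forall>z. U z = of_real K * exp (\<i> * of_real \<theta>1) * (1 / 2 * phi 0 \<gamma> z + of_real (sqrt 3 / 2) * \<i> * exp (\<i> * of_real \<theta>) * phi 1 \<gamma> z)"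
      unfolding U lin(5) fock_linear[OF p0 p1] by blast
    moreover have "\<forall>z. V z = of_real K * exp (\<i> * of_real \<theta>2) * (1 / 2 * phi 0 \<gamma> z - of_real (sqrt 3 / 2) * \<i> * exp (\<i> * of_real \<theta>) * phi 1 \<gamma> z)"
      unfolding V lin(6) fock_linear[OF r0 r1] by simp
    moreover have "lam = K\<^sup>2 / (32 * pi) * (7 + 2 * sqrt 3 * Im (\<gamma> * exp (- \<i> * of_real \<theta>)))"
      using l unfolding l_def galilean_shift[OF \<alpha>] .
    moreover have "mu = K\<^sup>2 / (32 * pi) * (- 7 + 2 * sqrt 3 * Im (\<gamma> * exp (- \<i> * of_real \<theta>)))"
      using m unfolding m_def galilean_shift[OF \<alpha>] .
    ultimately show ?thesis using K \<alpha> by blast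
  qed
next
  assume "?I \<or> ?II"
  then show ?W
  proof
    assume ?I
    then obtain A B n1 n2 \<theta>1 \<theta>2 \<gamma> where A: "A > 0" and B: "B > 0"
      and U: "\<And>z. U z = of_real A * exp (\<i> * of_real \<theta>1) * phi n1 \<gamma> z"
      and V: "\<And>z. V z = of_real B * exp (\<i> * of_real \<theta>2) * phi n2 \<gamma> z" and \<alpha>: "\<alpha> = 0"
      and lam: "lam = fact (n1 + n2) / (2 ^ (n1 + n2 + 1) * pi * fact n1 * fact n2) * B\<^sup>2"
      and mu: "mu = - (fact (n1 + n2) / (2 ^ (n1 + n2 + 1) * pi * fact n1 * fact n2) * A\<^sup>2)" by blast
    define a where "a = of_real A * exp (\<i> * of_real \<theta>1) * complex_of_real (phi_coeff \<gamma> n1)"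
    define b where "b = of_real B * exp (\<i> * of_real \<theta>2) * complex_of_real (phi_coeff \<gamma> n2)"
    have ab: "a \<noteq> 0" "b \<noteq> 0" using A B phi_coeff_pos[of \<gamma> n1] phi_coeff_pos[of \<gamma> n2] by (simp_all add: a_def b_def)
    have Uw: "U = fock (wave 1 (monom a n1) \<gamma>)" and Vw: "V = fock (wave 1 (monom b n2) \<gamma>)"
      by (simp_all add: fun_eq_iff U V a_def b_def fock_monom)
    have l: "lam - 2 * Im (\<alpha> * \<gamma>) = exp ((cmod \<gamma>)\<^sup>2) / 2 * (cmod b)\<^sup>2 * (fact (n1 + n2) / (fact n1 * 2 ^ (n1 + n2)))"
      unfolding b_def monomial_constant lam \<alpha> by simp
    have m: "mu - 2 * Im (\<alpha> * \<gamma>) = - (exp ((cmod \<gamma>)\<^sup>2) / 2 * (cmod a)\<^sup>2 * (fact (n1 + n2) / (fact n2 * 2 ^ (n1 + n2))))"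
      using monomial_constant[of \<gamma> A \<theta>1 n1 n2] unfolding a_def mu \<alpha> by (simp add: add.commute mult_ac)
    have nz: "monom a n1 \<noteq> 0" "monom b n2 \<noteq> 0" using ab by simp_all
    have "exp ((cmod \<gamma>)\<^sup>2) / 2 > 0" by simp
    from polynomial_system_iff[OF this nz, THEN iffD2, OF disjI1] show ?W
      unfolding Uw Vw progressive_wave_polynomials_iff using ab l m \<alpha> by blast
  next
    assume ?II
    then obtain K \<theta> \<theta>1 \<theta>2 \<gamma> where K: "K > 0"
      and U: "\<And>z. U z = of_real K * exp (\<i> * of_real \<theta>1) * (1 / 2 * phi 0 \<gamma> z + of_real (sqrt 3 / 2) * \<i> * exp (\<i> * of_real \<theta>) * phi 1 \<gamma> z)"
      and V: "\<And>z. V z = of_real K * exp (\<i> * of_real \<theta>2) * (1 / 2 * phi 0 \<gamma> z - of_real (sqrt 3 / 2) * \<i> * exp (\<i> * of_real \<theta>) * phi 1 \<gamma> z)"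
      and lam: "lam = K\<^sup>2 / (32 * pi) * (7 + 2 * sqrt 3 * Im (\<gamma> * exp (- \<i> * of_real \<theta>)))"
      and mu: "mu = K\<^sup>2 / (32 * pi) * (- 7 + 2 * sqrt 3 * Im (\<gamma> * exp (- \<i> * of_real \<theta>)))"
      and \<alpha>: "\<alpha> = of_real (sqrt 3 / (32 * pi) * K\<^sup>2) * exp (- \<i> * of_real \<theta>)" by blast
    define p0 where "p0 = of_real K * exp (\<i> * of_real \<theta>1) / 2 * complex_of_real (phi_coeff \<gamma> 0)"
    define p1 where "p1 = of_real (sqrt 3) * \<i> * exp (\<i> * of_real \<theta>) * p0"
    define r0 where "r0 = of_real K * exp (\<i> * of_real \<theta>2) / 2 * complex_of_real (phi_coeff \<gamma> 0)"
    define r1 where "r1 = of_real (sqrt 3) * \<i> * - exp (\<i> * of_real \<theta>) * r0"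
    have nz0: "p0 \<noteq> 0" "r0 \<noteq> 0" using K phi_coeff_pos[of \<gamma> 0] by (simp_all add: p0_def r0_def)
    then have nz: "p0 \<noteq> 0" "p1 \<noteq> 0" "r0 \<noteq> 0" "r1 \<noteq> 0" by (simp_all add: p1_def r1_def)
    have Uw: "U = fock (wave 1 [:p0, p1:] \<gamma>)"
      by (rule ext) (simp only: U fock_linear[OF p0_def p1_def])
    have Vw: "V = fock (wave 1 [:r0, r1:] \<gamma>)"
      by (rule ext) (simp add: V fock_linear[OF r0_def r1_def])
    have c: "exp ((cmod \<gamma>)\<^sup>2) / 2 > 0" by simp
    have 1: "(cmod r0)\<^sup>2 = (cmod p0)\<^sup>2"
      unfolding linear_constants(4)[OF p0_def p1_def] linear_constants(4)[OF r0_def refl] ..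
    have 2: "r0 * p1 = - (p0 * r1)" by (simp add: p1_def r1_def)
    have l: "lam - 2 * Im (\<alpha> * \<gamma>) = 7 * (exp ((cmod \<gamma>)\<^sup>2) / 2) * (cmod p0)\<^sup>2 / 4"
      unfolding linear_constants(1)[OF p0_def p1_def] galilean_shift[OF \<alpha>] by (rule lam)
    have m: "mu - 2 * Im (\<alpha> * \<gamma>) = - (7 * (exp ((cmod \<gamma>)\<^sup>2) / 2) * (cmod p0)\<^sup>2 / 4)"
    proof -
      have "mu - 2 * Im (\<alpha> * \<gamma>) = - 7 * K\<^sup>2 / (32 * pi)" unfolding galilean_shift[OF \<alpha>] by (rule mu)
      then show ?thesis unfolding linear_constants(1)[OF p0_def p1_def] by simp
    qed
    have al: "\<alpha> = \<i> * of_real (exp ((cmod \<gamma>)\<^sup>2) / 2) * p0 * cnj p1 / 4"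
      unfolding linear_constants(2)[OF p0_def p1_def] by (rule \<alpha>)
    show ?W unfolding Uw Vw progressive_wave_polynomials_iff linear_system[OF c nz]
      using linear_constants(3)[OF p0_def p1_def] 1 2 l m al by blast
  qed
qed

end
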